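(* Let $n\ge 3$ and let $B\subset\mathbb R^n$ be a convex body with a smooth strictly convex boundary and with $0$ in its interior. Let $H\subset\mathbb R^n$ be a two-dimensional linear subspace and suppose that there is a neighborhood $\mathcal W$ of $H$ in the Grassmannian $\operatorname{Gr}_2(\mathbb R^n)$ such that for every $H'\in\mathcal W$ the cross-section $H'\cap B$ is linearly equivalent to $H\cap B$. Then $H\cap B$ is an ellipse centered at $0$, and furthermore $B$ coincides with an ellipsoid in a neighborhood of $H$, i.e. there exist a (solid) ellipsoid $E\subset\mathbb R^n$ and an open set $W\subset\mathbb R^n$ containing $H$ such that $B\cap W=E\cap W$.
   Context: $\operatorname{Gr}_k(V)$ is the Grassmannian of $k$-dimensional linear subspaces of a vector space $V$. "Smooth" means $C^\infty$. "Strictly convex" means quadratically strictly convex: the boundary is a hypersurface whose second fundamental form (with respect to the inner normal) is positive definite at every point. Two cross-sections $H\cap B$ and $H'\cap B$ are linearly equivalent if there is a linear bijection $H\to H'$ sending $H\cap B$ onto $H'\cap B$. An ellipse here means the region bounded by an ellipse in the plane. *)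

theory Defs
  imports "HOL-Analysis.Analysis"
begin

text \<open>For open \<open>U\<close>, \<open>C_diff_on k U f\<close> says that \<open>f\<close> is of class \<open>C\<^sup>k\<close> on \<open>U\<close>.\<close>

primrec C_diff_on :: "nat \<Rightarrow> 'a::euclidean_space set \<Rightarrow> ('a \<Rightarrow> 'b::euclidean_space) \<Rightarrow> bool" where
  "C_diff_on 0 U f \<longleftrightarrow> continuous_on U f"
| "C_diff_on (Suc k) U f \<longleftrightarrow>
     (\<forall>x\<in>U. f differentiable (at x)) \<and> (\<forall>v. C_diff_on k U (\<lambda>x. frechet_derivative f (at x) v))"

definition smooth_on :: "'a::euclidean_space set \<Rightarrow> ('a \<Rightarrow> 'b::euclidean_space) \<Rightarrow> bool" where
  "smooth_on U f \<longleftrightarrow> (\<forall>k. C_diff_on k U f)"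

definition smooth_hypersurface :: "'a::euclidean_space set \<Rightarrow> bool" where
  "smooth_hypersurface S \<longleftrightarrow>
     (\<forall>p\<in>S. \<exists>U (f :: 'a \<Rightarrow> real). open U \<and> p \<in> U \<and> smooth_on U f \<and>
        (\<forall>x\<in>U. frechet_derivative f (at x) \<noteq> (\<lambda>_. 0)) \<and> S \<inter> U = {x \<in> U. f x = 0})"

definition tangent_space :: "'a::euclidean_space set \<Rightarrow> 'a \<Rightarrow> 'a set" where
  "tangent_space S p =
     {v. \<exists>(\<gamma> :: real \<Rightarrow> 'a) e. e > 0 \<and> smooth_on {-e<..<e} \<gamma> \<and> \<gamma> ` {-e<..<e} \<subseteq> S \<and>
           \<gamma> 0 = p \<and> (\<gamma> has_vector_derivative v) (at 0)}"

text \<open>The description below determines a unique vector when \<open>B\<close> is a convex body whose boundary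
  is a smooth hypersurface and \<open>p\<close> is a boundary point.\<close>

definition inner_normal :: "'a::euclidean_space set \<Rightarrow> 'a \<Rightarrow> 'a" where
  "inner_normal B p =
     (THE \<nu>. norm \<nu> = 1 \<and> (\<forall>v\<in>tangent_space (frontier B) p. v \<bullet> \<nu> = 0) \<and>
             (\<exists>e>0. \<forall>t\<in>{0<..<e}. p + t *\<^sub>R \<nu> \<in> interior B))"

text \<open>Weingarten's formula \<open>II(v,w) = - \<langle>D\<^sub>v \<nu>, w\<rangle>\<close>, where \<open>\<nu>\<close> is the inner unit normal; with this sign
  the second fundamental form of a round ball is positive definite. The normal is differentiated
  within the boundary, since it is only defined there. Such a derivative is not
  unique as a linear map on the whole space, but its values on tangent vectors are.\<close>

definition second_fundamental_form :: "'a::euclidean_space set \<Rightarrow> 'a \<Rightarrow> 'a \<Rightarrow> 'a \<Rightarrow> real" where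
  "second_fundamental_form B p v w =
     - (frechet_derivative (inner_normal B) (at p within frontier B) v \<bullet> w)"

definition convex_body :: "'a::euclidean_space set \<Rightarrow> bool" where
  "convex_body B \<longleftrightarrow> convex B \<and> compact B \<and> interior B \<noteq> {}"

definition smooth_strictly_convex_boundary :: "'a::euclidean_space set \<Rightarrow> bool" where
  "smooth_strictly_convex_boundary B \<longleftrightarrow>
     smooth_hypersurface (frontier B) \<and>
     (\<forall>p\<in>frontier B. \<forall>v\<in>tangent_space (frontier B) p.
        v \<noteq> 0 \<longrightarrow> second_fundamental_form B p v v > 0)"

text \<open>A linear map between subspaces is represented by a linear map of the ambient space;
  every linear map on a subspace has such an extension.\<close>

definition linearly_equivalent_sections ::
    "'a::euclidean_space set \<Rightarrow> 'a set \<Rightarrow> 'a set \<Rightarrow> bool" where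
  "linearly_equivalent_sections B H H' \<longleftrightarrow>
     (\<exists>f :: 'a \<Rightarrow> 'a. linear f \<and> bij_betw f H H' \<and> f ` (H \<inter> B) = H' \<inter> B)"

definition grassmannian :: "nat \<Rightarrow> 'a::euclidean_space set set" where
  "grassmannian k = {H. subspace H \<and> dim H = k}"

definition frames :: "nat \<Rightarrow> (nat \<Rightarrow> 'a::euclidean_space) set" where
  "frames k = {b \<in> extensional {..<k}. inj_on b {..<k} \<and> independent (b ` {..<k})}"

definition frame_topology :: "nat \<Rightarrow> (nat \<Rightarrow> 'a::euclidean_space) topology" where
  "frame_topology k = subtopology (product_topology (\<lambda>_. euclidean) {..<k}) (frames k)"

text \<open>The Grassmannian carries the quotient topology of the map sending a frame to its span.\<close>

definition grassmannian_topology :: "nat \<Rightarrow> 'a::euclidean_space set topology" where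
  "grassmannian_topology k =
     topology (\<lambda>\<W>. \<W> \<subseteq> grassmannian k \<and>
       openin (frame_topology k) {b \<in> frames k. span (b ` {..<k}) \<in> \<W>})"

lemma topspace_frame_topology: "topspace (frame_topology k) = frames k"
  by (auto simp: frame_topology_def frames_def PiE_def)

lemma openin_grassmannian_topology:
  fixes \<W> :: "'a::euclidean_space set set"
  shows "openin (grassmannian_topology k) \<W> \<longleftrightarrow>
     \<W> \<subseteq> grassmannian k \<and> openin (frame_topology k) {b \<in> frames k. span (b ` {..<k}) \<in> \<W>}"
proof -
  let ?pre = "\<lambda>\<W> :: 'a set set. {b \<in> frames k. span (b ` {..<k}) \<in> \<W>}"
  have "istopology (\<lambda>\<W> :: 'a set set. \<W> \<subseteq> grassmannian k \<and> openin (frame_topology k) (?pre \<W>))"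
    unfolding istopology_def
  proof (intro conjI allI impI)
    fix S T :: "'a set set"
    assume S: "S \<subseteq> grassmannian k \<and> openin (frame_topology k) (?pre S)"
      and T: "T \<subseteq> grassmannian k \<and> openin (frame_topology k) (?pre T)"
    show "S \<inter> T \<subseteq> grassmannian k" using S by blast
    have "?pre (S \<inter> T) = ?pre S \<inter> ?pre T" by blast
    then show "openin (frame_topology k) (?pre (S \<inter> T))" using S T by auto
  next
    fix \<K> :: "'a set set set"
    assume K: "\<forall>K\<in>\<K>. K \<subseteq> grassmannian k \<and> openin (frame_topology k) (?pre K)"
    then show "\<Union>\<K> \<subseteq> grassmannian k" by blast
    have "?pre (\<Union>\<K>) = \<Union>(?pre ` \<K>)" by blast
    then show "openin (frame_topology k) (?pre (\<Union>\<K>))" using K by auto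
  qed
  then show ?thesis
    by (simp add: grassmannian_topology_def topology_inverse')
qed

lemma span_frame_in_grassmannian:
  assumes "b \<in> frames k"
  shows "span (b ` {..<k}) \<in> grassmannian k"
  using assms by (auto simp: frames_def grassmannian_def dim_eq_card_independent card_image)

lemma grassmannian_frame_exists:
  fixes H :: "'a::euclidean_space set"
  assumes "H \<in> grassmannian k"
  obtains b where "b \<in> frames k" "span (b ` {..<k}) = H"
proof -
  have H: "subspace H" "dim H = k" using assms by (auto simp: grassmannian_def)
  obtain X where X: "X \<subseteq> H" "independent X" "H \<subseteq> span X" "card X = k"
    using basis_exists[of H] unfolding H(2) by blast
  then have "finite X" using independent_imp_finite by blast
  then obtain g where g: "bij_betw g {..<k} X"
    using X(4) ex_bij_betw_nat_finite[OF \<open>finite X\<close>] by (auto simp: atLeast0LessThan)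
  have im: "restrict g {..<k} ` {..<k} = X"
    using g by (auto simp: bij_betw_def)
  have "restrict g {..<k} \<in> frames k"
    using g X im by (auto simp: frames_def bij_betw_def)
  moreover have "span X = H"
    using X H by (intro span_subspace)
  ultimately show ?thesis using that[of "restrict g {..<k}"] im by simp
qed

lemma topspace_grassmannian_topology:
  "topspace (grassmannian_topology k :: 'a::euclidean_space set topology) = grassmannian k"
proof (rule antisym)
  show "topspace (grassmannian_topology k :: 'a set topology) \<subseteq> grassmannian k"
    using openin_topspace[of "grassmannian_topology k :: 'a set topology"]
    unfolding openin_grassmannian_topology by blast
  have "{b :: nat \<Rightarrow> 'a. b \<in> frames k \<and> span (b ` {..<k}) \<in> grassmannian k} = topspace (frame_topology k)"
    using span_frame_in_grassmannian by (auto simp: topspace_frame_topology)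
  then have "openin (grassmannian_topology k) (grassmannian k :: 'a set set)"
    unfolding openin_grassmannian_topology by simp
  then show "(grassmannian k :: 'a set set) \<subseteq> topspace (grassmannian_topology k)"
    by (rule openin_subset)
qed

lemma quotient_map_span:
  "quotient_map (frame_topology k) (grassmannian_topology k)
     (\<lambda>b :: nat \<Rightarrow> 'a::euclidean_space. span (b ` {..<k}))"
proof -
  have "(\<lambda>b :: nat \<Rightarrow> 'a. span (b ` {..<k})) ` frames k = grassmannian k"
  proof (intro equalityI subsetI)
    fix H :: "'a set"
    assume "H \<in> grassmannian k"
    then obtain b where "b \<in> frames k" "span (b ` {..<k}) = H"
      by (rule grassmannian_frame_exists)
    then show "H \<in> (\<lambda>b. span (b ` {..<k})) ` frames k" by blast
  qed (auto intro: span_frame_in_grassmannian)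
  then show ?thesis
    by (simp add: quotient_map_def topspace_frame_topology topspace_grassmannian_topology
        openin_grassmannian_topology)
qed

text \<open>\<open>E\<close> is the solid ellipsoid in the affine subspace \<open>c + V\<close> with centre \<open>c\<close>: the orthonormal basis
  \<open>A\<close> of \<open>V\<close> consists of the directions of its principal axes, \<open>r\<close> gives the lengths of the semi-axes.\<close>

definition solid_ellipsoid_in :: "'a::euclidean_space set \<Rightarrow> 'a \<Rightarrow> 'a set \<Rightarrow> bool" where
  "solid_ellipsoid_in V c E \<longleftrightarrow>
     (\<exists>A (r :: 'a \<Rightarrow> real). pairwise orthogonal A \<and> (\<forall>a\<in>A. norm a = 1) \<and> span A = V \<and>
        (\<forall>a\<in>A. r a > 0) \<and> E = {x. x - c \<in> V \<and> (\<Sum>a\<in>A. (((x - c) \<bullet> a) / r a)\<^sup>2) \<le> 1})"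

definition solid_ellipsoid :: "'a::euclidean_space set \<Rightarrow> bool" where
  "solid_ellipsoid E \<longleftrightarrow> (\<exists>c. solid_ellipsoid_in UNIV c E)"

definition solid_ellipse_in :: "'a::euclidean_space set \<Rightarrow> 'a \<Rightarrow> 'a set \<Rightarrow> bool" where
  "solid_ellipse_in V c E \<longleftrightarrow> dim V = 2 \<and> solid_ellipsoid_in V c E"

end

theory Submission
  imports Defs
begin

text \<open>Let \<open>F\<close> be the Minkowski functional of \<open>B\<close> and \<open>f\<close> its restriction to \<open>H\<close>, identified with the
  complex plane. A section near \<open>H\<close>, written as the graph of \<open>z \<mapsto> (p \<bullet> z) b\<close>, satisfies
  \<open>F (z + (p \<bullet> z) b) = f (A\<^sub>p z)\<close> for some linear map \<open>A\<^sub>p\<close> of \<open>H\<close>.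

  Suppose that no nonzero linear vector field on \<open>H\<close> is tangent to the level sets of \<open>f\<close>. Then \<open>A\<^sub>p\<close> can be
  chosen uniquely near the identity, it is differentiable along lines, and for \<open>P = A\<^sub>p\<inverse> \<partial>\<^sub>1 A\<^sub>p\<close> and
  \<open>Q = A\<^sub>p\<inverse> \<partial>\<^sub>2 A\<^sub>p\<close> the quadratic field \<open>y P z - x Q z\<close>, where \<open>z = x + i y\<close>, is tangent to the level sets
  of \<open>f \<circ> A\<^sub>p\<close>. Such a field has a linear factor, so it vanishes. Hence \<open>A\<^sub>p z\<close> depends only on \<open>z\<close> and
  \<open>p \<bullet> z\<close>, which forces \<open>A\<^sub>p z = z + (p \<bullet> z) c\<close>. But then \<open>F\<close> is constant on segments in direction
  \<open>b - c\<close>, against strict convexity.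

  So some nonzero linear vector field is tangent to the level sets of \<open>f\<close>; it can only generate an elliptic
  rotation, and \<open>f\<^sup>2\<close> is a quadratic form. Therefore \<open>F\<^sup>2\<close> is quadratic on every plane near \<open>H\<close>, and the
  symmetry \<open>d(F\<^sup>2)\<^sub>u v = d(F\<^sup>2)\<^sub>v u\<close> makes it a quadratic form on a neighbourhood of \<open>H - {0}\<close>. Strict convexity
  makes this form positive definite on the whole space.\<close>

section \<open>Functions of class \<open>C\<^sup>k\<close>\<close>

text \<open>The hypothesis yields some linear map for each parameter \<open>p\<close>, with no
  regularity in \<open>p\<close>, and \<open>F\<close> is differentiated only once. The maps are
  therefore controlled by compactness: difference quotients either stay bounded or, rescaled to norm
  one, tend to a linear field tangent to the level sets of \<open>f\<close>. Excluding such fields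
  isolates the identity among the linear symmetries of \<open>f\<close> and makes the difference
  quotients of \<open>A\<close> converge. Since derivatives of a convex gauge are supporting
  functionals, tangency of \<open>v\<close> at \<open>z\<close> amounts to
  \<open>f z \<le> f (z + s v)\<close> for all \<open>s\<close>. This inequality passes to limits
  without appeal to continuity of the derivative. The second fundamental form enters through one
  consequence: \<open>F\<close> is constant on no nondegenerate segment. That is used twice, to
  exclude affine families \<open>A\<close> and to make the final form positive definite.\<close>

lemma C_diff_on_cong:
  assumes "open U" "\<And>x. x \<in> U \<Longrightarrow> f x = g x" "C_diff_on k U f"
  shows "C_diff_on k U g"
  using assms(2,3)
proof (induction k arbitrary: f g)
  case 0
  then show ?case using continuous_on_cong[of U U f g] by simp
next
  case (Suc k)
  have d: "(g has_derivative frechet_derivative f (at x)) (at x)" if "x \<in> U" for x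
  proof -
    have "(f has_derivative frechet_derivative f (at x)) (at x)"
      using Suc.prems(2) that by (simp add: frechet_derivative_works)
    then show ?thesis
      by (rule has_derivative_transform_within_open[OF _ assms(1) that]) (use Suc.prems(1) in auto)
  qed
  have e: "frechet_derivative f (at x) = frechet_derivative g (at x)" if "x \<in> U" for x
    using frechet_derivative_at[OF d[OF that]] .
  have "C_diff_on k U (\<lambda>x. frechet_derivative g (at x) v)" for v
    by (rule Suc.IH[of "\<lambda>x. frechet_derivative f (at x) v"]) (use e Suc.prems(2) in simp_all)
  then show ?case using d by (auto simp: differentiable_def)
qed

lemma C_diff_on_SucD: "C_diff_on (Suc k) U f \<Longrightarrow> C_diff_on k U f"
proof (induction k arbitrary: f)
  case 0
  then show ?case
    by (auto intro!: continuous_at_imp_continuous_on differentiable_imp_continuous_within)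
qed simp

text \<open>The recursion refers to \<open>frechet_derivative\<close>, which agrees with the
  explicit derivative \<open>f'\<close> only on \<open>U\<close>. The congruence rule, valid for
  open \<open>U\<close>, exchanges the two.\<close>

lemma C_diff_on_SucI:
  assumes "open U" "\<And>x. x \<in> U \<Longrightarrow> (f has_derivative f' x) (at x)"
    and "\<And>v. C_diff_on k U (\<lambda>x. f' x v)"
  shows "C_diff_on (Suc k) U f"
proof -
  have e: "f' x = frechet_derivative f (at x)" if "x \<in> U" for x
    using frechet_derivative_at[OF assms(2)[OF that]] .
  have "C_diff_on k U (\<lambda>x. frechet_derivative f (at x) v)" for v
    by (rule C_diff_on_cong[OF assms(1) _ assms(3)[of v]]) (simp add: e)
  then show ?thesis using assms(2) by (auto simp: differentiable_def)
qed

lemma C_diff_on_SucE: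
  assumes "C_diff_on (Suc k) U f"
  shows "\<And>x. x \<in> U \<Longrightarrow> (f has_derivative frechet_derivative f (at x)) (at x)"
    and "\<And>v. C_diff_on k U (\<lambda>x. frechet_derivative f (at x) v)"
  using assms by (auto simp: frechet_derivative_works)

lemma C_diff_on_const: "C_diff_on k U (\<lambda>_. c)"
  by (induction k arbitrary: c) auto

lemma C_diff_on_bounded_linear:
  assumes L: "bounded_linear L" and U: "open U"
  shows "C_diff_on k U f \<Longrightarrow> C_diff_on k U (\<lambda>x. L (f x))"
proof (induction k arbitrary: f)
  case 0
  then show ?case
    using bounded_linear.continuous_on[OF L] by simp
next
  case (Suc k)
  note S = C_diff_on_SucE[OF Suc.prems]
  show ?case
    by (rule C_diff_on_SucI[OF U bounded_linear.has_derivative[OF L S(1)] Suc.IH[OF S(2)]])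
qed

lemma C_diff_on_add:
  assumes U: "open U"
  shows "C_diff_on k U f \<Longrightarrow> C_diff_on k U g \<Longrightarrow> C_diff_on k U (\<lambda>x. f x + g x)"
proof (induction k arbitrary: f g)
  case 0
  then show ?case by (simp add: continuous_on_add)
next
  case (Suc k)
  note S = C_diff_on_SucE[OF Suc.prems(1)] C_diff_on_SucE[OF Suc.prems(2)]
  show ?case
    by (rule C_diff_on_SucI[OF U has_derivative_add[OF S(1) S(3)] Suc.IH[OF S(2) S(4)]])
qed

lemma C_diff_on_sum:
  assumes "open U" "\<And>i. i \<in> I \<Longrightarrow> C_diff_on k U (f i)"
  shows "C_diff_on k U (\<lambda>x. \<Sum>i\<in>I. f i x)"
  using assms(2)
proof (induction I rule: infinite_finite_induct)
  case (insert i I)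
  then show ?case using C_diff_on_add[OF assms(1), of k "f i"] by simp
qed (simp_all add: C_diff_on_const)

lemma C_diff_on_scaleR:
  assumes U: "open U"
  shows "C_diff_on k U f \<Longrightarrow> C_diff_on k U g \<Longrightarrow> C_diff_on k U (\<lambda>x. f x *\<^sub>R g x)"
proof (induction k arbitrary: f g)
  case 0
  then show ?case by (simp add: continuous_on_scaleR)
next
  case (Suc k)
  note S = C_diff_on_SucE[OF Suc.prems(1)] C_diff_on_SucE[OF Suc.prems(2)]
  note D = Suc.prems[THEN C_diff_on_SucD]
  show ?case
    by (rule C_diff_on_SucI[OF U has_derivative_scaleR[OF S(1) S(3)]])
       (auto intro!: C_diff_on_add U Suc.IH S(2,4) D)
qed

lemma C_diff_on_inverse:
  fixes f :: "'a::euclidean_space \<Rightarrow> real"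
  assumes U: "open U"
  shows "C_diff_on k U f \<Longrightarrow> (\<And>x. x \<in> U \<Longrightarrow> f x \<noteq> 0) \<Longrightarrow> C_diff_on k U (\<lambda>x. inverse (f x))"
proof (induction k arbitrary: f)
  case 0
  then show ?case by (simp add: continuous_on_inverse)
next
  case (Suc k)
  note S = C_diff_on_SucE[OF Suc.prems(1)]
  have I: "C_diff_on k U (\<lambda>x. inverse (f x))"
    by (rule Suc.IH[OF C_diff_on_SucD[OF Suc.prems(1)] Suc.prems(2)])
  have "C_diff_on k U (\<lambda>x. - (inverse (f x) * frechet_derivative f (at x) v * inverse (f x)))" for v
  proof -
    have "C_diff_on k U (\<lambda>x. (-1) *\<^sub>R inverse (f x) *\<^sub>R frechet_derivative f (at x) v *\<^sub>R inverse (f x))"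
      by (intro C_diff_on_scaleR U C_diff_on_const I S(2))
    then show ?thesis by (simp add: mult.assoc)
  qed
  then show ?case
    by (intro C_diff_on_SucI[OF U Deriv.has_derivative_inverse[OF Suc.prems(2) S(1)]])
qed

lemma C_diff_on_compose:
  fixes g :: "'a::euclidean_space \<Rightarrow> 'b::euclidean_space" and c :: "'c::euclidean_space \<Rightarrow> 'a"
  assumes T: "open T" and cT: "c ` T \<subseteq> U"
  shows "C_diff_on k U g \<Longrightarrow> C_diff_on k T c \<Longrightarrow> C_diff_on k T (\<lambda>t. g (c t))"
proof (induction k arbitrary: g)
  case 0
  then show ?case using continuous_on_compose2[OF _ _ cT] by auto
next
  case (Suc k)
  note S = C_diff_on_SucE[OF Suc.prems(1)] C_diff_on_SucE[OF Suc.prems(2)]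
  note D = C_diff_on_SucD[OF Suc.prems(2)]
  have c: "c t \<in> U" if "t \<in> T" for t using cT that by blast
  \<comment> \<open>The direction fed to the derivative of \<open>g\<close> moves with
    \<open>t\<close>, while \<open>C_diff_on\<close> gives regularity for fixed directions.
    Expansion in the basis leaves fixed directions with scalar coefficients.\<close>
  have "C_diff_on k T (\<lambda>t. frechet_derivative g (at (c t)) (frechet_derivative c (at t) v))" for v
  proof (rule C_diff_on_cong[OF T])
    show "C_diff_on k T (\<lambda>t. \<Sum>i\<in>Basis. (frechet_derivative c (at t) v \<bullet> i) *\<^sub>R frechet_derivative g (at (c t)) i)"
      by (intro C_diff_on_sum T C_diff_on_scaleR C_diff_on_bounded_linear[OF bounded_linear_inner_left T]
          S(4) Suc.IH[OF S(2) D])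
    show "(\<Sum>i\<in>Basis. (frechet_derivative c (at t) v \<bullet> i) *\<^sub>R frechet_derivative g (at (c t)) i)
        = frechet_derivative g (at (c t)) (frechet_derivative c (at t) v)" if "t \<in> T" for t
    proof -
      interpret linear "frechet_derivative g (at (c t))"
        using has_derivative_linear[OF S(1)[OF c[OF that]]] .
      show ?thesis
        by (subst (2) euclidean_representation[symmetric]) (simp add: sum scaleR)
    qed
  qed
  then show ?case
    by (intro C_diff_on_SucI[OF T has_derivative_compose[OF S(3) S(1)[OF c]]])
qed

section \<open>Gauge functions\<close>

text \<open>The points \<open>X k\<close> may approach \<open>x\<close> along any path whose
  rescaled increments converge. This generality serves families of linear maps that are known only
  through difference quotients along sequences.\<close>

lemma has_derivative_sequentially:
  fixes f :: "'a::real_normed_vector \<Rightarrow> real"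
  assumes f: "(f has_derivative f') (at x)" and s: "s \<longlonglongrightarrow> 0" "\<And>k. s k \<noteq> 0"
    and X: "(\<lambda>k. (X k - x) /\<^sub>R s k) \<longlonglongrightarrow> Y"
  shows "(\<lambda>k. (f (X k) - f x) / s k) \<longlonglongrightarrow> f' Y"
proof -
  \<comment> \<open>Division by zero gives \<open>e 0 = 0\<close>, so differentiability says that
    \<open>e\<close> is continuous at \<open>0\<close>, and indices with \<open>X k = x\<close>
    cause no trouble.\<close>
  define e where "e h = norm (f (x + h) - f x - f' h) / norm h" for h
  define h where "h k = X k - x" for k
  have lin: "bounded_linear f'" using f by (rule has_derivative_bounded_linear)
  then have f'0: "f' 0 = 0" by (simp add: linear_simps)
  have hs: "h k = s k *\<^sub>R ((X k - x) /\<^sub>R s k)" for k using s(2) by (simp add: h_def)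
  have h0: "h \<longlonglongrightarrow> 0"
    unfolding hs using tendsto_scaleR[OF s(1) X] by simp
  have "e \<midarrow>0\<rightarrow> e 0" using f unfolding has_derivative_at e_def by simp
  then have "(\<lambda>k. e (h k)) \<longlonglongrightarrow> e 0"
    using h0 isCont_tendsto_compose[of 0 e h] by (simp add: isCont_def)
  then have e0: "(\<lambda>k. e (h k)) \<longlonglongrightarrow> 0" by (simp add: e_def)
  have lim: "(\<lambda>k. f' ((X k - x) /\<^sub>R s k)) \<longlonglongrightarrow> f' Y"
    by (rule bounded_linear.tendsto[OF lin X])
  have "(\<lambda>k. e (h k) * norm ((X k - x) /\<^sub>R s k)) \<longlonglongrightarrow> 0"
    using tendsto_mult[OF e0 tendsto_norm[OF X]] by simp
  then have "(\<lambda>k. (f (X k) - f x) / s k - f' ((X k - x) /\<^sub>R s k)) \<longlonglongrightarrow> 0"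
  proof (rule Lim_null_comparison[rotated], intro always_eventually allI)
    fix k
    have "f' ((X k - x) /\<^sub>R s k) = f' (h k) / s k"
      using linear_simps(5)[OF lin, of "inverse (s k)" "h k"] by (simp add: h_def divide_inverse_commute)
    then have "(f (X k) - f x) / s k - f' ((X k - x) /\<^sub>R s k) = (f (x + h k) - f x - f' (h k)) / s k"
      by (simp add: h_def diff_divide_distrib)
    also have "norm \<dots> = e (h k) * norm (h k) / \<bar>s k\<bar>"
      by (cases "h k = 0") (simp_all add: e_def f'0)
    also have "\<dots> = e (h k) * norm ((X k - x) /\<^sub>R s k)"
      by (simp add: h_def divide_inverse_commute)
    finally show "norm ((f (X k) - f x) / s k - f' ((X k - x) /\<^sub>R s k))
        \<le> e (h k) * norm ((X k - x) /\<^sub>R s k)" by simp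
  qed
  from tendsto_add[OF this lim] show ?thesis by simp
qed

text \<open>If infinitely many terms stayed away from \<open>L\<close>, compactness would give them
  a subsequential limit different from \<open>L\<close>.\<close>

lemma bounded_unique_limit_convergent:
  fixes X :: "nat \<Rightarrow> 'a::heine_borel"
  assumes "bounded (range X)"
    and "\<And>r l. strict_mono r \<Longrightarrow> (X \<circ> r) \<longlonglongrightarrow> l \<Longrightarrow> l = L"
  shows "X \<longlonglongrightarrow> L"
proof (rule ccontr)
  assume "\<not> X \<longlonglongrightarrow> L"
  then obtain e where "e > 0" and "\<exists>\<^sub>F k in sequentially. \<not> dist (X k) L < e"
    unfolding tendsto_iff frequently_def by auto
  then have "infinite {k. \<not> dist (X k) L < e}"
    by (simp add: frequently_cofinite flip: cofinite_eq_sequentially)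
  then obtain r :: "nat \<Rightarrow> nat" where r: "strict_mono r" "\<And>k. r k \<in> {k. \<not> dist (X k) L < e}"
    using infinite_enumerate by blast
  have "bounded (range (X \<circ> r))" using assms(1) by (rule bounded_subset) auto
  from bounded_imp_convergent_subsequence[OF this] obtain l q
    where q: "strict_mono q" "(X \<circ> r \<circ> q) \<longlonglongrightarrow> l" by (auto simp: o_def)
  have "l = L"
    using assms(2)[of "r \<circ> q" l] q r(1) by (auto simp: strict_mono_o o_assoc)
  with q(2) \<open>e > 0\<close> have "\<forall>\<^sub>F k in sequentially. dist (X (r (q k))) L < e"
    by (simp add: tendsto_iff)
  then show False using r(2) by (auto simp: eventually_sequentially)
qed

locale gauge =
  fixes F :: "'a::euclidean_space \<Rightarrow> real"
  assumes pos: "x \<noteq> 0 \<Longrightarrow> F x > 0"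
    and scale: "t \<ge> 0 \<Longrightarrow> F (t *\<^sub>R x) = t * F x"
    and subadd: "F (x + y) \<le> F x + F y"
begin

lemma zero [simp]: "F 0 = 0"
  using scale[of 0 0] by simp

lemma nonneg: "F x \<ge> 0"
  using pos[of x] by (cases "x = 0") auto

lemma eq_0_iff [simp]: "F x = 0 \<longleftrightarrow> x = 0"
  using pos[of x] by (cases "x = 0") auto

lemma convex: "convex_on UNIV F"
proof (rule convex_onI)
  fix t :: real and x y assume "0 < t" "t < 1"
  then show "F ((1 - t) *\<^sub>R x + t *\<^sub>R y) \<le> (1 - t) * F x + t * F y"
    using subadd[of "(1 - t) *\<^sub>R x" "t *\<^sub>R y"] by (simp add: scale)
qed simp

lemma continuous_on_gauge: "continuous_on S F"
  using convex_on_continuous[OF open_UNIV convex] continuous_on_subset by blast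

lemma tendsto_gauge: "(f \<longlongrightarrow> l) G \<Longrightarrow> ((\<lambda>x. F (f x)) \<longlongrightarrow> F l) G"
  using continuous_on_tendsto_compose[OF continuous_on_gauge[of UNIV], of f l G] by simp

lemma bounds: "\<exists>m C. m > 0 \<and> C > 0 \<and> (\<forall>x. m * norm x \<le> F x \<and> F x \<le> C * norm x)"
proof -
  have ne: "sphere (0::'a) 1 \<noteq> {}" by simp
  obtain a where a: "a \<in> sphere 0 1" "\<And>x. x \<in> sphere 0 1 \<Longrightarrow> F a \<le> F x"
    using continuous_attains_inf[OF compact_sphere ne continuous_on_gauge] by blast
  obtain b where b: "b \<in> sphere 0 1" "\<And>x. x \<in> sphere 0 1 \<Longrightarrow> F x \<le> F b"
    using continuous_attains_sup[OF compact_sphere ne continuous_on_gauge] by blast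
  have *: "F a * norm x \<le> F x \<and> F x \<le> F b * norm x" for x
  proof (cases "x = 0")
    case False
    then have "F x = norm x * F (x /\<^sub>R norm x)" by (simp add: scale)
    then show ?thesis using a(2)[of "x /\<^sub>R norm x"] b(2)[of "x /\<^sub>R norm x"] False
      by (simp add: mult.commute)
  qed simp
  have "F a > 0" "F b > 0" using a(1) b(1) by (auto intro!: pos)
  then show ?thesis using * by blast
qed

end

section \<open>Differentiable gauges and their supporting functionals\<close>

locale smooth_gauge = gauge F for F :: "'a::euclidean_space \<Rightarrow> real" +
  assumes diff: "x \<noteq> 0 \<Longrightarrow> F differentiable (at x)"
begin

abbreviation D :: "'a \<Rightarrow> 'a \<Rightarrow> real" where "D x \<equiv> frechet_derivative F (at x)"

lemma has_derivative: "x \<noteq> 0 \<Longrightarrow> (F has_derivative D x) (at x)"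
  using diff frechet_derivative_works by blast

lemma linear_D: "x \<noteq> 0 \<Longrightarrow> linear (D x)"
  using has_derivative has_derivative_linear by blast

lemma D_unique: "(F has_derivative L) (at x) \<Longrightarrow> D x = L"
  using frechet_derivative_at by metis

text \<open>Subadditivity bounds each difference quotient in direction \<open>y\<close> by
  \<open>F y\<close>. Together with \<open>D x x = F x\<close> this makes \<open>D x\<close> the
  supporting functional of the gauge at \<open>x\<close>.\<close>

lemma D_le: assumes "x \<noteq> 0" shows "D x y \<le> F y"
proof -
  define s where "s = (\<lambda>k. inverse (real (Suc k)))"
  have "(\<lambda>k. (F (x + s k *\<^sub>R y) - F x) / s k) \<longlonglongrightarrow> D x y"
    by (rule has_derivative_sequentially[OF has_derivative[OF assms]])
       (use LIMSEQ_inverse_real_of_nat in \<open>auto simp: s_def simp del: of_nat_Suc\<close>)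
  moreover have "(F (x + s k *\<^sub>R y) - F x) / s k \<le> F y" for k
    using subadd[of x "s k *\<^sub>R y"] by (simp add: scale s_def field_simps)
  ultimately show ?thesis using LIMSEQ_le_const2 by blast
qed

lemma D_self: assumes "x \<noteq> 0" shows "D x x = F x"
proof (rule antisym)
  show "D x x \<le> F x" by (rule D_le[OF assms])
  define s where "s k = inverse (real (Suc k))" for k
  have s: "s \<longlonglongrightarrow> 0" "s k > 0" for k
    unfolding s_def using LIMSEQ_inverse_real_of_nat by auto
  have "(\<lambda>k. (F (x + s k *\<^sub>R x) - F x) / s k) \<longlonglongrightarrow> D x x"
    by (rule has_derivative_sequentially[OF has_derivative[OF assms] s(1)])
       (use s(2) in \<open>auto simp: less_imp_neq[THEN not_sym]\<close>)
  moreover have "(F (x + s k *\<^sub>R x) - F x) / s k = F x" for k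
    using scale[of "1 + s k" x] s(2)[of k] by (simp add: algebra_simps add_divide_distrib)
  ultimately show "F x \<le> D x x" by (simp add: LIMSEQ_const_iff)
qed

text \<open>\<open>F - L\<close> is nonnegative and vanishes at \<open>x\<close>, so its derivative
  at this minimum is zero: supporting functionals of a differentiable gauge are unique.\<close>

lemma D_eqI:
  assumes "x \<noteq> 0" "linear L" "\<And>y. L y \<le> F y" "L x = F x"
  shows "D x = L"
proof -
  have "((\<lambda>y. F y - L y) has_derivative (\<lambda>y. D x y - L y)) (at x)"
    using has_derivative[OF assms(1)] assms(2)
    by (intro has_derivative_diff linear_imp_has_derivative) auto
  then have "(\<lambda>y. D x y - L y) = (\<lambda>v. 0)"
    by (intro differential_zero_maxmin[where S = UNIV and x = x and f = "\<lambda>y. F y - L y"])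
       (use assms in auto)
  then show ?thesis by (metis eq_iff_diff_eq_0 ext)
qed

lemma D_scale: assumes "x \<noteq> 0" "t > 0" shows "D (t *\<^sub>R x) = D x"
proof (rule D_eqI)
  show "D x (t *\<^sub>R x) = F (t *\<^sub>R x)"
    using assms D_self linear_scale[OF linear_D] scale by simp
qed (use assms D_le linear_D in auto)

lemma constant_along_curve:
  assumes "\<And>t. (c has_vector_derivative c' t) (at t)" "\<And>t. c t \<noteq> 0" "\<And>t. D (c t) (c' t) = 0"
  shows "F (c s) = F (c t)"
proof (rule DERIV_isconst_all[of "\<lambda>t. F (c t)"], intro allI)
  fix t
  interpret Dc: linear "D (c t)" by (rule linear_D[OF assms(2)])
  show "((\<lambda>t. F (c t)) has_real_derivative 0) (at t)"
    using has_derivative_compose[OF assms(1)[of t, unfolded has_vector_derivative_def]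
        has_derivative[OF assms(2)[of t]]] assms(3)[of t]
    by (simp add: has_field_derivative_def Dc.scale lambda_zero)
qed

lemma pullback:
  assumes "linear J" "inj J"
  shows "smooth_gauge (\<lambda>z. F (J z))"
    and "z \<noteq> 0 \<Longrightarrow> frechet_derivative (\<lambda>z. F (J z)) (at z) h = D (J z) (J h)"
proof -
  interpret J: linear J by fact
  have J0: "J z \<noteq> 0" if "z \<noteq> 0" for z
    using that assms(2) by (metis J.zero injD)
  have d: "((\<lambda>z. F (J z)) has_derivative (\<lambda>h. D (J z) (J h))) (at z)" if "z \<noteq> 0" for z
    by (rule has_derivative_compose[OF linear_imp_has_derivative[OF assms(1)] has_derivative[OF J0[OF that]]])
  then show "smooth_gauge (\<lambda>z. F (J z))"
    by unfold_locales (auto simp: J.scaleR J.add scale subadd J0 pos differentiable_def)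
  show "frechet_derivative (\<lambda>z. F (J z)) (at z) h = D (J z) (J h)" if "z \<noteq> 0"
    using frechet_derivative_at[OF d[OF that]] by metis
qed

end

section \<open>Linear and quadratic fields tangent to the level sets of a planar gauge\<close>

lemma odd_continuous_zero:
  fixes g :: "complex \<Rightarrow> real"
  assumes "continuous_on UNIV g" "\<And>z. g (- z) = - g z"
  obtains z where "z \<noteq> 0" "g z = 0"
proof -
  have c: "continuous_on {0..pi} (\<lambda>t. g (cis t))"
    by (intro continuous_on_compose2[OF assms(1)] continuous_intros) auto
  have pi: "g (cis pi) = - g (cis 0)" using assms(2)[of 1] by simp
  have "\<exists>t\<in>{0..pi}. g (cis t) = 0"
  proof (cases "g (cis 0) \<le> 0")
    case True
    then show ?thesis using IVT'[OF _ _ pi_ge_zero c, of 0] pi by auto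
  next
    case False
    then show ?thesis using IVT2'[OF _ _ pi_ge_zero c, of 0] pi by auto
  qed
  then obtain t where "g (cis t) = 0" by blast
  then show ?thesis using that[of "cis t"] by simp
qed

lemma linear_Re_Im:
  assumes "linear (Y :: complex \<Rightarrow> 'b::real_vector)"
  shows "Y z = Re z *\<^sub>R Y 1 + Im z *\<^sub>R Y \<i>"
proof -
  interpret linear Y by fact
  have "z = Re z *\<^sub>R 1 + Im z *\<^sub>R \<i>" by (simp add: complex_eq_iff)
  from arg_cong[OF this, of Y] show ?thesis by (simp only: add scaleR)
qed

text \<open>Equivalently, \<open>f\<close> is invariant under a nontrivial one-parameter group of linear maps.\<close>

definition rotation_like :: "(complex \<Rightarrow> real) \<Rightarrow> bool" where
  "rotation_like f \<longleftrightarrow> (\<exists>Y. linear Y \<and> Y \<noteq> (\<lambda>_. 0) \<and>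
     (\<forall>z. z \<noteq> 0 \<longrightarrow> frechet_derivative f (at z) (Y z) = 0))"

lemma not_rotation_likeD:
  assumes "\<not> rotation_like f" "linear Y" "\<And>z. z \<noteq> 0 \<Longrightarrow> frechet_derivative f (at z) (Y z) = 0"
  shows "Y z = 0"
  using assms unfolding rotation_like_def by metis

locale planar_gauge = smooth_gauge f for f :: "complex \<Rightarrow> real"
begin

text \<open>Where \<open>z\<close> and \<open>X z\<close> are parallel, \<open>X\<close> vanishes. So the two components of the quadratic vector field
  \<open>X\<close> have a common linear factor, and the other factor \<open>Y\<close> is a linear field with \<open>D z (Y z) = 0\<close>.\<close>

lemma tangent_quadratic_field_zero:
  assumes nr: "\<not> rotation_like f" and P: "linear P" and Q: "linear Q"
    and X: "\<And>z. z \<noteq> 0 \<Longrightarrow> D z (Im z *\<^sub>R P z - Re z *\<^sub>R Q z) = 0"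
  shows "Im z *\<^sub>R P z = Re z *\<^sub>R Q z"
proof -
  interpret P: linear P by fact
  interpret Q: linear Q by fact
  define X where "X z = Im z *\<^sub>R P z - Re z *\<^sub>R Q z" for z
  have cP: "continuous_on UNIV P" and cQ: "continuous_on UNIV Q"
    by (rule linear_continuous_on, use P Q in \<open>simp add: linear_conv_bounded_linear\<close>)+
  \<comment> \<open>\<open>Im (cnj z * X z)\<close> is the determinant of \<open>z\<close> and
    \<open>X z\<close>. It is homogeneous of degree three, hence odd, and at a nonzero zero
    \<open>z0\<close> the vector \<open>X z0\<close> is a multiple of \<open>z0\<close>.\<close>
  obtain z0 where z0: "z0 \<noteq> 0" "Im (cnj z0 * X z0) = 0"
  proof (rule odd_continuous_zero)
    show "continuous_on UNIV (\<lambda>z. Im (cnj z * X z))"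
      unfolding X_def by (intro continuous_intros cP cQ)
    show "Im (cnj (- z) * X (- z)) = - Im (cnj z * X z)" for z
      by (simp add: X_def P.neg Q.neg algebra_simps)
  qed
  define l where "l = Re (cnj z0 * X z0) / (norm z0)\<^sup>2"
  have "cnj z0 * X z0 = complex_of_real (l * (norm z0)\<^sup>2)"
    using z0 by (simp add: complex_eq_iff l_def)
  then have "cnj z0 * X z0 = cnj z0 * (l *\<^sub>R z0)"
    by (simp add: complex_norm_square scaleR_conv_of_real algebra_simps flip: of_real_power)
  then have lz: "X z0 = l *\<^sub>R z0" using z0(1) by (metis complex_cnj_zero_iff mult_left_cancel)
  \<comment> \<open>The radial derivative \<open>D z0 z0 = f z0\<close> is positive, so a radial
    vector tangent to the level set vanishes.\<close>
  have "l * f z0 = 0"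
    using X[OF z0(1)] lz linear_scale[OF linear_D[OF z0(1)]] D_self[OF z0(1)] by (simp add: X_def)
  then have Xz0: "X z0 = 0" using z0(1) lz by simp
  define z1 where "z1 = \<i> * z0"
  define a where "a z = Re (inverse z0 * z)" for z
  define b where "b z = Im (inverse z0 * z)" for z
  have ab: "z = a z *\<^sub>R z0 + b z *\<^sub>R z1" for z
  proof -
    have "complex_of_real (a z) + \<i> * complex_of_real (b z) = inverse z0 * z"
      unfolding a_def b_def by (simp add: complex_eq_iff)
    then have "z = (complex_of_real (a z) + \<i> * complex_of_real (b z)) * z0"
      using z0(1) by (simp only:) simp
    then show ?thesis by (simp add: z1_def scaleR_conv_of_real algebra_simps)
  qed
  \<comment> \<open>\<open>C\<close> is the mixed term of the quadratic map \<open>X\<close> at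
    \<open>z0\<close> and \<open>z1\<close>. As \<open>X z0 = 0\<close>, every remaining term of
    \<open>X\<close> in the coordinates \<open>a\<close>, \<open>b\<close> is divisible by
    \<open>b\<close>, and the cofactor \<open>Y\<close> is linear.\<close>
  define C where "C = Im z0 *\<^sub>R P z1 + Im z1 *\<^sub>R P z0 - Re z0 *\<^sub>R Q z1 - Re z1 *\<^sub>R Q z0"
  define Y where "Y z = a z *\<^sub>R C + b z *\<^sub>R X z1" for z
  have Xab: "X (s *\<^sub>R z0 + t *\<^sub>R z1) = s\<^sup>2 *\<^sub>R X z0 + t *\<^sub>R (s *\<^sub>R C + t *\<^sub>R X z1)" for s t
    by (simp add: X_def C_def P.add P.scaleR Q.add Q.scaleR algebra_simps power2_eq_square)
  have XY: "X z = b z *\<^sub>R Y z" for z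
    by (subst ab) (simp add: Xab Xz0 Y_def)
  have linY: "linear Y"
    by (rule linearI) (auto simp: Y_def a_def b_def distrib_left scaleR_add_left scaleR_add_right)
  have DY: "D z (Y z) = 0" if "z \<noteq> 0" "b z \<noteq> 0" for z
    using X[OF that(1), folded X_def] XY[of z] that linear_scale[OF linear_D[OF that(1)]] by simp
  have "f z \<le> f (z + s *\<^sub>R Y z)" if "z \<noteq> 0" "b z \<noteq> 0" for z s
    using D_le[OF that(1), of "z + s *\<^sub>R Y z"] DY[OF that] D_self[OF that(1)]
    by (simp add: linear_add linear_scale linear_D[OF that(1)])
  note le = this
  \<comment> \<open>On the line \<open>b z = 0\<close> the tangency of \<open>Y\<close> cannot be
    read off from \<open>X\<close>. The inequality given by the supporting functional off this line
    passes to the limit, and it says that \<open>s = 0\<close> is a minimum of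
    \<open>f (z + s Y z)\<close>.\<close>
  have le0: "f z \<le> f (z + s *\<^sub>R Y z)" if "z \<noteq> 0" "b z = 0" for z s
  proof -
    define w where "w k = z + inverse (real (Suc k)) *\<^sub>R z1" for k
    have w: "w \<longlonglongrightarrow> z"
      unfolding w_def using tendsto_add[OF tendsto_const tendsto_scaleR[OF LIMSEQ_inverse_real_of_nat tendsto_const]]
      by force
    have "inverse z0 * z1 = \<i>" using z0(1) by (simp add: z1_def)
    then have "b (w k) = b z + inverse (real (Suc k))" for k
      unfolding w_def b_def distrib_left mult_scaleR_right by simp
    then have bw: "b (w k) \<noteq> 0" for k
      using that(2) by simp
    then have w0: "w k \<noteq> 0" for k by (metis b_def mult_zero_right zero_complex.sel(2))
    have "(\<lambda>k. Y (w k)) \<longlonglongrightarrow> Y z"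
      using w linY by (simp add: bounded_linear.tendsto linear_conv_bounded_linear)
    then have "(\<lambda>k. f (w k + s *\<^sub>R Y (w k))) \<longlonglongrightarrow> f (z + s *\<^sub>R Y z)"
      by (intro tendsto_gauge tendsto_intros w)
    moreover have "(\<lambda>k. f (w k)) \<longlonglongrightarrow> f z" by (intro tendsto_gauge w)
    ultimately show ?thesis using le[OF w0 bw] by (intro LIMSEQ_le) auto
  qed
  have "D z (Y z) = 0" if "z \<noteq> 0" for z
  proof (cases "b z = 0")
    case True
    interpret Dz: linear "D z" by (rule linear_D[OF that])
    have "(\<lambda>h. D z (h *\<^sub>R Y z)) = (\<lambda>v::real. 0)"
    proof (rule differential_zero_maxmin[where S = UNIV and x = 0 and f = "\<lambda>s. f (z + s *\<^sub>R Y z)"])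
      show "((\<lambda>s. f (z + s *\<^sub>R Y z)) has_derivative (\<lambda>h. D z (h *\<^sub>R Y z))) (at 0)"
        by (rule has_derivative_compose[of "\<lambda>s. z + s *\<^sub>R Y z"])
           (use has_derivative[OF that] in \<open>auto intro!: derivative_eq_intros\<close>)
    qed (use le0[OF that True] in auto)
    then have "D z (1 *\<^sub>R Y z) = 0" by metis
    then show ?thesis by simp
  qed (use that DY in auto)
  then have "Y z = 0" by (intro not_rotation_likeD[OF nr linY])
  then have "X z = 0" using XY by simp
  then show ?thesis by (simp add: X_def)
qed

text \<open>The linear field \<open>Y\<close> is conjugate to a multiple of a rotation, because the flow of \<open>Y\<close> preserves \<open>f\<close>.
  A real eigenvalue of \<open>Y\<close> vanishes, and a nilpotent \<open>Y\<close> would move a point along a line.\<close>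

lemma rotation_like_quadratic:
  assumes "rotation_like f"
  obtains p q r where "\<And>z. (f z)\<^sup>2 = p * (Re z)\<^sup>2 + q * (Re z * Im z) + r * (Im z)\<^sup>2"
proof -
  obtain Y where Y: "linear Y" "Y \<noteq> (\<lambda>_. 0)" and DY: "\<And>z. z \<noteq> 0 \<Longrightarrow> D z (Y z) = 0"
    using assms unfolding rotation_like_def by blast
  interpret Y: linear Y by fact
  \<comment> \<open>\<open>2 * s\<close> is the trace of \<open>Y\<close> and
    \<open>k + s\<^sup>2\<close> its determinant. So \<open>CH\<close> is the Cayley-Hamilton
    identity, and \<open>Y\<close> has a real eigenvalue exactly when
    \<open>k \<le> 0\<close>.\<close>
  define s where "s = (Re (Y 1) + Im (Y \<i>)) / 2"
  define k where "k = Re (Y 1) * Im (Y \<i>) - Im (Y 1) * Re (Y \<i>) - s\<^sup>2"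
  have CH: "Y (Y z) = (2 * s) *\<^sub>R Y z - (k + s\<^sup>2) *\<^sub>R z" for z
  proof -
    note R = linear_Re_Im[OF Y(1)]
    have c: "Re (Y z) = Re z * Re (Y 1) + Im z * Re (Y \<i>)" "Im (Y z) = Re z * Im (Y 1) + Im z * Im (Y \<i>)"
      by (simp_all add: R[of z])
    show ?thesis
      unfolding R[of "Y z"] by (simp add: complex_eq_iff c s_def k_def field_simps power2_eq_square)
  qed
  have eig0: "m = 0" if "Y z = m *\<^sub>R z" "z \<noteq> 0" for m z
    using DY[OF that(2)] that linear_scale[OF linear_D[OF that(2)]] D_self[OF that(2)] by simp
  have kpos: "k > 0"
  proof (rule ccontr)
    assume "\<not> k > 0"
    define d where "d = sqrt (- k)"
    have d2: "d\<^sup>2 = - k" using \<open>\<not> k > 0\<close> by (simp add: d_def)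
    \<comment> \<open>Either \<open>Y\<close> is the scalar \<open>s - e\<close>, which
      \<open>eig0\<close> would force to be zero against \<open>Y\<close> being nonzero, or some
      \<open>Y z - (s - e) z\<close> is nonzero and, by \<open>CH\<close>, an eigenvector for the
      root \<open>s + e\<close>.\<close>
    have root0: "m = 0" if m: "m = s + e" and e: "e\<^sup>2 = - k" for m e
    proof (cases "\<forall>z. Y z - (s - e) *\<^sub>R z = 0")
      case True
      then have "Y 1 = (s - e) *\<^sub>R 1" and Ye: "\<And>z. Y z = (s - e) *\<^sub>R z"
        by (auto simp: algebra_simps)
      then have "s - e = 0" using eig0[of 1 "s - e"] by auto
      then have "Y = (\<lambda>_. 0)" using Ye by auto
      then show ?thesis using Y(2) by simp
    next
      case False
      then obtain z where z: "Y z - (s - e) *\<^sub>R z \<noteq> 0" by blast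
      have k': "k = - (e * e)" using e by (simp add: power2_eq_square)
      have "Y (Y z - (s - e) *\<^sub>R z) = m *\<^sub>R (Y z - (s - e) *\<^sub>R z)"
        unfolding Y.diff Y.scaleR CH by (simp add: m k' complex_eq_iff algebra_simps power2_eq_square)
      then show ?thesis using z by (rule eig0)
    qed
    have "s + d = 0" "s + - d = 0" using root0[of "s + d" d] root0[of "s + - d" "- d"] d2 by auto
    then have "s = 0" "d = 0" by auto
    then have "k = 0" using d2 by simp
    then have YY: "Y (Y z) = 0" for z using CH[of z] \<open>s = 0\<close> by simp
    obtain z where e: "Y z \<noteq> 0" using Y(2) by auto
    define e where "e = Y z"
    have nz: "z + t *\<^sub>R e \<noteq> 0" for t
    proof
      assume "z + t *\<^sub>R e = 0"
      then have "Y (z + t *\<^sub>R e) = 0" by simp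
      then show False using e YY[of z] by (simp add: Y.add Y.scaleR e_def)
    qed
    have const: "f (z + t *\<^sub>R e) = f (z + 0 *\<^sub>R e)" for t
    proof (rule constant_along_curve[where c' = "\<lambda>t. e"])
      show "((\<lambda>t. z + t *\<^sub>R e) has_vector_derivative e) (at t)" for t
        by (auto intro!: derivative_eq_intros)
      show "D (z + t *\<^sub>R e) e = 0" for t
        using DY[OF nz[of t]] YY[of z] by (simp add: Y.add Y.scaleR e_def)
    qed (rule nz)
    \<comment> \<open>\<open>f\<close> is constant on the line through \<open>z\<close> in direction
      \<open>e\<close>, so subadditivity bounds \<open>t * f e\<close> by
      \<open>f z + f (- z)\<close>. This \<open>t\<close> exceeds the bound by one.\<close>
    define t where "t = (f z + f (- z) + 1) / f e"
    have fe: "f e > 0" using e pos by (simp add: e_def)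
    have t0: "t \<ge> 0" using fe nonneg[of z] nonneg[of "- z"] by (simp add: t_def)
    have "t * f e = f ((z + t *\<^sub>R e) + (- z))" using t0 by (simp add: scale)
    also have "\<dots> \<le> f (z + t *\<^sub>R e) + f (- z)" by (rule subadd)
    also have "\<dots> = f z + f (- z)" using const[of t] by simp
    finally have "t * f e \<le> f z + f (- z)" .
    moreover have "t * f e = f z + f (- z) + 1"
      using fe by (cases "e = 0") (simp_all add: t_def)
    ultimately show False by simp
  qed
  define w where "w = sqrt k"
  have w: "w > 0" "w\<^sup>2 = k" using kpos by (auto simp: w_def)
  \<comment> \<open>In the basis \<open>1\<close>, \<open>z'\<close> the map \<open>Y\<close> is
    \<open>s\<close> times the identity plus \<open>w\<close> times a quarter turn.\<close>
  define z' where "z' = (Y 1 - s *\<^sub>R 1) /\<^sub>R w"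
  have Y1: "Y 1 = s *\<^sub>R 1 + w *\<^sub>R z'" using w(1) by (simp add: z'_def)
  have "s *\<^sub>R Y 1 + w *\<^sub>R Y z' = Y (Y 1)" by (simp only: Y1 Y.add Y.scaleR)
  also have "\<dots> = (2 * s) *\<^sub>R Y 1 - (w\<^sup>2 + s\<^sup>2) *\<^sub>R 1" using CH[of 1] w(2) by simp
  finally have "w *\<^sub>R Y z' = s *\<^sub>R Y 1 - (w\<^sup>2 + s\<^sup>2) *\<^sub>R 1"
    by (simp add: complex_eq_iff algebra_simps)
  then have "w *\<^sub>R Y z' = w *\<^sub>R (s *\<^sub>R z' - w *\<^sub>R 1)"
    unfolding Y1 by (simp add: complex_eq_iff algebra_simps power2_eq_square)
  then have Yz': "Y z' = s *\<^sub>R z' - w *\<^sub>R 1" using w(1) by simp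
  have Im: "Im z' \<noteq> 0"
  proof
    assume "Im z' = 0"
    then have z': "z' = Re z' *\<^sub>R 1" by (simp add: complex_eq_iff)
    then have Y1': "Y 1 = (s + w * Re z') *\<^sub>R 1" using Y1 by (metis scaleR_left.add scaleR_scaleR)
    have "Y (Y 1) = (s + w * Re z') *\<^sub>R Y 1" by (subst Y1') (rule Y.scaleR)
    also have "\<dots> = (s + w * Re z')\<^sup>2 *\<^sub>R 1" by (simp only: Y1' scaleR_scaleR power2_eq_square)
    finally have "Y (Y 1) = (s + w * Re z')\<^sup>2 *\<^sub>R 1" .
    then have "(s + w * Re z')\<^sup>2 *\<^sub>R (1::complex) = (2 * s * (s + w * Re z') - (k + s\<^sup>2)) *\<^sub>R 1"
      using CH[of 1] Y1' by (simp add: algebra_simps)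
    then have "(s + w * Re z')\<^sup>2 = 2 * s * (s + w * Re z') - (k + s\<^sup>2)" by (simp add: complex_eq_iff)
    then have "(w * Re z')\<^sup>2 + k = 0" by (simp add: algebra_simps power2_eq_square)
    then show False using kpos by (smt (verit) zero_le_power2)
  qed
  have nz: "x *\<^sub>R 1 + y *\<^sub>R z' \<noteq> 0" if "x \<noteq> 0 \<or> y \<noteq> 0" for x y
    using Im that by (auto simp: complex_eq_iff)
  \<comment> \<open>The integral curve of \<open>Y\<close> through \<open>1\<close>, a logarithmic
    spiral in these coordinates. After one turn it is back on the ray of \<open>1\<close>, scaled by
    \<open>exp (s * (2 * pi / w))\<close>, so constancy of \<open>f\<close> forces
    \<open>s = 0\<close>.\<close>
  define c where "c t = (exp (s * t) * cos (w * t)) *\<^sub>R 1 + (exp (s * t) * sin (w * t)) *\<^sub>R z'" for t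
  have const: "f (c t) = f (c 0)" for t
  proof (rule constant_along_curve)
    show "(c has_vector_derivative Y (c t)) (at t)" for t
    proof -
      define a where "a t = exp (s * t) * cos (w * t)" for t
      define b where "b t = exp (s * t) * sin (w * t)" for t
      have "(a has_field_derivative s * a t - w * b t) (at t)" "(b has_field_derivative s * b t + w * a t) (at t)"
        unfolding a_def b_def by (auto intro!: derivative_eq_intros simp: algebra_simps)
      then have "((\<lambda>t. a t *\<^sub>R 1 + b t *\<^sub>R z') has_vector_derivative
          (a t *\<^sub>R 0 + (s * a t - w * b t) *\<^sub>R 1) + (b t *\<^sub>R 0 + (s * b t + w * a t) *\<^sub>R z')) (at t)"
        by (intro has_vector_derivative_add has_vector_derivative_scaleR has_vector_derivative_const)
      moreover have "Y (c t) = a t *\<^sub>R Y 1 + b t *\<^sub>R Y z'"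
        by (simp only: c_def a_def b_def Y.add Y.scaleR)
      moreover have "\<dots> = (a t *\<^sub>R 0 + (s * a t - w * b t) *\<^sub>R 1) + (b t *\<^sub>R 0 + (s * b t + w * a t) *\<^sub>R z')"
        unfolding Y1 Yz' by (simp add: complex_eq_iff algebra_simps)
      moreover have "c = (\<lambda>t. a t *\<^sub>R 1 + b t *\<^sub>R z')" by (simp add: fun_eq_iff c_def a_def b_def)
      ultimately show ?thesis by metis
    qed
    show nzc: "c t \<noteq> 0" for t
      unfolding c_def by (intro nz) (use sin_zero_abs_cos_one[of "w * t"] in auto)
    show "D (c t) (Y (c t)) = 0" for t by (rule DY[OF nzc])
  qed
  have c0: "c 0 = 1" by (simp add: c_def)
  have "c (2 * pi / w) = exp (s * (2 * pi / w)) *\<^sub>R 1" using w(1) by (simp add: c_def)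
  then have "exp (s * (2 * pi / w)) * f 1 = 1 * f 1"
    using const[of "2 * pi / w"] scale[of "exp (s * (2 * pi / w))" 1] by (simp add: c0)
  then have "exp (s * (2 * pi / w)) = 1" using pos[of 1] by simp
  then have s0: "s = 0" using w(1) by simp
  have q: "(f (x *\<^sub>R 1 + y *\<^sub>R z'))\<^sup>2 = (x\<^sup>2 + y\<^sup>2) * (f 1)\<^sup>2" for x y
  proof -
    define v where "v = Complex x y"
    have v: "x = norm v * cos (Arg v)" "y = norm v * sin (Arg v)"
      using rcis_cmod_Arg[of v] by (auto simp: v_def complex_eq_iff)
    have "norm v *\<^sub>R c (Arg v / w) = (norm v * cos (Arg v)) *\<^sub>R 1 + (norm v * sin (Arg v)) *\<^sub>R z'"
      using w(1) s0 by (simp add: c_def scaleR_add_right)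
    then have "x *\<^sub>R 1 + y *\<^sub>R z' = norm v *\<^sub>R c (Arg v / w)"
      using v by simp
    then have "f (x *\<^sub>R 1 + y *\<^sub>R z') = norm v * f 1"
      using const[of "Arg v / w"] by (simp add: scale c0)
    then show ?thesis by (simp add: power_mult_distrib v_def cmod_power2)
  qed
  define i where "i = 1 / Im z'"
  have "(f z)\<^sup>2 = (f 1)\<^sup>2 * (Re z)\<^sup>2 + (- 2 * i * Re z' * (f 1)\<^sup>2) * (Re z * Im z)
      + ((i * Re z')\<^sup>2 + i\<^sup>2) * (f 1)\<^sup>2 * (Im z)\<^sup>2" for z
  proof -
    have "z = (Re z - i * Im z * Re z') *\<^sub>R 1 + (i * Im z) *\<^sub>R z'"
      using Im by (simp add: complex_eq_iff i_def)
    then have "(f z)\<^sup>2 = ((Re z - i * Im z * Re z')\<^sup>2 + (i * Im z)\<^sup>2) * (f 1)\<^sup>2"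
      using q by metis
    then show ?thesis by algebra
  qed
  then show ?thesis by (rule that)
qed

end

section \<open>Rigidity of linear reparametrizations\<close>

lemma blinfun_inverse:
  fixes M :: "'a::euclidean_space \<Rightarrow>\<^sub>L 'a"
  assumes "inj M"
  obtains G :: "'a \<Rightarrow>\<^sub>L 'a" where "\<And>z. G (M z) = z" "\<And>z. M (G z) = z"
proof -
  have l: "linear (blinfun_apply M)" using blinfun.bounded_linear_right bounded_linear.linear by blast
  obtain g where g: "linear g" "g \<circ> M = id"
    using linear_injective_left_inverse[OF l assms] by blast
  have "M (g x) = x" for x
    using linear_injective_imp_surjective[OF l assms] g(2) by (metis comp_apply id_apply surjD)
  moreover have "blinfun_apply (Blinfun g) = g"
    using g(1) by (simp add: bounded_linear_Blinfun_apply linear_conv_bounded_linear)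
  ultimately show ?thesis using that[of "Blinfun g"] g(2) by (simp add: fun_eq_iff)
qed

lemma linear_blinfun_apply: "linear (blinfun_apply M)"
  using blinfun.bounded_linear_right bounded_linear.linear by blast

lemma tendsto_blinfun_apply:
  assumes "(X \<longlongrightarrow> M) G" shows "((\<lambda>k. blinfun_apply (X k) z) \<longlongrightarrow> M z) G"
  using blinfun.tendsto[OF assms tendsto_const] .

context planar_gauge
begin

text \<open>Substituting \<open>z = G w\<close>, with \<open>G\<close> the inverse of
  \<open>M\<close>, turns \<open>Y\<close> into the linear field \<open>Y o\<^sub>L G\<close>, which
  is tangent to the level sets of \<open>f\<close> itself.\<close>

lemma not_rotation_like_at:
  fixes M Y :: "complex \<Rightarrow>\<^sub>L complex"
  assumes nr: "\<not> rotation_like f" and M: "inj M" and Y: "\<And>z. z \<noteq> 0 \<Longrightarrow> D (M z) (Y z) = 0"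
  shows "Y = 0"
proof -
  obtain G :: "complex \<Rightarrow>\<^sub>L complex" where G: "\<And>z. G (M z) = z" "\<And>z. M (G z) = z"
    using blinfun_inverse[OF M] by blast
  have "(Y o\<^sub>L G) w = 0" for w
  proof (rule not_rotation_likeD[OF nr linear_blinfun_apply])
    show "D w ((Y o\<^sub>L G) w) = 0" if "w \<noteq> 0" for w
    proof -
      have "G w \<noteq> 0" using that G(2)[of w] by (metis blinfun.zero_right)
      then show ?thesis using Y[of "G w"] by (simp add: G)
    qed
  qed
  then have "Y z = 0" for z using G(1)[of z] by (metis blinfun_apply_blinfun_compose)
  then show ?thesis by (simp add: blinfun_eqI)
qed

lemma quotient_limit:
  fixes X :: "nat \<Rightarrow> complex \<Rightarrow>\<^sub>L complex" and M :: "complex \<Rightarrow>\<^sub>L complex"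
  assumes "inj M" "s \<longlonglongrightarrow> 0" "\<And>k. s k \<noteq> 0" "(\<lambda>k. (X k - M) /\<^sub>R s k) \<longlonglongrightarrow> Y" "z \<noteq> 0"
  shows "(\<lambda>k. (f (X k z) - f (M z)) / s k) \<longlonglongrightarrow> D (M z) (Y z)"
proof (rule has_derivative_sequentially[where X = "\<lambda>k. X k z" and f' = "D (M z)" and Y = "Y z"])
  have "M z \<noteq> 0" using assms(1,5) by (metis blinfun.zero_right injD)
  then show "(f has_derivative D (M z)) (at (M z))" by (rule has_derivative)
  show "(\<lambda>k. (X k z - M z) /\<^sub>R s k) \<longlonglongrightarrow> Y z"
    using tendsto_blinfun_apply[OF assms(4), of z] by (simp add: blinfun.diff_left blinfun.scaleR_left)
qed (use assms in auto)

text \<open>Without tangent linear fields, the linearization at \<open>M\<close> of composing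
  \<open>f\<close> with a linear map is injective. Hence convergence of the scalar quotients at each
  point forces convergence of the operator quotients. This takes the place of an implicit function
  theorem.\<close>

lemma rigidity:
  fixes X :: "nat \<Rightarrow> complex \<Rightarrow>\<^sub>L complex" and M :: "complex \<Rightarrow>\<^sub>L complex"
  assumes nr: "\<not> rotation_like f" and M: "inj M" and X: "X \<longlonglongrightarrow> M"
    and t: "t \<longlonglongrightarrow> 0" "\<And>k. t k \<noteq> 0"
    and q: "\<And>z. z \<noteq> 0 \<Longrightarrow> (\<lambda>k. (f (X k z) - f (M z)) / t k) \<longlonglongrightarrow> \<psi> z"
  shows "\<exists>P. (\<lambda>k. (X k - M) /\<^sub>R t k) \<longlonglongrightarrow> P \<and> (\<forall>z. z \<noteq> 0 \<longrightarrow> D (M z) (P z) = \<psi> z)"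
proof -
  define R where "R k = (X k - M) /\<^sub>R t k" for k
  have Rb: "bounded (range R)"
  proof (rule ccontr)
    assume nb: "\<not> bounded (range R)"
    have ex: "\<exists>j>k. norm (R j) > real (Suc n)" for n k
    proof (rule ccontr)
      assume "\<not> (\<exists>j>k. norm (R j) > real (Suc n))"
      then have "norm (R (j + Suc k)) \<le> real (Suc n)" for j by (auto simp: not_less dest: spec[of _ "j + Suc k"])
      then have "Bseq (\<lambda>j. R (j + Suc k))" by (intro BseqI') auto
      then have "Bseq R" by (rule Bseq_offset)
      then show False using nb by (simp add: Bseq_eq_bounded)
    qed
    \<comment> \<open>Along these indices \<open>t (r n)\<close> is negligible against
      \<open>d n = norm (X (r n) - M)\<close>. The increments rescaled by \<open>d n\<close>
      therefore accumulate at a tangent field \<open>Y\<close> of norm one.\<close>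
    obtain r where r: "\<And>n. norm (R (r n)) > real (Suc n)" "\<And>n. r n < r (Suc n)"
    proof -
      have "\<exists>r. \<forall>n. norm (R (r n)) > real (Suc n) \<and> r n < r (Suc n)"
        by (rule dependent_nat_choice) (use ex in blast)+
      then show ?thesis using that by blast
    qed
    have rm: "strict_mono r" using r(2) by (simp add: strict_mono_Suc_iff)
    define d where "d n = norm (X (r n) - M)" for n
    have dn: "d n = norm (R (r n)) * \<bar>t (r n)\<bar>" for n
      using t(2)[of "r n"] by (simp add: d_def R_def)
    have d0: "d n > 0" for n
      using dn[of n] r(1)[of n] t(2)[of "r n"] by (smt (verit) mult_pos_pos of_nat_0_le_iff zero_less_abs_iff)
    have dlim: "d \<longlonglongrightarrow> 0"
      using LIMSEQ_subseq_LIMSEQ[OF X rm] unfolding d_def o_def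
      by (simp add: LIM_zero_iff[symmetric, of _ M] tendsto_norm_zero)
    define S where "S n = (X (r n) - M) /\<^sub>R d n" for n
    have S1: "norm (S n) = 1" for n using d0[of n] by (simp add: S_def d_def)
    then have "bounded (range S)" by (auto simp: bounded_iff)
    from bounded_imp_convergent_subsequence[OF this] obtain Y u
      where u: "strict_mono u" "(\<lambda>n. S (u n)) \<longlonglongrightarrow> Y" by (auto simp: o_def)
    have "norm Y = 1" using tendsto_norm[OF u(2)] S1 by (simp add: LIMSEQ_const_iff)
    have "(\<lambda>n. t (r n) / d n) \<longlonglongrightarrow> 0"
    proof (rule Lim_null_comparison[OF always_eventually LIMSEQ_inverse_real_of_nat], intro allI)
      fix n
      have "norm (t (r n) / d n) = inverse (norm (R (r n)))"
        using dn[of n] d0[of n] t(2)[of "r n"] by (simp add: field_simps)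
      also have "\<dots> \<le> inverse (real (Suc n))"
        using r(1)[of n] by (intro le_imp_inverse_le) auto
      finally show "norm (t (r n) / d n) \<le> inverse (real (Suc n))" .
    qed
    then have td: "(\<lambda>n. t (r (u n)) / d (u n)) \<longlonglongrightarrow> 0"
      using LIMSEQ_subseq_LIMSEQ[OF _ u(1)] by (simp add: o_def)
    have "D (M z) (Y z) = 0" if "z \<noteq> 0" for z
    proof -
      have l1: "(\<lambda>n. (f (X (r (u n)) z) - f (M z)) / d (u n)) \<longlonglongrightarrow> D (M z) (Y z)"
        by (rule quotient_limit[OF M _ _ _ that])
           (use LIMSEQ_subseq_LIMSEQ[OF dlim u(1)] d0 u(2) in
             \<open>auto simp: o_def S_def less_imp_neq[THEN not_sym]\<close>)
      have l2: "(\<lambda>n. (f (X (r (u n)) z) - f (M z)) / t (r (u n)) * (t (r (u n)) / d (u n))) \<longlonglongrightarrow> \<psi> z * 0"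
        using tendsto_mult[OF LIMSEQ_subseq_LIMSEQ[OF q[OF that] strict_mono_o[OF rm u(1)]] td]
        by (simp add: o_def)
      have eq: "(f (X (r (u n)) z) - f (M z)) / t (r (u n)) * (t (r (u n)) / d (u n))
          = (f (X (r (u n)) z) - f (M z)) / d (u n)" for n
        using t(2)[of "r (u n)"] by simp
      from l2 have "(\<lambda>n. (f (X (r (u n)) z) - f (M z)) / d (u n)) \<longlonglongrightarrow> \<psi> z * 0"
        by (simp only: eq)
      from LIMSEQ_unique[OF l1 this] show ?thesis by simp
    qed
    then have "Y = 0" by (rule not_rotation_like_at[OF nr M])
    then show False using \<open>norm Y = 1\<close> by simp
  qed
  have lim: "D (M z) (l z) = \<psi> z" if "strict_mono r" "(R \<circ> r) \<longlonglongrightarrow> l" "z \<noteq> 0" for r l z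
  proof -
    have "(\<lambda>n. (f (X (r n) z) - f (M z)) / t (r n)) \<longlonglongrightarrow> D (M z) (l z)"
      by (rule quotient_limit[OF M _ t(2) _ that(3)])
         (use LIMSEQ_subseq_LIMSEQ[OF t(1) that(1)] that(2) in \<open>auto simp: o_def R_def\<close>)
    then show ?thesis
      using LIMSEQ_subseq_LIMSEQ[OF q[OF that(3)] that(1)] LIMSEQ_unique by (auto simp: o_def)
  qed
  from bounded_imp_convergent_subsequence[OF Rb] obtain P r
    where r: "strict_mono r" "(R \<circ> r) \<longlonglongrightarrow> P" by (auto simp: o_def)
  \<comment> \<open>All subsequential limits satisfy the same equation with right-hand side
    \<open>\<psi>\<close>, so two of them differ by a tangent field.\<close>
  have "R \<longlonglongrightarrow> P"
  proof (rule bounded_unique_limit_convergent[OF Rb])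
    fix r' l assume l: "strict_mono r'" "(R \<circ> r') \<longlonglongrightarrow> l"
    have "l - P = 0"
    proof (rule not_rotation_like_at[OF nr M])
      fix z :: complex assume "z \<noteq> 0"
      then have "M z \<noteq> 0" using M by (metis blinfun.zero_right injD)
      then show "D (M z) ((l - P) z) = 0"
        using lim[OF l \<open>z \<noteq> 0\<close>] lim[OF r \<open>z \<noteq> 0\<close>]
        by (simp add: blinfun.diff_left linear_diff[OF linear_D])
    qed
    then show "l = P" by simp
  qed
  then show ?thesis using lim[OF r] unfolding R_def by blast
qed

text \<open>If linear symmetries accumulated at the identity, their differences from it, rescaled to
  norm one, would converge by \<open>rigidity\<close> with \<open>\<psi> = 0\<close> to a nonzero
  tangent field.\<close>

lemma isometries_discrete:
  assumes nr: "\<not> rotation_like f"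
  obtains e where "e > 0"
    "\<forall>N. (\<forall>z. f (blinfun_apply N z) = f z) \<longrightarrow> norm (N - id_blinfun) < e \<longrightarrow> N = id_blinfun"
proof (rule ccontr)
  assume "\<not> thesis"
  then have "\<exists>N. (\<forall>z. f (blinfun_apply N z) = f z) \<and> norm (N - id_blinfun) < inverse (real (Suc k)) \<and> N \<noteq> id_blinfun" for k
    using that[of "inverse (real (Suc k))"] by (auto simp del: of_nat_Suc)
  then obtain N where N: "\<And>k z. f (blinfun_apply (N k) z) = f z"
    "\<And>k. norm (N k - id_blinfun) < inverse (real (Suc k))" "\<And>k. N k \<noteq> id_blinfun"
    by metis
  define t where "t k = norm (N k - id_blinfun)" for k
  have t0: "t k \<noteq> 0" for k using N(3) by (simp add: t_def)
  have tl: "t \<longlonglongrightarrow> 0"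
    by (rule Lim_null_comparison[OF always_eventually LIMSEQ_inverse_real_of_nat])
       (use N(2) in \<open>auto simp: t_def less_imp_le\<close>)
  have Nl: "N \<longlonglongrightarrow> id_blinfun"
    using tl unfolding t_def by (simp add: tendsto_norm_zero_iff LIM_zero_cancel)
  have "\<exists>P. (\<lambda>k. (N k - id_blinfun) /\<^sub>R t k) \<longlonglongrightarrow> P \<and>
    (\<forall>z. z \<noteq> 0 \<longrightarrow> D (blinfun_apply id_blinfun z) (P z) = 0)"
    by (rule rigidity[OF nr _ Nl tl t0, where \<psi> = "\<lambda>_. 0"]) (auto simp: N(1) inj_on_def)
  then obtain P where P: "(\<lambda>k. (N k - id_blinfun) /\<^sub>R t k) \<longlonglongrightarrow> P"
    "\<And>z. z \<noteq> 0 \<Longrightarrow> D (blinfun_apply id_blinfun z) (P z) = 0" by blast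
  have "P = 0" by (rule not_rotation_like_at[OF nr _ P(2)]) (auto simp: inj_on_def)
  have "norm ((N k - id_blinfun) /\<^sub>R t k) = 1" for k using t0[of k] by (simp add: t_def)
  then have "norm P = 1" using tendsto_norm[OF P(1)] by (simp add: LIMSEQ_const_iff)
  then show False using \<open>P = 0\<close> by simp
qed

lemma injI_below:
  assumes "m > 0" "\<And>z. m * norm z \<le> f (blinfun_apply M z)"
  shows "inj (blinfun_apply M)"
proof (rule injI)
  fix x y assume "M x = M y"
  then have "M (x - y) = 0" by (simp add: blinfun.diff_right)
  then have "m * norm (x - y) \<le> 0" using assms(2)[of "x - y"] by simp
  then have "norm (x - y) \<le> 0" using assms(1) by (simp add: mult_le_0_iff)
  then show "x = y" by simp
qed

text \<open>\<open>M\<close> composed with the inverse of \<open>M'\<close> is a linear symmetry of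
  \<open>f\<close>. The lower bound \<open>m\<close> limits the norm of this inverse to
  \<open>C / m\<close>, so that one radius serves all \<open>M\<close>.\<close>

lemma representation_locally_unique:
  assumes nr: "\<not> rotation_like f" and m: "m > 0"
  obtains e where "e > 0"
    "\<forall>(M :: complex \<Rightarrow>\<^sub>L complex) M'. (\<forall>z. f (blinfun_apply M z) = f (blinfun_apply M' z)) \<longrightarrow>
       (\<forall>z. m * norm z \<le> f (blinfun_apply M z)) \<longrightarrow> norm (M - M') < e \<longrightarrow> M = M'"
proof -
  obtain e where e: "e > 0"
    "\<forall>N. (\<forall>z. f (blinfun_apply N z) = f z) \<longrightarrow> norm (N - id_blinfun) < e \<longrightarrow> N = id_blinfun"
    using isometries_discrete[OF nr] by blast
  obtain C where C: "C > 0" "\<And>z. f z \<le> C * norm z" using bounds by blast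
  have "M = M'" if eq: "\<And>z. f (blinfun_apply M z) = f (blinfun_apply M' z)"
    and low: "\<And>z. m * norm z \<le> f (blinfun_apply M z)" and close: "norm (M - M') < e * m / C"
    for M M' :: "complex \<Rightarrow>\<^sub>L complex"
  proof -
    have "inj (blinfun_apply M')" using injI_below[OF m, of M'] low eq by simp
    then obtain G :: "complex \<Rightarrow>\<^sub>L complex" where G: "\<And>z. G (blinfun_apply M' z) = z" "\<And>z. blinfun_apply M' (G z) = z"
      using blinfun_inverse by blast
    have "norm (G z) \<le> C / m * norm z" for z
      using low[of "G z"] eq[of "G z"] G(2)[of z] C(2)[of z] m by (simp add: field_simps)
    then have nG: "norm G \<le> C / m" using C(1) m by (intro norm_blinfun_bound) auto
    have "M o\<^sub>L G = id_blinfun"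
    proof (rule e(2)[rule_format])
      show "f ((M o\<^sub>L G) z) = f z" for z using eq[of "G z"] G(2) by simp
      have "(M o\<^sub>L G) - id_blinfun = (M - M') o\<^sub>L G"
        by (rule blinfun_eqI) (simp add: minus_blinfun.rep_eq G)
      then have "norm ((M o\<^sub>L G) - id_blinfun) \<le> norm (M - M') * norm G"
        using norm_blinfun_compose by metis
      also have "\<dots> \<le> norm (M - M') * (C / m)" by (rule mult_left_mono[OF nG]) simp
      also have "\<dots> < e" using close C(1) m by (simp add: field_simps)
      finally show "norm ((M o\<^sub>L G) - id_blinfun) < e" .
    qed
    then have "blinfun_apply M (G (blinfun_apply M' z)) = blinfun_apply M' z" for z by (metis blinfun_apply_blinfun_compose id_blinfun.rep_eq id_apply)
    then show ?thesis using G(1) by (simp add: blinfun_eqI)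
  qed
  then show ?thesis using that[of "e * m / C"] e(1) C(1) m by auto
qed

end

section \<open>Planar sections with few linear symmetries\<close>

context smooth_gauge
begin

text \<open>With \<open>w = 1 - s c\<close> and \<open>p\<close> such that
  \<open>p \<bullet> w = s\<close>, the right-hand side of \<open>sec\<close> is
  \<open>F (J 1)\<close> for every \<open>s\<close>, while the argument on the left runs along the
  line through \<open>J 1\<close> in direction \<open>b - J c\<close>.\<close>

lemma segment_of_linear_sections:
  fixes J :: "complex \<Rightarrow> 'a" and b :: 'a and M :: "complex \<Rightarrow> complex \<Rightarrow>\<^sub>L complex" and c :: complex
  assumes J: "linear J" and inj: "\<And>z t. J z + t *\<^sub>R b = 0 \<Longrightarrow> z = 0 \<and> t = 0"
    and h: "h > 0" and sec: "\<And>p z. norm p < h \<Longrightarrow> F (J z + (p \<bullet> z) *\<^sub>R b) = F (J (z + (p \<bullet> z) *\<^sub>R c))"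
  shows "\<exists>x k e. x \<noteq> 0 \<and> k \<noteq> 0 \<and> e > 0 \<and> (\<forall>s. \<bar>s\<bar> < e \<longrightarrow> F (x + s *\<^sub>R k) = F x)"
proof -
  interpret J: linear J by fact
  \<comment> \<open>The second bound keeps \<open>norm (s *\<^sub>R c)\<close> at most 1/2, hence
    \<open>norm w\<close> at least 1/2. Then \<open>norm p = \<bar>s\<bar> / norm w\<close> is at
    most twice \<open>\<bar>s\<bar>\<close>, and the first bound keeps it below
    \<open>h\<close>.\<close>
  define e where "e = min (h / 2) (1 / (2 * (norm c + 1)))"
  have e: "e > 0" using h by (auto simp: e_def add_nonneg_pos)
  have "F (J 1 + s *\<^sub>R (b - J c)) = F (J 1)" if s: "\<bar>s\<bar> < e" for s
  proof -
    define w where "w = 1 - s *\<^sub>R c"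
    have "\<bar>s\<bar> * norm c \<le> \<bar>s\<bar> * (norm c + 1)" by (simp add: mult_left_mono)
    also have "\<dots> \<le> 1 / (2 * (norm c + 1)) * (norm c + 1)"
      using s by (intro mult_right_mono) (auto simp: e_def)
    also have "\<dots> = 1 / 2" by (simp add: field_simps add_nonneg_eq_0_iff)
    finally have "norm (s *\<^sub>R c) \<le> 1 / 2" by simp
    then have nw: "norm w \<ge> 1 / 2"
      using norm_triangle_ineq2[of 1 "s *\<^sub>R c"] by (simp add: w_def)
    define p where "p = (s / (norm w)\<^sup>2) *\<^sub>R w"
    have pw: "p \<bullet> w = s" using nw by (cases "w = 0") (auto simp: p_def power2_norm_eq_inner)
    have "norm p = \<bar>s\<bar> / norm w" by (simp add: p_def power2_eq_square)
    also have "\<dots> \<le> \<bar>s\<bar> / (1 / 2)" using nw by (intro divide_left_mono) auto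
    also have "\<dots> < h" using s by (simp add: e_def)
    finally have "F (J w + s *\<^sub>R b) = F (J (w + s *\<^sub>R c))" using sec[of p w] pw by simp
    then show ?thesis by (simp add: w_def J.diff J.scaleR algebra_simps)
  qed
  moreover have "J 1 \<noteq> 0" using inj[of 1 0] by auto
  moreover have "b - J c \<noteq> 0" using inj[of "- c" 1] by (auto simp: J.neg)
  ultimately show ?thesis using e by metis
qed

text \<open>Tilting the plane in direction \<open>q\<close> changes the section at the rate
  \<open>(q \<bullet> z) * \<phi> p z\<close>, where \<open>\<phi>\<close> is the derivative of
  \<open>F\<close> in direction \<open>b\<close>. This scalar is common to all \<open>q\<close> and
  cancels between two of them, which is the origin of the quadratic tangent field.\<close>

lemma sections_not_rotation_like_segment:
  fixes J :: "complex \<Rightarrow> 'a" and b :: 'a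
  assumes J: "linear J" and inj: "\<And>z t. J z + t *\<^sub>R b = 0 \<Longrightarrow> z = 0 \<and> t = 0"
    and \<delta>: "\<delta> > 0"
    and sec: "\<And>p. norm p < \<delta> \<Longrightarrow> \<exists>M :: complex \<Rightarrow>\<^sub>L complex. \<forall>z. F (J (M z)) = F (J z + (p \<bullet> z) *\<^sub>R b)"
    and nr: "\<not> rotation_like (\<lambda>z. F (J z))"
  shows "\<exists>x k e. x \<noteq> 0 \<and> k \<noteq> 0 \<and> e > 0 \<and> (\<forall>s. \<bar>s\<bar> < e \<longrightarrow> F (x + s *\<^sub>R k) = F x)"
proof -
  interpret J: linear J by fact
  define f where "f = (\<lambda>z. F (J z))"
  define g where "g p z = F (J z + (p \<bullet> z) *\<^sub>R b)" for p z
  have injJ: "inj J" using linear_injective_0[OF J] inj[of _ 0] by auto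
  interpret f: planar_gauge f
    unfolding f_def planar_gauge_def by (rule pullback[OF J injJ])
  have nrf: "\<not> rotation_like f" using nr by (simp add: f_def)
  have linJb: "linear (\<lambda>(z, t). J z + t *\<^sub>R b)"
    by (rule linearI) (auto simp: J.add J.scaleR algebra_simps)
  have injJb: "inj (\<lambda>(z, t). J z + t *\<^sub>R b)"
    using linear_injective_0[OF linJb] inj by (auto simp: zero_prod_def)
  obtain \<mu> where \<mu>: "\<mu> > 0" "\<And>x. \<mu> * norm x \<le> norm (case x of (z, t) \<Rightarrow> J z + t *\<^sub>R b)"
    using linear_inj_bounded_below_pos[OF linJb injJb] by blast
  obtain \<nu> where \<nu>: "\<nu> > 0" "\<And>x. norm (case x of (z, t) \<Rightarrow> J z + t *\<^sub>R b) \<le> \<nu> * norm x"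
    using linear_bounded_pos[OF linJb] by blast
  obtain mF CF where F: "mF > 0" "CF > 0" "\<And>x. mF * norm x \<le> F x" "\<And>x. F x \<le> CF * norm x"
    using bounds by blast
  define m where "m = mF * \<mu>"
  have m: "m > 0" using F \<mu> by (simp add: m_def)
  have low: "m * norm z \<le> g p z" for p z
  proof -
    have "m * norm z \<le> m * norm (z, p \<bullet> z)"
      using m norm_fst_le[of z "p \<bullet> z"] by (simp add: mult_left_mono)
    also have "\<dots> \<le> mF * norm (J z + (p \<bullet> z) *\<^sub>R b)"
      using \<mu>(2)[of "(z, p \<bullet> z)"] F(1) by (simp add: m_def)
    also have "\<dots> \<le> g p z" unfolding g_def by (rule F(3))
    finally show ?thesis .
  qed
  have g0: "g 0 = f" by (auto simp: g_def f_def)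
  define C where "C = CF * \<nu> * (1 + \<delta>)"
  have up: "g p z \<le> C * norm z" if "norm p < \<delta>" for p z
  proof -
    have "norm (z, p \<bullet> z) \<le> norm z + norm (p \<bullet> z)" by (rule norm_Pair_le)
    also have "\<dots> \<le> norm z + \<delta> * norm z"
      using Cauchy_Schwarz_ineq2[of p z] that mult_right_mono[of "norm p" \<delta> "norm z"] by simp
    finally have "norm (J z + (p \<bullet> z) *\<^sub>R b) \<le> \<nu> * ((1 + \<delta>) * norm z)"
      using \<nu>(2)[of "(z, p \<bullet> z)"] mult_left_mono[of "norm (z, p \<bullet> z)" "(1 + \<delta>) * norm z" \<nu>] \<nu>(1)
      by (simp add: algebra_simps)
    then have "CF * norm (J z + (p \<bullet> z) *\<^sub>R b) \<le> C * norm z"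
      using F(2) by (simp add: C_def mult.assoc)
    then show ?thesis using F(4)[of "J z + (p \<bullet> z) *\<^sub>R b"] unfolding g_def by linarith
  qed
  have C: "C > 0" using F \<nu> \<delta> by (simp add: C_def)
  have nM: "norm M \<le> C / m" if "norm p < \<delta>" "\<And>z. f (blinfun_apply M z) = g p z" for M :: "complex \<Rightarrow>\<^sub>L complex" and p
  proof (rule norm_blinfun_bound)
    show "norm (M z) \<le> C / m * norm z" for z
      using low[of "M z" 0] that(2)[of z] up[OF that(1), of z] m by (simp add: g0 field_simps)
  qed (use C m in auto)
  have gcont: "(\<lambda>n. g (p n) z) \<longlonglongrightarrow> g q z" if "p \<longlonglongrightarrow> q" for p q z
    unfolding g_def by (intro tendsto_gauge tendsto_intros that)
  have fcont: "(\<lambda>n. f (blinfun_apply (X n) z)) \<longlonglongrightarrow> f (blinfun_apply M z)" if "X \<longlonglongrightarrow> M"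
    for X :: "nat \<Rightarrow> complex \<Rightarrow>\<^sub>L complex" and M z
    by (intro f.tendsto_gauge tendsto_blinfun_apply that)

  \<comment> \<open>As \<open>p\<close> tends to \<open>0\<close>, the given maps need not approach
    the identity, but along a subsequence they approach some linear symmetry \<open>M\<close> of
    \<open>f\<close>. Composing with the inverse of \<open>M\<close> moves them near the identity
    without changing \<open>f\<close>.\<close>
  have near: "\<exists>d>0. d \<le> \<delta> \<and> (\<forall>p. norm p < d \<longrightarrow>
      (\<exists>M :: complex \<Rightarrow>\<^sub>L complex. norm (M - id_blinfun) < e \<and> (\<forall>z. f (blinfun_apply M z) = g p z)))" if "e > 0" for e
  proof (rule ccontr)
    assume neg: "\<not> ?thesis"
    have "\<exists>p. norm p < min \<delta> (inverse (real (Suc n))) \<and>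
       (\<forall>M :: complex \<Rightarrow>\<^sub>L complex. (\<forall>z. f (blinfun_apply M z) = g p z) \<longrightarrow> \<not> norm (M - id_blinfun) < e)" for n
    proof -
      have "min \<delta> (inverse (real (Suc n))) > 0" using \<delta> by simp
      then have "\<not> (\<forall>p. norm p < min \<delta> (inverse (real (Suc n))) \<longrightarrow>
        (\<exists>M :: complex \<Rightarrow>\<^sub>L complex. norm (M - id_blinfun) < e \<and> (\<forall>z. f (blinfun_apply M z) = g p z)))"
        using neg min.cobounded1 by blast
      then show ?thesis by blast
    qed
    then obtain p where p: "\<And>n. norm (p n) < min \<delta> (inverse (real (Suc n)))"
      and no: "\<And>n (M :: complex \<Rightarrow>\<^sub>L complex). (\<forall>z. f (blinfun_apply M z) = g (p n) z) \<Longrightarrow> \<not> norm (M - id_blinfun) < e"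
      by metis
    have p0: "p \<longlonglongrightarrow> 0"
      by (rule Lim_null_comparison[OF always_eventually LIMSEQ_inverse_real_of_nat])
         (use p in \<open>auto simp: less_imp_le simp del: of_nat_Suc\<close>)
    have "\<forall>n. \<exists>M :: complex \<Rightarrow>\<^sub>L complex. \<forall>z. f (blinfun_apply M z) = g (p n) z"
      using sec p unfolding f_def g_def by auto
    then obtain X :: "nat \<Rightarrow> complex \<Rightarrow>\<^sub>L complex" where X: "\<And>n z. f (X n z) = g (p n) z" by metis
    have "bounded (range X)"
      unfolding bounded_iff using nM X p by (metis min_less_iff_conj rangeE)
    from bounded_imp_convergent_subsequence[OF this] obtain M r
      where r: "strict_mono r" "(\<lambda>n. X (r n)) \<longlonglongrightarrow> M" by (auto simp: o_def)
    have fM: "f (M z) = f z" for z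
    proof (rule LIMSEQ_unique)
      show "(\<lambda>n. f (X (r n) z)) \<longlonglongrightarrow> f (M z)" by (rule fcont[OF r(2)])
      show "(\<lambda>n. f (X (r n) z)) \<longlonglongrightarrow> f z"
        unfolding X using gcont[OF LIMSEQ_subseq_LIMSEQ[OF p0 r(1)]] by (simp add: o_def g0)
    qed
    have "inj (blinfun_apply M)" by (rule f.injI_below[OF m]) (use low[of _ 0] in \<open>simp add: fM g0\<close>)
    then obtain G :: "complex \<Rightarrow>\<^sub>L complex" where G: "\<And>z. G (blinfun_apply M z) = z" "\<And>z. blinfun_apply M (G z) = z"
      using blinfun_inverse by blast
    have "(\<lambda>n. (G o\<^sub>L X (r n))) \<longlonglongrightarrow> (G o\<^sub>L M)"
      by (rule bounded_bilinear.tendsto[OF bounded_bilinear_blinfun_compose tendsto_const r(2)])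
    moreover have "(G o\<^sub>L M) = id_blinfun" by (rule blinfun_eqI) (simp add: G)
    ultimately have "\<forall>\<^sub>F n in sequentially. norm ((G o\<^sub>L X (r n)) - id_blinfun) < e"
      using that by (simp add: tendsto_iff dist_norm)
    then obtain n where "norm ((G o\<^sub>L X (r n)) - id_blinfun) < e"
      by (auto simp: eventually_sequentially)
    moreover have "f ((G o\<^sub>L X (r n)) z) = g (p (r n)) z" for z
      using fM[of "G (X (r n) z)"] G(2) X by simp
    ultimately show False using no by blast
  qed

  obtain e where e: "e > 0" and uniq: "\<And>(M :: complex \<Rightarrow>\<^sub>L complex) M'. (\<forall>z. f (blinfun_apply M z) = f (blinfun_apply M' z)) \<Longrightarrow>
       (\<forall>z. m * norm z \<le> f (blinfun_apply M z)) \<Longrightarrow> norm (M - M') < e \<Longrightarrow> M = M'"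
    using f.representation_locally_unique[OF nrf m] by metis
  obtain d where d: "d > 0" "d \<le> \<delta>" and ex: "\<And>p. norm p < d \<Longrightarrow>
      \<exists>M :: complex \<Rightarrow>\<^sub>L complex. norm (M - id_blinfun) < e / 2 \<and> (\<forall>z. f (blinfun_apply M z) = g p z)"
    using near[of "e / 2"] e by auto
  obtain A :: "complex \<Rightarrow> complex \<Rightarrow>\<^sub>L complex" where A: "\<And>p. norm p < d \<Longrightarrow> norm (A p - id_blinfun) < e / 2"
    "\<And>p z. norm p < d \<Longrightarrow> f (A p z) = g p z"
    using ex by metis
  \<comment> \<open>\<open>A p\<close> is strictly within \<open>e / 2\<close> of the identity, so a
    competitor within \<open>e / 2\<close> is closer to it than \<open>e\<close>. The non-strict
    bound on the competitor is what survives the limit in \<open>Acont\<close>.\<close>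
  have Auniq: "M = A p" if "norm p < d" "norm (M - id_blinfun) \<le> e / 2" "\<And>z. f (blinfun_apply M z) = g p z"
    for M :: "complex \<Rightarrow>\<^sub>L complex" and p
  proof (rule uniq)
    show "norm (M - A p) < e"
      using norm_triangle_ineq4[of "M - id_blinfun" "A p - id_blinfun"] that(2) A(1)[OF that(1)] by simp
  qed (use that A low in auto)
  have A0: "A 0 = id_blinfun"
    by (rule Auniq[symmetric]) (use d e in \<open>auto simp: g0\<close>)
  have Acont: "(\<lambda>n. A (p n)) \<longlonglongrightarrow> A q" if "p \<longlonglongrightarrow> q" "norm q < d" "\<And>n. norm (p n) < d" for p q
  proof (rule bounded_unique_limit_convergent)
    have "norm (A (p n)) \<le> C / m" for n
      using nM[of "p n" "A (p n)"] A(2)[OF that(3)] that(3)[of n] d(2) by simp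
    then show "bounded (range (\<lambda>n. A (p n)))" by (auto simp: bounded_iff)
    fix r l assume r: "strict_mono r" "((\<lambda>n. A (p n)) \<circ> r) \<longlonglongrightarrow> l"
    then have l: "(\<lambda>n. A (p (r n))) \<longlonglongrightarrow> l" by (simp add: o_def)
    show "l = A q"
    proof (rule Auniq[OF that(2)])
      have "(\<lambda>n. norm (A (p (r n)) - id_blinfun)) \<longlonglongrightarrow> norm (l - id_blinfun)"
        by (intro tendsto_intros l)
      then show "norm (l - id_blinfun) \<le> e / 2"
        by (rule LIMSEQ_le_const2) (use A(1)[OF that(3)] in \<open>auto intro!: less_imp_le\<close>)
      show "f (l z) = g q z" for z
      proof (rule LIMSEQ_unique[OF fcont[OF l]])
        show "(\<lambda>n. f (A (p (r n)) z)) \<longlonglongrightarrow> g q z"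
          unfolding A(2)[OF that(3)] using gcont[OF LIMSEQ_subseq_LIMSEQ[OF that(1) r(1)]] by (simp add: o_def)
      qed
    qed
  qed
  have injA: "inj (blinfun_apply (A p))" if "norm p < d" for p
    by (rule f.injI_below[OF m]) (use low A(2)[OF that] in simp)

  define \<phi> where "\<phi> p z = D (J z + (p \<bullet> z) *\<^sub>R b) b" for p z
  have deriv: "\<exists>P. (\<lambda>n. (A (p + t n *\<^sub>R q) - A p) /\<^sub>R t n) \<longlonglongrightarrow> P \<and>
      (\<forall>z. z \<noteq> 0 \<longrightarrow> f.D (A p z) (P z) = (q \<bullet> z) * \<phi> p z)"
    if p: "norm p < d" and t: "t \<longlonglongrightarrow> 0" "\<And>n. t n \<noteq> 0" and pt: "\<And>n. norm (p + t n *\<^sub>R q) < d" for p q t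
  proof -
    have lim: "(\<lambda>n. p + t n *\<^sub>R q) \<longlonglongrightarrow> p"
      using tendsto_add[OF tendsto_const tendsto_scaleR[OF t(1) tendsto_const], of p q] by simp
    have "(\<lambda>n. (f (A (p + t n *\<^sub>R q) z) - f (A p z)) / t n) \<longlonglongrightarrow> (q \<bullet> z) * \<phi> p z" if "z \<noteq> 0" for z
    proof -
      have nz: "J z + (p \<bullet> z) *\<^sub>R b \<noteq> 0" using inj[of z "p \<bullet> z"] that by blast
      interpret Dz: linear "D (J z + (p \<bullet> z) *\<^sub>R b)" by (rule linear_D[OF nz])
      have "(\<lambda>n. (F (J z + ((p + t n *\<^sub>R q) \<bullet> z) *\<^sub>R b) - F (J z + (p \<bullet> z) *\<^sub>R b)) / t n)
          \<longlonglongrightarrow> D (J z + (p \<bullet> z) *\<^sub>R b) ((q \<bullet> z) *\<^sub>R b)"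
        by (rule has_derivative_sequentially[OF has_derivative[OF nz] t])
           (simp add: inner_add_left scaleR_add_left t(2) flip: mult.assoc)
      then show ?thesis
        unfolding A(2)[OF pt] A(2)[OF p] g_def by (simp add: Dz.scaleR \<phi>_def)
    qed
    then show ?thesis by (rule f.rigidity[OF nrf injA[OF p] Acont[OF lim p pt] t])
  qed
  have exP: "\<exists>P :: complex \<Rightarrow>\<^sub>L complex. \<forall>z. z \<noteq> 0 \<longrightarrow> f.D (A p z) (P z) = (q \<bullet> z) * \<phi> p z"
    if p: "norm p < d" for p q
  proof -
    define \<epsilon> where "\<epsilon> = (d - norm p) / (norm q + 1)"
    have eps: "\<epsilon> > 0" using p by (simp add: \<epsilon>_def add_nonneg_pos)
    have *: "norm (p + (\<epsilon> * inverse (real (Suc n))) *\<^sub>R q) < d" for n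
    proof -
      have "norm ((\<epsilon> * inverse (real (Suc n))) *\<^sub>R q) \<le> \<epsilon> * norm q"
        using eps mult_mono[of "inverse (real (Suc n))" 1 "norm q" "norm q"]
        by (simp add: inverse_le_1_iff mult.assoc)
      also have "\<dots> < \<epsilon> * (norm q + 1)" using eps by simp
      also have "\<dots> = d - norm p" 
      proof -
        have "norm q + 1 \<noteq> 0" using norm_ge_zero[of q] by linarith
        then show ?thesis by (simp add: \<epsilon>_def)
      qed
      finally show ?thesis using norm_triangle_ineq[of p "(\<epsilon> * inverse (real (Suc n))) *\<^sub>R q"] by linarith
    qed
    have "(\<lambda>n. \<epsilon> * inverse (real (Suc n))) \<longlonglongrightarrow> 0"
      using tendsto_mult[OF tendsto_const LIMSEQ_inverse_real_of_nat] by force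
    from deriv[OF p this _ *] eps show ?thesis by auto
  qed
  have nzA: "A p z \<noteq> 0" if "norm p < d" "z \<noteq> 0" for p z
    using injA[OF that(1)] that(2) by (metis blinfun.zero_right injD)

  \<comment> \<open>The derivative of \<open>A\<close> in direction \<open>q\<close> solves a
    uniquely solvable equation that is linear in \<open>q\<close>, hence equals
    \<open>Re q *\<^sub>R P1 + Im q *\<^sub>R P2\<close>. Once
    \<open>Im z *\<^sub>R P1 z = Re z *\<^sub>R P2 z\<close> is known, multiplying its value at
    \<open>z\<close> by \<open>Re z\<close> or by \<open>Im z\<close> brings out the factor
    \<open>q \<bullet> z\<close>.\<close>
  have stationary: "P z = 0"
    if p: "norm p < d" and P: "\<And>z. z \<noteq> 0 \<Longrightarrow> f.D (A p z) (P z) = (q \<bullet> z) * \<phi> p z" and qz: "q \<bullet> z = 0"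
    for p q z and P :: "complex \<Rightarrow>\<^sub>L complex"
  proof -
    obtain P1 :: "complex \<Rightarrow>\<^sub>L complex" where P1: "\<And>z. z \<noteq> 0 \<Longrightarrow> f.D (A p z) (P1 z) = (1 \<bullet> z) * \<phi> p z"
      using exP[OF p] by blast
    obtain P2 :: "complex \<Rightarrow>\<^sub>L complex" where P2: "\<And>z. z \<noteq> 0 \<Longrightarrow> f.D (A p z) (P2 z) = (\<i> \<bullet> z) * \<phi> p z"
      using exP[OF p] by blast
    obtain G :: "complex \<Rightarrow>\<^sub>L complex" where G: "\<And>z. G (blinfun_apply (A p) z) = z" "\<And>z. blinfun_apply (A p) (G z) = z"
      using blinfun_inverse[OF injA[OF p]] by blast
    have fA: "smooth_gauge (\<lambda>z. f (A p z))" and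
      DA: "\<And>z h. z \<noteq> 0 \<Longrightarrow> frechet_derivative (\<lambda>z. f (A p z)) (at z) h = f.D (A p z) (A p h)"
      using f.pullback[OF linear_blinfun_apply injA[OF p]] by blast+
    interpret fA: planar_gauge "\<lambda>z. f (A p z)" unfolding planar_gauge_def by (rule fA)
    have nrA: "\<not> rotation_like (\<lambda>z. f (A p z))"
    proof
      assume "rotation_like (\<lambda>z. f (A p z))"
      then obtain Y where Y: "linear Y" "Y \<noteq> (\<lambda>_. 0)" "\<And>z. z \<noteq> 0 \<Longrightarrow> f.D (A p z) (A p (Y z)) = 0"
        unfolding rotation_like_def using DA by metis
      have BY: "blinfun_apply (Blinfun Y) = Y"
        using Y(1) by (simp add: bounded_linear_Blinfun_apply linear_conv_bounded_linear)
      have "A p o\<^sub>L Blinfun Y = 0"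
        by (rule f.not_rotation_like_at[OF nrf injA[OF p]]) (use Y(3) in \<open>simp add: BY\<close>)
      then have "A p (Y z) = 0" for z by (metis BY blinfun_apply_blinfun_compose zero_blinfun.rep_eq)
      then have "Y z = 0" for z using G(1)[of "Y z"] by (simp add: blinfun.zero_right)
      then show False using Y(2) by auto
    qed
    \<comment> \<open>The combination of \<open>P1\<close> and \<open>P2\<close> is tangent to the
      level sets of \<open>f\<close> at \<open>A p z\<close>. Applying \<open>G\<close> turns it
      into a field at \<open>z\<close> for the pulled back gauge.\<close>
    have par: "Im z *\<^sub>R G (P1 z) = Re z *\<^sub>R G (P2 z)" for z
    proof (rule fA.tangent_quadratic_field_zero[OF nrA])
      show "linear (\<lambda>z. G (P1 z))" "linear (\<lambda>z. G (P2 z))"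
        using linear_compose[OF linear_blinfun_apply linear_blinfun_apply] by (auto simp: o_def)
      fix z :: complex assume z: "z \<noteq> 0"
      interpret Dz: linear "f.D (A p z)" by (rule f.linear_D[OF nzA[OF p z]])
      have "A p (Im z *\<^sub>R G (P1 z) - Re z *\<^sub>R G (P2 z)) = Im z *\<^sub>R P1 z - Re z *\<^sub>R P2 z"
        by (simp add: blinfun.diff_right blinfun.scaleR_right G)
      then show "frechet_derivative (\<lambda>z. f (A p z)) (at z) (Im z *\<^sub>R G (P1 z) - Re z *\<^sub>R G (P2 z)) = 0"
        using P1[OF z] P2[OF z] by (simp add: DA[OF z] Dz.diff Dz.scaleR inner_complex_def)
    qed
    have "A p (Im z *\<^sub>R G (P1 z)) = A p (Re z *\<^sub>R G (P2 z))" using par[of z] by simp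
    then have par': "Im z *\<^sub>R P1 z = Re z *\<^sub>R P2 z"
      by (simp add: blinfun.scaleR_right G)
    have "P - (Re q *\<^sub>R P1 + Im q *\<^sub>R P2) = 0"
    proof (rule f.not_rotation_like_at[OF nrf injA[OF p]])
      fix z :: complex assume z: "z \<noteq> 0"
      interpret Dz: linear "f.D (A p z)" by (rule f.linear_D[OF nzA[OF p z]])
      show "f.D (A p z) ((P - (Re q *\<^sub>R P1 + Im q *\<^sub>R P2)) z) = 0"
        using P[OF z] P1[OF z] P2[OF z]
        by (simp add: blinfun.diff_left blinfun.add_left blinfun.scaleR_left Dz.diff Dz.add Dz.scaleR
            inner_complex_def algebra_simps)
    qed
    then have "P = Re q *\<^sub>R P1 + Im q *\<^sub>R P2" by simp
    then have Pz: "P z = Re q *\<^sub>R P1 z + Im q *\<^sub>R P2 z"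
      by (simp add: blinfun.add_left blinfun.scaleR_left)
    have q0: "Re q * Re z + Im q * Im z = 0" using qz by (simp add: inner_complex_def)
    have "Re z *\<^sub>R P z = (Re q * Re z) *\<^sub>R P1 z + Im q *\<^sub>R (Re z *\<^sub>R P2 z)"
      by (simp add: Pz scaleR_add_right mult.commute)
    also have "\<dots> = (Re q * Re z + Im q * Im z) *\<^sub>R P1 z"
      unfolding par'[symmetric] by (simp add: scaleR_add_left)
    finally have 1: "Re z *\<^sub>R P z = 0" using q0 by simp
    have "Im z *\<^sub>R P z = Re q *\<^sub>R (Im z *\<^sub>R P1 z) + (Im q * Im z) *\<^sub>R P2 z"
      by (simp add: Pz scaleR_add_right mult.commute)
    also have "\<dots> = (Re q * Re z + Im q * Im z) *\<^sub>R P2 z"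
      unfolding par' by (simp add: scaleR_add_left)
    finally have "Im z *\<^sub>R P z = 0" using q0 by simp
    with 1 have "P z = 0 \<or> z = 0" by (auto simp: complex_eq_iff)
    then show ?thesis by (auto simp: blinfun.zero_right)
  qed

  \<comment> \<open>By \<open>stationary\<close>, the value at \<open>z\<close> has zero derivative
    along the line from \<open>p\<close> to \<open>p'\<close>.\<close>
  have const: "A p z = A p' z" if "norm p < d" "norm p' < d" "(p' - p) \<bullet> z = 0" for p p' z
  proof -
    define q where "q = p' - p"
    define S where "S = {t. norm (p + t *\<^sub>R q) < d}"
    have S: "S = (\<lambda>t. p + t *\<^sub>R q) -` ball 0 d" by (auto simp: S_def)
    have cS: "convex S"
    proof (rule convexI)
      fix x y u v :: real assume *: "x \<in> S" "y \<in> S" "0 \<le> u" "0 \<le> v" "u + v = 1"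
      have "u *\<^sub>R (p + x *\<^sub>R q) + v *\<^sub>R (p + y *\<^sub>R q) \<in> ball 0 d"
        using * by (intro convexD[OF convex_ball]) (auto simp: S)
      moreover have "u *\<^sub>R (p + x *\<^sub>R q) + v *\<^sub>R (p + y *\<^sub>R q) = (u + v) *\<^sub>R p + (u *\<^sub>R x + v *\<^sub>R y) *\<^sub>R q"
        by (simp add: algebra_simps)
      ultimately show "u *\<^sub>R x + v *\<^sub>R y \<in> S" using *(5) by (simp add: S)
    qed
    have vd: "((\<lambda>t. A (p + t *\<^sub>R q) z) has_vector_derivative 0) (at t within S)" if t: "t \<in> S" for t
      unfolding has_vector_derivative_def has_derivative_within
    proof (intro conjI)
      show "((\<lambda>y. (1 / norm (y - t)) *\<^sub>R (A (p + y *\<^sub>R q) z - (A (p + t *\<^sub>R q) z + (y - t) *\<^sub>R 0))) \<longlongrightarrow> 0) (at t within S)"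
        unfolding tendsto_at_iff_sequentially
      proof (intro allI impI)
        fix X assume X: "\<forall>i. X i \<in> S - {t}" "X \<longlonglongrightarrow> t"
        have e: "p + t *\<^sub>R q + (X n - t) *\<^sub>R q = p + X n *\<^sub>R q" for n by (simp add: algebra_simps)
        have "\<exists>P. (\<lambda>n. (A (p + t *\<^sub>R q + (X n - t) *\<^sub>R q) - A (p + t *\<^sub>R q)) /\<^sub>R (X n - t)) \<longlonglongrightarrow> P \<and>
            (\<forall>z. z \<noteq> 0 \<longrightarrow> f.D (A (p + t *\<^sub>R q) z) (P z) = (q \<bullet> z) * \<phi> (p + t *\<^sub>R q) z)"
        proof (rule deriv)
          show "(\<lambda>n. X n - t) \<longlonglongrightarrow> 0" using X(2) by (simp add: LIM_zero)
        qed (use X(1) t in \<open>auto simp: S_def e\<close>)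
        then obtain P :: "complex \<Rightarrow>\<^sub>L complex"
          where P: "(\<lambda>n. (A (p + X n *\<^sub>R q) - A (p + t *\<^sub>R q)) /\<^sub>R (X n - t)) \<longlonglongrightarrow> P"
            "\<And>z. z \<noteq> 0 \<Longrightarrow> f.D (A (p + t *\<^sub>R q) z) (P z) = (q \<bullet> z) * \<phi> (p + t *\<^sub>R q) z"
          unfolding e by blast
        have "P z = 0"
          by (rule stationary[OF _ P(2)]) (use t \<open>(p' - p) \<bullet> z = 0\<close> in \<open>auto simp: S_def q_def\<close>)
        then have "(\<lambda>n. (A (p + X n *\<^sub>R q) z - A (p + t *\<^sub>R q) z) /\<^sub>R (X n - t)) \<longlonglongrightarrow> 0"
          using tendsto_blinfun_apply[OF P(1), of z] by (simp add: blinfun.diff_left blinfun.scaleR_left)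
        then have "(\<lambda>n. norm ((A (p + X n *\<^sub>R q) z - A (p + t *\<^sub>R q) z) /\<^sub>R (X n - t))) \<longlonglongrightarrow> 0"
          by (rule tendsto_norm_zero)
        then show "((\<lambda>y. (1 / norm (y - t)) *\<^sub>R (A (p + y *\<^sub>R q) z - (A (p + t *\<^sub>R q) z + (y - t) *\<^sub>R 0))) \<circ> X) \<longlonglongrightarrow> 0"
          by - (rule tendsto_norm_zero_cancel, simp add: o_def divide_inverse_commute)
      qed
    qed auto
    have "\<exists>c. \<forall>t\<in>S. A (p + t *\<^sub>R q) z = c"
      by (rule has_vector_derivative_zero_constant[OF cS vd]) auto
    then obtain c where c: "\<And>t. t \<in> S \<Longrightarrow> A (p + t *\<^sub>R q) z = c" by blast
    show ?thesis using c[of 0] c[of 1] that by (simp add: S_def q_def)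
  qed

  \<comment> \<open>Half the radius, so that both \<open>Complex x y\<close> and
    \<open>x + y\<close> stay in the disc of radius \<open>d\<close> when \<open>x\<close> and
    \<open>y\<close> are below \<open>h\<close>.\<close>
  define h where "h = d / 2"
  have h: "h > 0" using d by (simp add: h_def)
  define a where "a x = A (of_real x) 1 - 1" for x
  have nd: "norm (Complex x y) < d" if "\<bar>x\<bar> < h" "\<bar>y\<bar> < h" for x y
    using cmod_le[of "Complex x y"] that by (simp add: h_def)
  \<comment> \<open>By \<open>const\<close>, the values of \<open>A p\<close> at \<open>1\<close>,
    \<open>\<i>\<close> and \<open>1 + \<i>\<close> depend only on \<open>Re p\<close>,
    \<open>Im p\<close> and \<open>Re p + Im p\<close>. Comparing them through linearity gives the
    same function \<open>a\<close> in both components, and Cauchy's functional equation for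
    it.\<close>
  have Acomp: "A (Complex x y) 1 = 1 + a x \<and> A (Complex x y) \<i> = \<i> + a y" and
    additive: "\<bar>x + y\<bar> < h \<Longrightarrow> a (x + y) = a x + a y"
    if xy: "\<bar>x\<bar> < h" "\<bar>y\<bar> < h" for x y
  proof -
    have r: "norm (complex_of_real x) < d" if "\<bar>x\<bar> < d" for x using that by simp
    have 1: "A (Complex x y) 1 = 1 + a x" if "\<bar>x\<bar> < h" "\<bar>y\<bar> < h" for x y
      using const[of "Complex x y" "of_real x" 1] nd[OF that] that h
      by (simp add: a_def inner_complex_def h_def)
    have diag: "A (Complex x y) (1 + \<i>) = A (of_real (x + y)) (1 + \<i>)" if "\<bar>x\<bar> < h" "\<bar>y\<bar> < h" for x y
      using const[of "Complex x y" "of_real (x + y)" "1 + \<i>"] nd[OF that] that r[of "x + y"]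
      by (simp add: inner_complex_def h_def)
    have i0: "A (of_real x) \<i> = \<i>" if "\<bar>x\<bar> < d" for x
      using const[of "of_real x" 0 \<i>] r[OF that] d A0 by (simp add: inner_complex_def)
    have s: "A (of_real x) (1 + \<i>) = 1 + a x + \<i>" if "\<bar>x\<bar> < d" for x
      using i0[OF that] by (simp add: blinfun.add_right a_def)
    have 2: "A (Complex x y) \<i> = \<i> + a (x + y) - a x" if "\<bar>x\<bar> < h" "\<bar>y\<bar> < h" for x y
    proof -
      have "A (Complex x y) 1 + A (Complex x y) \<i> = 1 + a (x + y) + \<i>"
        using diag[OF that] s[of "x + y"] that by (simp add: blinfun.add_right h_def)
      then show ?thesis using 1[OF that] by (simp add: algebra_simps)
    qed
    have a0: "a 0 = 0" by (simp add: a_def A0)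
    have 3: "A (Complex x y) \<i> = \<i> + a y"
      using const[of "Complex x y" "Complex 0 y" \<i>] nd[OF xy] nd[of 0 y] 2[of 0 y] xy h a0
      by (simp add: inner_complex_def)
    show "A (Complex x y) 1 = 1 + a x \<and> A (Complex x y) \<i> = \<i> + a y" using 1[OF xy] 3 by simp
    show "a (x + y) = a x + a y" using 2[OF xy] 3 by (simp add: algebra_simps)
  qed
  have a0: "a 0 = 0" by (simp add: a_def A0)
  obtain P1 :: "complex \<Rightarrow>\<^sub>L complex" where P1: "\<And>z. z \<noteq> 0 \<Longrightarrow> f.D (A 0 z) (P1 z) = (1 \<bullet> z) * \<phi> 0 z"
    using exP[of 0 1] d(1) unfolding norm_zero by blast
  define c where "c = P1 1"
  \<comment> \<open>An additive function differentiable at \<open>0\<close> is linear: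
    \<open>a x\<close> is \<open>x\<close> times the difference quotient at
    \<open>x / (n + 1)\<close>, for every \<open>n\<close>. Uniqueness of the derivative
    \<open>P1\<close> makes \<open>c\<close> independent of \<open>x\<close>.\<close>
  have lin: "a x = x *\<^sub>R c" if "\<bar>x\<bar> < h" for x
  proof (cases "x = 0")
    case False
    define t where "t n = x * inverse (real (Suc n))" for n
    have tn: "real (Suc n) * t n = x" for n by (simp add: t_def)
    have "\<bar>real k * t n\<bar> \<le> \<bar>x\<bar>" if "k \<le> Suc n" for k n
    proof -
      have "\<bar>real k * t n\<bar> = \<bar>x\<bar> * (real k / real (Suc n))" by (simp add: t_def abs_mult divide_inverse)
      also have "\<dots> \<le> \<bar>x\<bar> * 1" using that by (intro mult_left_mono) auto
      finally show ?thesis by simp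
    qed
    note kt = this
    have mult: "a (real k * t n) = real k *\<^sub>R a (t n)" if "k \<le> Suc n" for k n
      using that
    proof (induction k)
      case 0
      then show ?case by (simp add: a0)
    next
      case (Suc k)
      have "real (Suc k) * t n = real k * t n + t n" by (simp add: algebra_simps)
      moreover have "a (real k * t n + t n) = a (real k * t n) + a (t n)"
      proof (rule additive)
        show "\<bar>real k * t n\<bar> < h" using kt[of k n] Suc.prems \<open>\<bar>x\<bar> < h\<close> by simp
        show "\<bar>t n\<bar> < h" using kt[of 1 n] \<open>\<bar>x\<bar> < h\<close> by simp
        show "\<bar>real k * t n + t n\<bar> < h"
          using kt[of "Suc k" n] Suc.prems \<open>\<bar>x\<bar> < h\<close> by (simp add: algebra_simps)
      qed
      ultimately show ?case using Suc by (simp add: scaleR_add_left)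
    qed
    have axn: "a x = x *\<^sub>R (a (t n) /\<^sub>R t n)" for n
    proof -
      have "a x = real (Suc n) *\<^sub>R a (t n)" using mult[of "Suc n" n] tn by simp
      also have "\<dots> = (x / t n) *\<^sub>R a (t n)" using False by (simp add: t_def divide_inverse)
      finally show ?thesis by (simp add: divide_inverse)
    qed
    have "\<exists>P. (\<lambda>n. (A (0 + t n *\<^sub>R 1) - A 0) /\<^sub>R t n) \<longlonglongrightarrow> P \<and>
      (\<forall>z. z \<noteq> 0 \<longrightarrow> f.D (A 0 z) (P z) = (1 \<bullet> z) * \<phi> 0 z)"
    proof (rule deriv)
      show "norm (0 :: complex) < d" using d by simp
      show "t \<longlonglongrightarrow> 0" unfolding t_def
        using tendsto_mult[OF tendsto_const LIMSEQ_inverse_real_of_nat] by force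
      show "t n \<noteq> 0" for n using False by (simp add: t_def)
      show "norm (0 + t n *\<^sub>R 1 :: complex) < d" for n using kt[of 1 n] that h by (simp add: h_def)
    qed
    then obtain P :: "complex \<Rightarrow>\<^sub>L complex" where P: "(\<lambda>n. (A (of_real (t n)) - A 0) /\<^sub>R t n) \<longlonglongrightarrow> P"
      "\<And>z. z \<noteq> 0 \<Longrightarrow> f.D (A 0 z) (P z) = (1 \<bullet> z) * \<phi> 0 z"
      by (auto simp: scaleR_conv_of_real)
    have "P - P1 = 0"
      by (rule f.not_rotation_like_at[OF nrf injA[of 0]])
         (use d P(2) P1 nzA[of 0] in \<open>auto simp: blinfun.diff_left linear_diff[OF f.linear_D]\<close>)
    then have "P = P1" by simp
    have "(\<lambda>n. a (t n) /\<^sub>R t n) \<longlonglongrightarrow> c"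
      using tendsto_blinfun_apply[OF P(1), of 1]
      by (simp add: c_def \<open>P = P1\<close> blinfun.scaleR_left blinfun.diff_left A0 a_def)
    then have "(\<lambda>n. x *\<^sub>R (a (t n) /\<^sub>R t n)) \<longlonglongrightarrow> x *\<^sub>R c" by (intro tendsto_intros)
    then show ?thesis unfolding axn[symmetric] by (simp add: LIMSEQ_const_iff)
  qed (simp add: a0)

  have "A p z = z + (p \<bullet> z) *\<^sub>R c" if "norm p < h" for p z
  proof -
    have re: "\<bar>Re p\<bar> < h" "\<bar>Im p\<bar> < h"
      using that abs_Re_le_cmod[of p] abs_Im_le_cmod[of p] by auto
    have "A p z = Re z *\<^sub>R A p 1 + Im z *\<^sub>R A p \<i>" by (rule linear_Re_Im[OF linear_blinfun_apply])
    also have "\<dots> = Re z *\<^sub>R (1 + Re p *\<^sub>R c) + Im z *\<^sub>R (\<i> + Im p *\<^sub>R c)"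
      using Acomp[OF re] lin[OF re(1)] lin[OF re(2)] by simp
    also have "\<dots> = z + (p \<bullet> z) *\<^sub>R c" by (simp add: complex_eq_iff inner_complex_def algebra_simps)
    finally show ?thesis .
  qed
  then have lin_sec: "F (J z + (p \<bullet> z) *\<^sub>R b) = F (J (z + (p \<bullet> z) *\<^sub>R c))" if "norm p < h" for p z
    using A(2)[of p z] that h by (simp add: f_def g_def h_def)
  show ?thesis by (rule segment_of_linear_sections[OF J inj h lin_sec])
qed

end

section \<open>Quadratic sections\<close>

text \<open>The second difference at \<open>c\<close> with step \<open>t v\<close> isolates
  \<open>2 * t\<^sup>2 * B v v\<close>, and for small \<open>t\<close> its three points lie in the
  ball.\<close>

lemma bilinear_eq_on_ball:
  fixes B C :: "'a::real_normed_vector \<Rightarrow> 'a \<Rightarrow> real"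
  assumes B: "bilinear B" and C: "bilinear C" and e: "e > 0" and eq: "\<And>v. v \<in> ball c e \<Longrightarrow> B v v = C v v"
  shows "B v v = C v v"
proof -
  define t where "t = e / (2 * (norm v + 1))"
  have t: "t > 0" using e by (simp add: t_def add_nonneg_pos)
  have "t * norm v \<le> t * (norm v + 1)" using t by simp
  also have "\<dots> = e / 2" using norm_ge_zero[of v] by (simp add: t_def field_simps add_nonneg_eq_0_iff)
  finally have tv: "t * norm v < e" using e by linarith
  have "c + t *\<^sub>R v \<in> ball c e" "c - t *\<^sub>R v \<in> ball c e" "c \<in> ball c e"
    using tv t e by (auto simp: dist_norm)
  note E = this[THEN eq]
  have q: "D (c + s *\<^sub>R v) (c + s *\<^sub>R v) = D c c + s * (D c v + D v c) + s\<^sup>2 * D v v" if "bilinear D"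
    for D :: "'a \<Rightarrow> 'a \<Rightarrow> real" and s
    using that by (simp add: bilinear_ladd bilinear_radd bilinear_lmul bilinear_rmul algebra_simps power2_eq_square)
  have "D (c + t *\<^sub>R v) (c + t *\<^sub>R v) + D (c - t *\<^sub>R v) (c - t *\<^sub>R v) = 2 * D c c + 2 * (t\<^sup>2 * D v v)"
    if "bilinear D" for D :: "'a \<Rightarrow> 'a \<Rightarrow> real"
    using q[OF that, of t] q[OF that, of "- t"] by simp
  then have "t\<^sup>2 * B v v = t\<^sup>2 * C v v"
    using E B C by (smt (verit))
  then show ?thesis using t by simp
qed

context smooth_gauge
begin

definition quadratic_section :: "'a \<Rightarrow> 'a \<Rightarrow> bool" where
  "quadratic_section u v \<longleftrightarrow>
     (\<exists>p q r. \<forall>x y. (F (x *\<^sub>R u + y *\<^sub>R v))\<^sup>2 = p * x\<^sup>2 + q * (x * y) + r * y\<^sup>2)"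

text \<open>Both sides are half the mixed coefficient \<open>q\<close>, which is the derivative of
  \<open>F\<^sup>2\<close> at \<open>u\<close> along \<open>v\<close> and also at \<open>v\<close>
  along \<open>u\<close>.\<close>

lemma quadratic_section_symmetric:
  assumes "quadratic_section u v" "u \<noteq> 0" "v \<noteq> 0"
  shows "F u * D u v = F v * D v u"
proof -
  obtain p q r where Q: "\<And>x y. (F (x *\<^sub>R u + y *\<^sub>R v))\<^sup>2 = p * x\<^sup>2 + q * (x * y) + r * y\<^sup>2"
    using assms(1) unfolding quadratic_section_def by blast
  have der: "((\<lambda>t. (F (x + t *\<^sub>R y))\<^sup>2) has_real_derivative 2 * F x * D x y) (at 0)" if "x \<noteq> 0" for x y
  proof -
    interpret Dx: linear "D x" by (rule linear_D[OF that])
    have "((\<lambda>t. F (x + t *\<^sub>R y)) has_derivative (\<lambda>t. D x (t *\<^sub>R y))) (at 0)"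
      by (rule has_derivative_compose[of "\<lambda>t. x + t *\<^sub>R y"])
         (use has_derivative[OF that] in \<open>auto intro!: derivative_eq_intros\<close>)
    then have "((\<lambda>t. F (x + t *\<^sub>R y)) has_real_derivative D x y) (at 0)"
      by (simp add: has_field_derivative_def Dx.scaleR mult_commute_abs)
    from DERIV_power[OF this, of 2] show ?thesis by (simp add: mult_ac)
  qed
  have "(F (u + t *\<^sub>R v))\<^sup>2 = p + q * t + r * t\<^sup>2" for t using Q[of 1 t] by simp
  then have 1: "((\<lambda>t. (F (u + t *\<^sub>R v))\<^sup>2) has_real_derivative q) (at 0)"
    by (auto intro!: derivative_eq_intros)
  have "(F (v + t *\<^sub>R u))\<^sup>2 = p * t\<^sup>2 + q * t + r" for t using Q[of t 1] by (simp add: add.commute)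
  then have 2: "((\<lambda>t. (F (v + t *\<^sub>R u))\<^sup>2) has_real_derivative q) (at 0)"
    by (auto intro!: derivative_eq_intros)
  have "2 * F u * D u v = q" "2 * F v * D v u = q"
    using DERIV_unique[OF der[OF assms(2)] 1] DERIV_unique[OF der[OF assms(3)] 2] by auto
  then show ?thesis by simp
qed

text \<open>Where sections are quadratic, the differential \<open>L v\<close> of \<open>F\<^sup>2 / 2\<close> satisfies \<open>L v d = L d v\<close>. Taking
  the vectors \<open>d\<close> from a fixed spanning set makes \<open>L v v\<close> a quadratic form in \<open>v\<close>.\<close>

lemma locally_quadratic:
  assumes b: "b1 \<noteq> 0" "b2 \<noteq> 0" and "\<delta> > 0"
    and quad: "\<And>u v. u \<in> ball b1 \<delta> \<Longrightarrow> v \<in> ball b2 \<delta> \<Longrightarrow> quadratic_section u v"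
  shows "\<exists>B e. bilinear B \<and> e > 0 \<and> (\<forall>v\<in>ball b2 e. (F v)\<^sup>2 = B v v)"
proof -
  define e where "e = min \<delta> (min (norm b1) (norm b2))"
  have e: "e > 0" "e \<le> \<delta>" using assms by (auto simp: e_def)
  have nz: "u \<noteq> 0" "v \<noteq> 0" if "u \<in> ball b1 e" "v \<in> ball b2 e" for u v
    using that by (auto simp: e_def dist_norm)
  define s where "s = e / 2"
  have s: "s > 0" "s < e" using e by (auto simp: s_def)
  define L where "L u v = F u * D u v" for u v
  \<comment> \<open>By linearity \<open>L v i\<close> is the difference quotient of
    \<open>L v\<close> between \<open>b1\<close> and \<open>b1 + s i\<close>. The symmetry then
    moves \<open>v\<close> into the linear argument, with \<open>L\<close> taken at points that do
    not depend on \<open>v\<close>.\<close>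
  define B where "B u v = (\<Sum>i\<in>Basis. (u \<bullet> i) * ((L (b1 + s *\<^sub>R i) v - L b1 v) / s))" for u v
  have ball: "b1 + s *\<^sub>R i \<in> ball b1 e" if "i \<in> Basis" for i using s that by (simp add: dist_norm)
  have ball1: "b1 \<in> ball b1 e" using e by simp
  have b2e: "b2 \<in> ball b2 e" using e by simp
  have linL: "linear (L u)" if "u \<noteq> 0" for u
  proof -
    interpret Du: linear "D u" by (rule linear_D[OF that])
    show ?thesis by (rule linearI) (auto simp: L_def Du.add Du.scaleR algebra_simps)
  qed
  define T where "T i v = (L (b1 + s *\<^sub>R i) v - L b1 v) / s" for i v
  have "linear (T i)" if "i \<in> Basis" for i
  proof -
    interpret L1: linear "L b1" using linL nz(1)[OF ball1 b2e] by blast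
    interpret Li: linear "L (b1 + s *\<^sub>R i)" using linL nz(1)[OF ball[OF that] b2e] by blast
    show ?thesis
      by (rule linearI) (auto simp: T_def L1.add L1.scaleR Li.add Li.scaleR diff_divide_distrib add_divide_distrib algebra_simps)
  qed
  then have T: "linear (T i)" if "i \<in> Basis" for i using that by blast
  have BT: "B u v = (\<Sum>i\<in>Basis. (u \<bullet> i) * T i v)" for u v by (simp add: B_def T_def)
  have "bilinear B"
    unfolding bilinear_def BT
  proof (intro conjI allI linearI)
    fix u v w :: 'a and c :: real
    show "(\<Sum>i\<in>Basis. ((u + w) \<bullet> i) * T i v) = (\<Sum>i\<in>Basis. (u \<bullet> i) * T i v) + (\<Sum>i\<in>Basis. (w \<bullet> i) * T i v)"
      by (simp add: inner_add_left distrib_right sum.distrib)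
    show "(\<Sum>i\<in>Basis. ((c *\<^sub>R u) \<bullet> i) * T i v) = c *\<^sub>R (\<Sum>i\<in>Basis. (u \<bullet> i) * T i v)"
      by (simp add: sum_distrib_left mult.assoc)
    show "(\<Sum>i\<in>Basis. (u \<bullet> i) * T i (v + w)) = (\<Sum>i\<in>Basis. (u \<bullet> i) * T i v) + (\<Sum>i\<in>Basis. (u \<bullet> i) * T i w)"
      by (simp add: linear_add[OF T] distrib_left sum.distrib)
    show "(\<Sum>i\<in>Basis. (u \<bullet> i) * T i (c *\<^sub>R v)) = c *\<^sub>R (\<Sum>i\<in>Basis. (u \<bullet> i) * T i v)"
      by (simp add: linear_scale[OF T] sum_distrib_left mult.left_commute)
  qed
  moreover have "(F v)\<^sup>2 = B v v" if v: "v \<in> ball b2 e" for v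
  proof -
    have v0: "v \<noteq> 0" using nz(2)[OF ball1 v] .
    interpret Lv: linear "L v" by (rule linL[OF v0])
    have sym: "L v u = L u v" if "u \<in> ball b1 e" for u
      unfolding L_def using quadratic_section_symmetric[OF quad nz(1)[OF that v] v0] that v e
      by auto
    have "L v i = (L (b1 + s *\<^sub>R i) v - L b1 v) / s" if "i \<in> Basis" for i
    proof -
      have "L v (b1 + s *\<^sub>R i) = L v b1 + s * L v i" by (simp add: Lv.add Lv.scaleR)
      then show ?thesis using sym[OF ball[OF that]] sym[OF ball1] s by (simp add: field_simps)
    qed
    then have "B v v = (\<Sum>i\<in>Basis. (v \<bullet> i) * L v i)" by (simp add: B_def)
    also have "\<dots> = L v (\<Sum>i\<in>Basis. (v \<bullet> i) *\<^sub>R i)" by (simp add: Lv.sum Lv.scaleR)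
    also have "\<dots> = (F v)\<^sup>2" using D_self[OF v0] by (simp add: euclidean_representation L_def power2_eq_square)
    finally show ?thesis by simp
  qed
  ultimately show ?thesis using e(1) by blast
qed

text \<open>Forms belonging to nearby points agree on a small ball, hence everywhere. Their
  diagonals are thus locally constant in \<open>z\<close>, and the punctured plane is
  connected.\<close>

lemma glue_quadratic:
  assumes J: "linear (J :: complex \<Rightarrow> 'a)"
    and loc: "\<And>z. z \<noteq> 0 \<Longrightarrow> \<exists>B e. bilinear B \<and> e > 0 \<and> (\<forall>v\<in>ball (J z) e. (F v)\<^sup>2 = B v v)"
  shows "\<exists>B. bilinear B \<and> (\<forall>z. z \<noteq> 0 \<longrightarrow> (\<exists>e>0. \<forall>v\<in>ball (J z) e. (F v)\<^sup>2 = B v v))"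
proof -
  obtain B e where B: "\<And>z. z \<noteq> 0 \<Longrightarrow> bilinear (B z)" and e: "\<And>z. z \<noteq> 0 \<Longrightarrow> (e z :: real) > 0"
    and BF: "\<And>z v. z \<noteq> 0 \<Longrightarrow> v \<in> ball (J z) (e z) \<Longrightarrow> (F v)\<^sup>2 = B z v v"
    using loc by metis
  define g where "g z = (\<lambda>v. B z v v)" for z
  have "g 1 = g z" if "z \<noteq> 0" for z
  proof (rule connected_local_const[of "- {0}"])
    show "connected (- {0 :: complex})" by (rule connected_punctured_universe) simp
    show "\<forall>a\<in>- {0}. \<forall>\<^sub>F b in at a within - {0}. g a = g b"
    proof
      fix a :: complex assume "a \<in> - {0}"
      then have a: "a \<noteq> 0" by simp
      have "(J \<longlongrightarrow> J a) (at a within - {0})"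
        using J by (intro bounded_linear.tendsto[OF _ tendsto_ident_at]) (simp add: linear_conv_bounded_linear)
      then have "\<forall>\<^sub>F b in at a within - {0}. dist (J b) (J a) < e a" using e[OF a] by (rule tendstoD)
      moreover have "\<forall>\<^sub>F b in at a within - {0}. b \<in> - {0}" by (simp add: eventually_at_filter)
      ultimately show "\<forall>\<^sub>F b in at a within - {0}. g a = g b"
      proof eventually_elim
        case (elim b)
        then have b: "b \<noteq> 0" by simp
        define d where "d = min (e b) (e a - dist (J b) (J a))"
        have d: "d > 0" using e[OF b] elim by (simp add: d_def)
        have "B a v v = B b v v" if "v \<in> ball (J b) d" for v
        proof -
          have "dist (J a) v \<le> dist (J b) (J a) + dist (J b) v" using dist_triangle3[of "J a" v "J b"] by simp
          then have "v \<in> ball (J a) (e a)" "v \<in> ball (J b) (e b)" using that by (auto simp: d_def)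
          then show ?thesis using BF[OF a] BF[OF b] by metis
        qed
        then show ?case
          unfolding g_def using bilinear_eq_on_ball[OF B[OF a] B[OF b] d] by blast
      qed
    qed
  qed (use that in auto)
  then have "(F v)\<^sup>2 = B 1 v v" if "z \<noteq> 0" "v \<in> ball (J z) (e z)" for z v
    using BF[OF that] that(1) unfolding g_def by metis
  moreover have "bilinear (B 1)" using B[of 1] by simp
  ultimately show ?thesis using e by metis
qed

text \<open>\<open>Im (cnj z1 * z2)\<close> is the determinant of \<open>z1\<close> and
  \<open>z2\<close>, so \<open>sec\<close> speaks of perturbations of every basis of
  \<open>H\<close>. Varying the basis is what reaches a neighbourhood of each nonzero point of
  \<open>H\<close>.\<close>

theorem sections_equivalent_imp_quadratic:
  fixes J :: "complex \<Rightarrow> 'a"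
  assumes strict: "\<nexists>x k e. x \<noteq> 0 \<and> k \<noteq> 0 \<and> e > 0 \<and> (\<forall>s. \<bar>s\<bar> < e \<longrightarrow> F (x + s *\<^sub>R k) = F x)"
    and J: "linear J" and inj: "\<And>z t. J z + t *\<^sub>R b = 0 \<Longrightarrow> z = 0 \<and> t = 0"
    and sec: "\<And>z1 z2. Im (cnj z1 * z2) \<noteq> 0 \<Longrightarrow> \<exists>\<delta>>0. \<forall>u\<in>ball (J z1) \<delta>. \<forall>v\<in>ball (J z2) \<delta>.
       \<exists>a c. \<forall>x y. F (x *\<^sub>R u + y *\<^sub>R v) = F (J (x *\<^sub>R a + y *\<^sub>R c))"
  shows "\<exists>B. bilinear B \<and> (\<forall>x y. B x y = B y x) \<and> (\<forall>x. x \<noteq> 0 \<longrightarrow> B x x > 0) \<and>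
     (\<forall>z. z \<noteq> 0 \<longrightarrow> (\<exists>e>0. \<forall>v\<in>ball (J z) e. (F v)\<^sup>2 = B v v))"
proof -
  interpret J: linear J by fact
  have J0: "J z \<noteq> 0" if "z \<noteq> 0" for z using inj[of z 0] that by auto
  have injJ: "inj J" using linear_injective_0[OF J] J0 by auto
  interpret f: planar_gauge "\<lambda>z. F (J z)"
    unfolding planar_gauge_def by (rule pullback[OF J injJ])
  have rot: "rotation_like (\<lambda>z. F (J z))"
  proof (rule ccontr)
    assume nr: "\<not> rotation_like (\<lambda>z. F (J z))"
    obtain \<delta> where \<delta>: "\<delta> > 0" "\<And>u v. u \<in> ball (J 1) \<delta> \<Longrightarrow> v \<in> ball (J \<i>) \<delta> \<Longrightarrow>
       \<exists>a c. \<forall>x y. F (x *\<^sub>R u + y *\<^sub>R v) = F (J (x *\<^sub>R a + y *\<^sub>R c))"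
      using sec[of 1 \<i>] by auto
    define d where "d = \<delta> / (norm b + 1)"
    have d: "d > 0" using \<delta>(1) by (simp add: d_def add_nonneg_pos)
    have "\<exists>M :: complex \<Rightarrow>\<^sub>L complex. \<forall>z. F (J (M z)) = F (J z + (p \<bullet> z) *\<^sub>R b)" if p: "norm p < d" for p
    proof -
      have s: "norm (s *\<^sub>R b) < \<delta>" if "\<bar>s\<bar> \<le> norm p" for s
      proof -
        have "norm (s *\<^sub>R b) \<le> norm p * (norm b + 1)" using that by (simp add: mult_mono)
        also have "\<dots> < d * (norm b + 1)" using p by (intro mult_strict_right_mono) (auto simp: add_nonneg_pos)
        also have "\<dots> = \<delta>"
        proof -
          have "norm b + 1 \<noteq> 0" using norm_ge_zero[of b] by linarith
          then show ?thesis by (simp add: d_def)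
        qed
        finally show ?thesis .
      qed
      have "J 1 + Re p *\<^sub>R b \<in> ball (J 1) \<delta>" "J \<i> + Im p *\<^sub>R b \<in> ball (J \<i>) \<delta>"
        using s[OF abs_Re_le_cmod] s[OF abs_Im_le_cmod] by (auto simp: dist_norm)
      from \<delta>(2)[OF this] obtain a c where
        ac: "\<And>x y. F (x *\<^sub>R (J 1 + Re p *\<^sub>R b) + y *\<^sub>R (J \<i> + Im p *\<^sub>R b)) = F (J (x *\<^sub>R a + y *\<^sub>R c))"
        by blast
      define M where "M z = Re z *\<^sub>R a + Im z *\<^sub>R c" for z
      have "linear M" by (rule linearI) (auto simp: M_def algebra_simps)
      then have BM: "blinfun_apply (Blinfun M) = M"
        by (simp add: bounded_linear_Blinfun_apply linear_conv_bounded_linear)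
      have "F (J (M z)) = F (J z + (p \<bullet> z) *\<^sub>R b)" for z
      proof -
        have "Re z *\<^sub>R (J 1 + Re p *\<^sub>R b) + Im z *\<^sub>R (J \<i> + Im p *\<^sub>R b) = J z + (p \<bullet> z) *\<^sub>R b"
          unfolding linear_Re_Im[OF J, of z] by (simp add: inner_complex_def algebra_simps)
        then show ?thesis using ac[of "Re z" "Im z"] by (simp add: M_def)
      qed
      then show ?thesis using BM by metis
    qed
    from sections_not_rotation_like_segment[OF J inj d this nr] strict show False by blast
  qed
  obtain p q r where pqr: "\<And>z. (F (J z))\<^sup>2 = p * (Re z)\<^sup>2 + q * (Re z * Im z) + r * (Im z)\<^sup>2"
    using f.rotation_like_quadratic[OF rot] by metis
  have loc: "\<exists>B e. bilinear B \<and> e > 0 \<and> (\<forall>v\<in>ball (J z) e. (F v)\<^sup>2 = B v v)" if z: "z \<noteq> 0" for z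
  proof -
    have "cnj (\<i> * z) * z = - \<i> * complex_of_real ((norm z)\<^sup>2)"
      unfolding complex_norm_square by (simp add: mult.commute)
    then have "Im (cnj (\<i> * z) * z) = - (norm z)\<^sup>2" by (simp only:) simp
    then have "Im (cnj (\<i> * z) * z) \<noteq> 0" using z by (metis neg_equal_0_iff_equal norm_eq_zero power_eq_0_iff)
    from sec[OF this] obtain \<delta> where \<delta>: "\<delta> > 0"
      "\<And>u v. u \<in> ball (J (\<i> * z)) \<delta> \<Longrightarrow> v \<in> ball (J z) \<delta> \<Longrightarrow>
       \<exists>a c. \<forall>x y. F (x *\<^sub>R u + y *\<^sub>R v) = F (J (x *\<^sub>R a + y *\<^sub>R c))" by blast
    show ?thesis
    proof (rule locally_quadratic[OF J0 J0 \<delta>(1)])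
      fix u v assume "u \<in> ball (J (\<i> * z)) \<delta>" "v \<in> ball (J z) \<delta>"
      from \<delta>(2)[OF this] obtain a c where
        ac: "\<And>x y. F (x *\<^sub>R u + y *\<^sub>R v) = F (J (x *\<^sub>R a + y *\<^sub>R c))" by blast
      have "(F (x *\<^sub>R u + y *\<^sub>R v))\<^sup>2 = (p * (Re a)\<^sup>2 + q * (Re a * Im a) + r * (Im a)\<^sup>2) * x\<^sup>2
        + (2 * p * Re a * Re c + q * (Re a * Im c + Im a * Re c) + 2 * r * Im a * Im c) * (x * y)
        + (p * (Re c)\<^sup>2 + q * (Re c * Im c) + r * (Im c)\<^sup>2) * y\<^sup>2" for x y
        unfolding ac pqr by (simp add: algebra_simps power2_eq_square)
      then show "quadratic_section u v" unfolding quadratic_section_def by blast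
    qed (use z in auto)
  qed
  from glue_quadratic[OF J loc] obtain B0 where B0: "bilinear B0"
    "\<And>z. z \<noteq> 0 \<Longrightarrow> \<exists>e>0. \<forall>v\<in>ball (J z) e. (F v)\<^sup>2 = B0 v v" by blast
  define B where "B u v = (B0 u v + B0 v u) / 2" for u v
  have B: "bilinear B"
    unfolding bilinear_def B_def using B0(1)
    by (auto intro!: linearI simp: bilinear_ladd bilinear_radd bilinear_lmul bilinear_rmul field_simps)
  have sym: "B u v = B v u" for u v by (simp add: B_def)
  have BF: "\<exists>e>0. \<forall>v\<in>ball (J z) e. (F v)\<^sup>2 = B v v" if "z \<noteq> 0" for z
    using B0(2)[OF that] by (simp add: B_def)
  have "B w w > 0" if w: "w \<noteq> 0" for w
  proof (rule ccontr)
    assume "\<not> B w w > 0"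
    \<comment> \<open>A linear functional on a plane has a nonzero zero. With this \<open>z\<close>
      the form at \<open>J z + s w\<close> has no term linear in \<open>s\<close>.\<close>
    obtain z where z: "z \<noteq> 0" "B (J z) w = 0"
    proof (cases "B (J 1) w = 0")
      case True
      then show ?thesis using that[of 1] by simp
    next
      case False
      define z where "z = Complex (B (J \<i>) w) (- B (J 1) w)"
      have "B (J z) w = 0"
        unfolding linear_Re_Im[OF J, of z]
        by (simp add: z_def bilinear_lsub[OF B] bilinear_lmul[OF B])
      moreover have "z \<noteq> 0" using False by (simp add: z_def complex_eq_iff)
      ultimately show ?thesis by (rule that[rotated])
    qed
    obtain e where e: "e > 0" "\<And>v. v \<in> ball (J z) e \<Longrightarrow> (F v)\<^sup>2 = B v v" using BF[OF z(1)] by blast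
    have le: "F (J z + s *\<^sub>R w) \<le> F (J z)" if "\<bar>s\<bar> < e / norm w" for s
    proof -
      have "J z + s *\<^sub>R w \<in> ball (J z) e" using that w by (simp add: dist_norm field_simps)
      then have "(F (J z + s *\<^sub>R w))\<^sup>2 = B (J z + s *\<^sub>R w) (J z + s *\<^sub>R w)" by (rule e(2))
      also have "\<dots> = B (J z) (J z) + s\<^sup>2 * B w w"
        using z(2) sym[of w "J z"] by (simp add: bilinear_ladd[OF B] bilinear_radd[OF B] bilinear_lmul[OF B]
            bilinear_rmul[OF B] power2_eq_square)
      also have "\<dots> \<le> B (J z) (J z)" using \<open>\<not> B w w > 0\<close> by (simp add: mult_nonneg_nonpos)
      also have "\<dots> = (F (J z))\<^sup>2" using e by simp
      finally show ?thesis using nonneg by (rule power2_le_imp_le)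
    qed
    have "F (J z + s *\<^sub>R w) = F (J z)" if s: "\<bar>s\<bar> < e / norm w" for s
    proof (rule antisym)
      \<comment> \<open>Midpoint convexity turns the upper bounds at \<open>s\<close> and
        \<open>- s\<close> into equalities, which produces a flat segment.\<close>
      have "2 * F (J z) = F (2 *\<^sub>R J z)" by (simp add: scale)
      also have "2 *\<^sub>R J z = (J z + s *\<^sub>R w) + (J z + (- s) *\<^sub>R w)" by (simp add: scaleR_2)
      also have "F \<dots> \<le> F (J z + s *\<^sub>R w) + F (J z + (- s) *\<^sub>R w)" by (rule subadd)
      finally show "F (J z) \<le> F (J z + s *\<^sub>R w)" using le[of "- s"] s by simp
    qed (rule le[OF s])
    moreover have "e / norm w > 0" using e(1) w by simp
    ultimately show False using strict J0[OF z(1)] w by blast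
  qed
  then show ?thesis using B sym BF by blast
qed

end

section \<open>Ellipsoids\<close>

text \<open>Principal axes by induction on the dimension: a maximizer \<open>a\<close> of
  \<open>B x x\<close> on the unit sphere of \<open>V\<close> is \<open>B\<close>-orthogonal to its
  orthogonal complement in \<open>V\<close>, so the form splits there.\<close>

lemma bilinear_diagonalization:
  fixes B :: "'a::euclidean_space \<Rightarrow> 'a \<Rightarrow> real"
  assumes B: "bilinear B" and sym: "\<And>x y. B x y = B y x" and pos: "\<And>x. x \<noteq> 0 \<Longrightarrow> B x x > 0"
  shows "subspace V \<Longrightarrow> \<exists>A r. finite A \<and> pairwise orthogonal A \<and> (\<forall>a\<in>A. norm a = 1) \<and> span A = V \<and>
     (\<forall>a\<in>A. r a > 0) \<and> (\<forall>x\<in>V. B x x = (\<Sum>a\<in>A. ((x \<bullet> a) / r a)\<^sup>2))"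
proof (induction "dim V" arbitrary: V rule: less_induct)
  case less
  note V = less.prems
  note bil = bilinear_ladd[OF B] bilinear_radd[OF B] bilinear_lmul[OF B] bilinear_rmul[OF B] sym
  show ?case
  proof (cases "V = {0}")
    case True
    then show ?thesis
      by (intro exI[of _ "{}"] exI[of _ "\<lambda>_. 1"]) (simp add: bilinear_lzero[OF B])
  next
    case False
    then obtain v where v: "v \<in> V" "v \<noteq> 0" using subspace_0[OF V] by auto
    have "compact (sphere 0 1 \<inter> V)" by (intro compact_Int_closed compact_sphere closed_subspace V)
    moreover have "v /\<^sub>R norm v \<in> sphere 0 1 \<inter> V" using v V by (simp add: subspace_scale)
    moreover have "continuous_on (sphere 0 1 \<inter> V) (\<lambda>x. B x x)"
      using B by (intro bounded_bilinear.continuous_on[of B] continuous_on_id)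
        (simp add: bilinear_conv_bounded_bilinear)
    ultimately obtain a where a: "a \<in> sphere 0 1 \<inter> V" "\<And>x. x \<in> sphere 0 1 \<inter> V \<Longrightarrow> B x x \<le> B a a"
      using continuous_attains_sup[of "sphere 0 1 \<inter> V" "\<lambda>x. B x x"] by blast
    have a1: "norm a = 1" "a \<in> V" "a \<noteq> 0" "a \<bullet> a = 1" using a(1) by (auto simp: norm_eq_1)
    have max: "B x x \<le> B a a * (norm x)\<^sup>2" if "x \<in> V" for x
    proof (cases "x = 0")
      case False
      have "B (x /\<^sub>R norm x) (x /\<^sub>R norm x) \<le> B a a"
        using that V False by (intro a(2)) (simp add: subspace_scale)
      then show ?thesis using False by (simp add: bil field_simps power2_eq_square)
    qed (simp add: bilinear_lzero[OF B])
    have Bay: "B a y = 0" if y: "y \<in> V" "y \<bullet> a = 0" for y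
    proof (rule ccontr)
      assume ne: "B a y \<noteq> 0"
      define K where "K = B a a * (norm y)\<^sup>2 - B y y"
      have ineq: "2 * t * B a y \<le> t\<^sup>2 * K" for t
      proof -
        have "B (a + t *\<^sub>R y) (a + t *\<^sub>R y) \<le> B a a * (norm (a + t *\<^sub>R y))\<^sup>2"
          using a1(2) y(1) V by (intro max) (simp add: subspace_add subspace_scale)
        moreover have "(norm (a + t *\<^sub>R y))\<^sup>2 = 1 + t\<^sup>2 * (norm y)\<^sup>2"
          unfolding power2_norm_eq_inner using y(2) a1(4)
          by (simp add: inner_add_left inner_add_right inner_commute power2_eq_square)
        ultimately show ?thesis by (simp add: bil K_def algebra_simps power2_eq_square)
      qed
      \<comment> \<open>A step of the sign of \<open>B a y\<close>, so small that the linear term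
        beats the quadratic one; adding one keeps the denominator positive.\<close>
      define t where "t = B a y / (\<bar>K\<bar> + 1)"
      have "2 * t * B a y \<le> t\<^sup>2 * (\<bar>K\<bar> + 1)"
        by (rule order_trans[OF ineq mult_left_mono]) auto
      moreover have tB: "t * (\<bar>K\<bar> + 1) = B a y"
      proof -
        have "\<bar>K\<bar> + 1 \<noteq> 0" by linarith
        then show ?thesis by (simp add: t_def)
      qed
      ultimately have "2 * t * B a y \<le> t * B a y"
        by (metis mult.assoc power2_eq_square)
      then have "t * B a y \<le> 0" by simp
      moreover have "t * B a y = (B a y)\<^sup>2 / (\<bar>K\<bar> + 1)" by (simp add: t_def power2_eq_square)
      moreover have "\<dots> > 0" using ne by (intro divide_pos_pos) auto
      ultimately show False by simp
    qed
    define V' where "V' = {y \<in> V. y \<bullet> a = 0}"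
    have V': "subspace V'" using V by (auto simp: V'_def subspace_def inner_add_left)
    have aV': "a \<notin> V'" using a1 by (simp add: V'_def)
    moreover have "V' \<subseteq> V" by (auto simp: V'_def)
    ultimately have "V' \<subset> V" using a1(2) by blast
    then have "dim V' < dim V" using V V' by (metis dim_psubset span_eq_iff)
    from less.hyps[OF this V'] obtain A r where A: "finite A" "pairwise orthogonal A" "\<And>a. a \<in> A \<Longrightarrow> norm a = 1"
      "span A = V'" "\<And>a. a \<in> A \<Longrightarrow> r a > 0" "\<And>x. x \<in> V' \<Longrightarrow> B x x = (\<Sum>a\<in>A. ((x \<bullet> a) / r a)\<^sup>2)" by blast
    have AV: "a' \<in> V'" if "a' \<in> A" for a' using span_base[OF that] A(4) by simp
    have anA: "a \<notin> A" using AV aV' by blast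
    define r' where "r' = r(a := 1 / sqrt (B a a))"
    have Ba: "B a a > 0" by (rule pos[OF a1(3)])
    have dec: "x - (x \<bullet> a) *\<^sub>R a \<in> V'" if "x \<in> V" for x
      using that V a1 by (simp add: V'_def subspace_diff subspace_scale inner_diff_left)
    have "span (insert a A) = V"
    proof
      show "span (insert a A) \<subseteq> V"
        using span_minimal[OF _ V, of "insert a A"] AV a1 by (auto simp: V'_def)
      show "V \<subseteq> span (insert a A)"
      proof
        fix x assume "x \<in> V"
        then have "x - (x \<bullet> a) *\<^sub>R a \<in> span (insert a A)"
          using dec A(4) span_mono[of A "insert a A"] by blast
        moreover have "(x \<bullet> a) *\<^sub>R a \<in> span (insert a A)" by (simp add: span_base span_scale)
        ultimately show "x \<in> span (insert a A)" using span_add by fastforce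
      qed
    qed
    moreover have "pairwise orthogonal (insert a A)"
      using A(2) AV by (auto simp: pairwise_insert V'_def orthogonal_def inner_commute)
    moreover have "B x x = (\<Sum>a'\<in>insert a A. ((x \<bullet> a') / r' a')\<^sup>2)" if x: "x \<in> V" for x
    proof -
      define y where "y = x - (x \<bullet> a) *\<^sub>R a"
      have y: "y \<in> V'" using dec[OF x] by (simp add: y_def)
      have "B x x = B ((x \<bullet> a) *\<^sub>R a + y) ((x \<bullet> a) *\<^sub>R a + y)" by (simp add: y_def)
      also have "\<dots> = (x \<bullet> a)\<^sup>2 * B a a + B y y"
        using Bay[of y] y sym[of y a] by (simp add: bil V'_def power2_eq_square)
      also have "B y y = (\<Sum>a'\<in>A. ((y \<bullet> a') / r a')\<^sup>2)" by (rule A(6)[OF y])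
      also have "\<dots> = (\<Sum>a'\<in>A. ((x \<bullet> a') / r' a')\<^sup>2)"
      proof (rule sum.cong)
        fix a' assume a': "a' \<in> A"
        then have "a \<bullet> a' = 0" using AV[OF a'] by (simp add: V'_def inner_commute)
        then have "y \<bullet> a' = x \<bullet> a'" by (simp add: y_def inner_diff_left)
        moreover have "r' a' = r a'" using a' anA by (auto simp: r'_def)
        ultimately show "((y \<bullet> a') / r a')\<^sup>2 = ((x \<bullet> a') / r' a')\<^sup>2" by simp
      qed simp
      also have "(x \<bullet> a)\<^sup>2 * B a a = ((x \<bullet> a) / r' a)\<^sup>2"
        using Ba by (simp add: r'_def power_mult_distrib)
      finally show ?thesis using A(1) anA by simp
    qed
    moreover have "\<forall>a'\<in>insert a A. r' a' > 0" using A(5) Ba by (auto simp: r'_def)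
    ultimately show ?thesis using A(1,3) a1(1) by (intro exI[of _ "insert a A"] exI[of _ r']) auto
  qed
qed

lemma solid_ellipsoid_in_sublevel:
  fixes B :: "'a::euclidean_space \<Rightarrow> 'a \<Rightarrow> real"
  assumes "bilinear B" "\<And>x y. B x y = B y x" "\<And>x. x \<noteq> 0 \<Longrightarrow> B x x > 0" "subspace V"
  shows "solid_ellipsoid_in V 0 {x \<in> V. B x x \<le> 1}"
proof -
  obtain A r where A: "pairwise orthogonal A" "\<forall>a\<in>A. norm a = 1" "span A = V" "\<forall>a\<in>A. r a > 0"
    "\<forall>x\<in>V. B x x = (\<Sum>a\<in>A. ((x \<bullet> a) / r a)\<^sup>2)"
    using bilinear_diagonalization[OF assms] by blast
  then have "{x \<in> V. B x x \<le> 1} = {x. x - 0 \<in> V \<and> (\<Sum>a\<in>A. (((x - 0) \<bullet> a) / r a)\<^sup>2) \<le> 1}" by auto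
  then show ?thesis using A unfolding solid_ellipsoid_in_def by blast
qed

section \<open>The Minkowski functional of a convex body\<close>

lemma C_diff_on_ident: "open U \<Longrightarrow> C_diff_on k U (\<lambda>x. x)"
proof (cases k)
  case (Suc n)
  assume "open U"
  then have "C_diff_on (Suc n) U (\<lambda>x. x)"
    by (rule C_diff_on_SucI[where f' = "\<lambda>_ h. h"]) (auto intro: C_diff_on_const)
  then show ?thesis using Suc by simp
qed simp

definition minkowski :: "'a::real_normed_vector set \<Rightarrow> 'a \<Rightarrow> real" where
  "minkowski B x = Inf {t. t > 0 \<and> x /\<^sub>R t \<in> B}"

lemma eq_if_same_upper_bounds:
  fixes a b :: real
  assumes "a \<ge> 0" "b \<ge> 0" "\<And>s. s > 0 \<Longrightarrow> (a \<le> s) = (b \<le> s)"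
  shows "a = b"
proof (rule antisym)
  show "a \<le> b"
  proof (rule dense_ge)
    fix s assume "b < s"
    then show "a \<le> s" using assms(2) assms(3)[of s] by simp
  qed
  show "b \<le> a"
  proof (rule dense_ge)
    fix s assume "a < s"
    then show "b \<le> s" using assms(1) assms(3)[of s] by simp
  qed
qed

locale pointed_body =
  fixes B :: "'a::euclidean_space set"
  assumes convex_B: "convex B" and compact_B: "compact B" and interior_0: "0 \<in> interior B"
begin

abbreviation F where "F \<equiv> minkowski B"

lemma zero_in: "0 \<in> B"
  using interior_0 interior_subset by blast

lemma upward: "t > 0 \<Longrightarrow> x /\<^sub>R t \<in> B \<Longrightarrow> t \<le> s \<Longrightarrow> x /\<^sub>R s \<in> B"
  using convexD_alt[OF convex_B zero_in, of "x /\<^sub>R t" "t / s"] by (simp add: field_simps)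

lemma nonempty: "\<exists>t>0. x /\<^sub>R t \<in> B"
proof -
  obtain r where r: "r > 0" "ball 0 r \<subseteq> B" using interior_0 by (auto simp: mem_interior)
  define t where "t = (norm x + 1) / r"
  have t: "t > 0" using r by (simp add: t_def add_nonneg_pos)
  have "norm (x /\<^sub>R t) = norm x / (norm x + 1) * r" using t r by (simp add: t_def abs_of_nonneg field_simps)
  also have "\<dots> < 1 * r" using r by (intro mult_strict_right_mono) (simp_all add: add_nonneg_pos)
  finally show ?thesis using r t by (intro exI[of _ t]) auto
qed

lemma F_nonneg: "F x \<ge> 0"
  unfolding minkowski_def using nonempty[of x] by (intro cInf_greatest) auto

text \<open>Every scale above \<open>t\<close> is admissible because \<open>B\<close> is star-shaped
  about \<open>0\<close>, and closedness of \<open>B\<close> admits the limit scale \<open>t\<close>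
  as well.\<close>

lemma F_le_iff: assumes t: "t > 0" shows "F x \<le> t \<longleftrightarrow> x /\<^sub>R t \<in> B"
proof
  have bdd: "bdd_below {t. t > 0 \<and> x /\<^sub>R t \<in> B}" by (rule bdd_belowI[of _ 0]) auto
  show "F x \<le> t" if "x /\<^sub>R t \<in> B"
    unfolding minkowski_def using bdd that t by (intro cInf_lower) auto
  assume le: "F x \<le> t"
  have "x /\<^sub>R (t + inverse (real (Suc n))) \<in> B" for n
  proof -
    have "F x < t + inverse (real (Suc n))" using le by (simp add: le_less_trans)
    then obtain s where "s > 0" "x /\<^sub>R s \<in> B" "s < t + inverse (real (Suc n))"
      unfolding minkowski_def using cInf_less_iff[OF _ bdd] nonempty[of x] by auto
    then show ?thesis using upward less_imp_le by blast
  qed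
  note m = this
  have l: "(\<lambda>n. x /\<^sub>R (t + inverse (real (Suc n)))) \<longlonglongrightarrow> x /\<^sub>R (t + 0)"
    by (intro tendsto_intros LIMSEQ_inverse_real_of_nat) (use t in auto)
  from closed_sequentially[OF compact_imp_closed[OF compact_B] m l] show "x /\<^sub>R t \<in> B" by simp
qed

sublocale gauge F
proof
  fix x y :: 'a and t :: real
  show "F x > 0" if "x \<noteq> 0"
  proof -
    obtain R where R: "R > 0" "\<And>y. y \<in> B \<Longrightarrow> norm y \<le> R"
      using compact_imp_bounded[OF compact_B] by (auto simp: bounded_pos)
    have "norm x / R \<le> F x"
      unfolding minkowski_def
    proof (rule cInf_greatest)
      show "{t. t > 0 \<and> x /\<^sub>R t \<in> B} \<noteq> {}" using nonempty by auto
      fix t assume "t \<in> {t. t > 0 \<and> x /\<^sub>R t \<in> B}"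
      then show "norm x / R \<le> t" using R(2)[of "x /\<^sub>R t"] R(1) by (simp add: field_simps)
    qed
    then show ?thesis using that R(1) by (smt (verit) divide_pos_pos zero_less_norm_iff)
  qed
  show "F (t *\<^sub>R x) = t * F x" if "t \<ge> 0"
  proof (rule eq_if_same_upper_bounds)
    fix s :: real assume s: "s > 0"
    show "(F (t *\<^sub>R x) \<le> s) = (t * F x \<le> s)"
    proof (cases "t = 0")
      case True
      then show ?thesis using F_le_iff[OF s, of 0] zero_in s by simp
    next
      case False
      then have t: "t > 0" using that by simp
      have "F (t *\<^sub>R x) \<le> s \<longleftrightarrow> x /\<^sub>R (s / t) \<in> B"
        using F_le_iff[OF s] t by (simp add: divide_inverse mult.commute)
      also have "\<dots> \<longleftrightarrow> F x \<le> s / t" using F_le_iff[of "s / t" x] s t by simp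
      finally show ?thesis using t by (simp add: field_simps)
    qed
  next
    show "0 \<le> F (t *\<^sub>R x)" by (rule F_nonneg)
    show "0 \<le> t * F x" using that F_nonneg by (intro mult_nonneg_nonneg)
  qed
  show "F (x + y) \<le> F x + F y"
  proof (rule field_le_epsilon)
    fix e :: real assume e: "e > 0"
    define a where "a = F x + e / 2"
    define b where "b = F y + e / 2"
    have ab: "a > 0" "b > 0" using F_nonneg[of x] F_nonneg[of y] e by (auto simp: a_def b_def)
    have "x /\<^sub>R a \<in> B" "y /\<^sub>R b \<in> B" using F_le_iff[OF ab(1), of x] F_le_iff[OF ab(2), of y] e by (auto simp: a_def b_def)
    then have "(a / (a + b)) *\<^sub>R (x /\<^sub>R a) + (b / (a + b)) *\<^sub>R (y /\<^sub>R b) \<in> B"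
      using ab by (intro convexD[OF convex_B]) (auto simp: add_divide_distrib[symmetric])
    moreover have "(a / (a + b)) *\<^sub>R (x /\<^sub>R a) = x /\<^sub>R (a + b)" "(b / (a + b)) *\<^sub>R (y /\<^sub>R b) = y /\<^sub>R (a + b)"
      using ab by (simp_all add: field_simps)
    ultimately have "(x + y) /\<^sub>R (a + b) \<in> B" by (simp only: scaleR_add_right)
    then have "F (x + y) \<le> a + b" using F_le_iff[of "a + b"] ab by simp
    then show "F (x + y) \<le> F x + F y + e" by (simp add: a_def b_def)
  qed
qed

lemma mem_iff: "x \<in> B \<longleftrightarrow> F x \<le> 1"
  using F_le_iff[of 1 x] by simp

lemma less_1_interior: assumes "F x < 1" shows "x \<in> interior B"
proof (rule interiorI)
  show "open {x. F x < 1}" by (intro open_Collect_less continuous_on_gauge continuous_on_const)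
  show "x \<in> {x. F x < 1}" using assms by simp
  show "{x. F x < 1} \<subseteq> B"
  proof
    fix y assume "y \<in> {x. F x < 1}"
    then show "y \<in> B" using mem_iff[of y] by simp
  qed
qed

lemma frontier_iff: "x \<in> frontier B \<longleftrightarrow> F x = 1"
proof
  have cl: "closure B = B" by (rule closure_closed[OF compact_imp_closed[OF compact_B]])
  show "F x = 1" if "x \<in> frontier B"
  proof -
    have "x \<in> B" "x \<notin> interior B" using that by (auto simp: frontier_def cl)
    then show ?thesis using less_1_interior[of x] mem_iff[of x] by fastforce
  qed
  assume x: "F x = 1"
  then have x0: "x \<noteq> 0" by auto
  have "x \<notin> interior B"
  proof
    assume "x \<in> interior B"
    then obtain e where e: "e > 0" "ball x e \<subseteq> B" by (auto simp: mem_interior)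
    define s where "s = e / (2 * norm x)"
    have s: "s > 0" using e x0 by (simp add: s_def)
    have "x + s *\<^sub>R x \<in> ball x e" using e x0 by (simp add: dist_norm s_def)
    then have "F ((1 + s) *\<^sub>R x) \<le> 1" using e mem_iff by (auto simp: algebra_simps)
    then show False using s x by (simp add: scale)
  qed
  then show "x \<in> frontier B" using x mem_iff[of x] by (simp add: frontier_def cl)
qed

lemma interior_iff: "x \<in> interior B \<longleftrightarrow> F x < 1"
proof
  assume "x \<in> interior B"
  then have "x \<in> B" "x \<notin> frontier B" using interior_subset by (auto simp: frontier_def)
  then show "F x < 1" using mem_iff frontier_iff by fastforce
qed (rule less_1_interior)

text \<open>Moving from \<open>p\<close> towards \<open>0\<close>, in any direction close to \<open>-p\<close>, leads into the interior. If \<open>-p\<close>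
  were tangent to the zero set of \<open>g\<close>, some such direction would stay in it.\<close>

lemma defining_function_transversal:
  assumes p: "p \<in> frontier B" and U: "open U" "p \<in> U" and g: "continuous_on U g" "(g has_derivative g') (at p)"
    and nz: "g' \<noteq> (\<lambda>_. 0)" and eq: "frontier B \<inter> U = {x \<in> U. g x = (0::real)}"
  shows "g' p \<noteq> 0"
proof
  assume g'p: "g' p = 0"
  interpret g': linear g' using g(2) has_derivative_linear by blast
  have gp: "g p = 0" using p U eq by blast
  have Fp: "F p = 1" using p frontier_iff by simp
  obtain w where w: "g' w \<noteq> 0" using nz by auto
  define n where "n = sgn (g' w) *\<^sub>R w"
  have n: "g' n > 0" using w by (simp add: n_def g'.scaleR sgn_if)
  obtain C where C: "C > 0" "\<And>x. F x \<le> C * norm x" using bounds by blast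
  \<comment> \<open>This makes \<open>F (s *\<^sub>R n)\<close> at most 1/2 for
    \<open>\<bar>s\<bar> \<le> \<epsilon>\<close>, so that the whole fan of directions
    \<open>- p + s n\<close> points into the interior.\<close>
  define \<epsilon> where "\<epsilon> = 1 / (2 * C * (norm n + 1))"
  have eps: "\<epsilon> > 0" using C by (simp add: \<epsilon>_def add_nonneg_pos)
  have n1: "norm n + 1 > 0" using norm_ge_zero[of n] by linarith
  have cone: "F (p + t *\<^sub>R (- p + s *\<^sub>R n)) < 1" if t: "0 < t" "t \<le> 1" and s: "\<bar>s\<bar> \<le> \<epsilon>" for t s
  proof -
    have "p + t *\<^sub>R (- p + s *\<^sub>R n) = (1 - t) *\<^sub>R p + t *\<^sub>R (s *\<^sub>R n)" by (simp add: algebra_simps)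
    then have "F (p + t *\<^sub>R (- p + s *\<^sub>R n)) \<le> F ((1 - t) *\<^sub>R p) + F (t *\<^sub>R (s *\<^sub>R n))"
      using subadd by metis
    also have "\<dots> = (1 - t) + t * F (s *\<^sub>R n)" using t Fp by (simp add: scale del: scaleR_scaleR)
    also have "F (s *\<^sub>R n) \<le> C * (\<epsilon> * (norm n + 1))"
    proof -
      have "\<bar>s\<bar> * norm n \<le> \<epsilon> * (norm n + 1)" using s eps by (intro mult_mono) auto
      then have "C * norm (s *\<^sub>R n) \<le> C * (\<epsilon> * (norm n + 1))" using C(1) by (intro mult_left_mono) auto
      then show ?thesis using C(2)[of "s *\<^sub>R n"] by linarith
    qed
    also have "C * (\<epsilon> * (norm n + 1)) = 1 / 2" using C(1) n1 by (simp add: \<epsilon>_def)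
    finally show ?thesis using t by simp
  qed
  define t where "t = (\<lambda>k. inverse (real (Suc k)))"
  have t: "t \<longlonglongrightarrow> 0" "\<And>k. 0 < t k" "\<And>k. t k \<le> 1"
    using LIMSEQ_inverse_real_of_nat by (auto simp: t_def inverse_le_1_iff)
  have q: "(\<lambda>k. (g (p + t k *\<^sub>R y) - g p) / t k) \<longlonglongrightarrow> g' y" for y
    by (rule has_derivative_sequentially[OF g(2) t(1)]) (use t(2) in \<open>auto simp: less_imp_neq[THEN not_sym]\<close>)
  have "g' (- p + \<epsilon> *\<^sub>R n) > 0" "g' (- p + (- \<epsilon>) *\<^sub>R n) < 0"
    using n eps g'p by (simp_all add: g'.add g'.neg g'.scaleR g'.diff)
  then have ev: "\<forall>\<^sub>F k in sequentially. (g (p + t k *\<^sub>R (- p + \<epsilon> *\<^sub>R n)) - g p) / t k > 0"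
    "\<forall>\<^sub>F k in sequentially. (g (p + t k *\<^sub>R (- p + (- \<epsilon>) *\<^sub>R n)) - g p) / t k < 0"
    using order_tendstoD[OF q] by blast+
  obtain r where r: "r > 0" "ball p r \<subseteq> U" using U openE by blast
  define K where "K = norm p + \<epsilon> * norm n + 1"
  have K: "K > 0" using eps by (simp add: K_def add_nonneg_pos)
  have "\<forall>\<^sub>F k in sequentially. t k < r / K" using order_tendstoD(2)[OF t(1)] r K by simp
  with ev have "\<forall>\<^sub>F k in sequentially. (g (p + t k *\<^sub>R (- p + \<epsilon> *\<^sub>R n)) - g p) / t k > 0 \<and>
     (g (p + t k *\<^sub>R (- p + (- \<epsilon>) *\<^sub>R n)) - g p) / t k < 0 \<and> t k < r / K"
    by eventually_elim simp
  then obtain k where k: "(g (p + t k *\<^sub>R (- p + \<epsilon> *\<^sub>R n)) - g p) / t k > 0"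
     "(g (p + t k *\<^sub>R (- p + (- \<epsilon>) *\<^sub>R n)) - g p) / t k < 0" "t k < r / K"
    by (auto simp: eventually_sequentially)
  have inU: "p + t k *\<^sub>R (- p + s *\<^sub>R n) \<in> U" if s: "\<bar>s\<bar> \<le> \<epsilon>" for s
  proof -
    have "norm (- p + s *\<^sub>R n) \<le> norm p + \<bar>s\<bar> * norm n" using norm_triangle_ineq[of "- p" "s *\<^sub>R n"] by simp
    also have "\<dots> \<le> K" using mult_right_mono[OF s, of "norm n"] by (simp add: K_def)
    finally have "t k * norm (- p + s *\<^sub>R n) \<le> t k * K" using t(2)[of k] by simp
    also have "\<dots> < r" using k(3) K by (simp add: field_simps)
    finally have "p + t k *\<^sub>R (- p + s *\<^sub>R n) \<in> ball p r" using t(2)[of k] by (simp add: dist_norm)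
    then show ?thesis using r by blast
  qed
  \<comment> \<open>Since \<open>g' p = 0\<close>, the term \<open>g' n\<close> decides the signs of
    \<open>g\<close> at the two ends of the fan, and they are opposite. A zero in between lies on
    the frontier, although the fan lies in the interior.\<close>
  have "\<exists>s. - \<epsilon> \<le> s \<and> s \<le> \<epsilon> \<and> g (p + t k *\<^sub>R (- p + s *\<^sub>R n)) = 0"
  proof (rule IVT')
    show "g (p + t k *\<^sub>R (- p + (- \<epsilon>) *\<^sub>R n)) \<le> 0" "0 \<le> g (p + t k *\<^sub>R (- p + \<epsilon> *\<^sub>R n))"
      using k(1,2) t(2)[of k] gp by (simp_all add: divide_less_0_iff zero_less_divide_iff)
    show "continuous_on {- \<epsilon>..\<epsilon>} (\<lambda>s. g (p + t k *\<^sub>R (- p + s *\<^sub>R n)))"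
      by (intro continuous_on_compose2[OF g(1)] continuous_intros) (use inU in auto)
  qed (use eps in auto)
  then obtain s where "- \<epsilon> \<le> s" "s \<le> \<epsilon>" and s0: "g (p + t k *\<^sub>R (- p + s *\<^sub>R n)) = 0" by blast
  then have s: "\<bar>s\<bar> \<le> \<epsilon>" "g (p + t k *\<^sub>R (- p + s *\<^sub>R n)) = 0" by auto
  then have "p + t k *\<^sub>R (- p + s *\<^sub>R n) \<in> frontier B" using eq inU[OF s(1)] by blast
  then show False using cone[OF t(2,3)[of k] s(1)] frontier_iff by simp
qed

text \<open>Implicit differentiation of \<open>g (y / F y) = 0\<close>. For \<open>s = F y\<close>,
  \<open>u = y - p\<close> and \<open>h = y / s - p\<close> one has
  \<open>s h = (1 - s) p + u\<close>, and \<open>g' h\<close> is of smaller order than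
  \<open>u\<close>; solving for \<open>s - 1\<close> gives the formula.\<close>

lemma has_derivative_defining_function:
  assumes p: "p \<in> frontier B" and U: "open U" "p \<in> U" and g: "(g has_derivative g') (at p)"
    and nz: "g' p \<noteq> 0" and eq: "frontier B \<inter> U = {x \<in> U. g x = (0::real)}"
  shows "(F has_derivative (\<lambda>u. g' u / g' p)) (at p)"
  unfolding has_derivative_at_alt
proof (intro conjI allI impI)
  have lin: "bounded_linear g'" using g has_derivative_bounded_linear by blast
  interpret g': linear g' using g has_derivative_linear by blast
  show "bounded_linear (\<lambda>u. g' u / g' p)" using lin by (rule bounded_linear_compose[OF bounded_linear_divide])
  fix e :: real assume e: "e > 0"
  have gp: "g p = 0" using p U eq by blast
  have Fp: "F p = 1" using p frontier_iff by simp
  obtain C where C: "C > 0" "\<And>x. F x \<le> C * norm x" using bounds by blast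
  define K where "K = C * norm p + 1"
  have K: "K > 0" using C by (simp add: K_def add_nonneg_pos)
  define \<eta> where "\<eta> = e * \<bar>g' p\<bar> / K"
  have eta: "\<eta> > 0" using e nz K by (simp add: \<eta>_def)
  obtain \<delta> where \<delta>: "\<delta> > 0" "\<And>y. norm (y - p) < \<delta> \<Longrightarrow> norm (g y - g p - g' (y - p)) \<le> \<eta> * norm (y - p)"
    using g eta unfolding has_derivative_at_alt by blast
  obtain r where r: "r > 0" "ball p r \<subseteq> U" using U openE by blast
  \<comment> \<open>The first bound forces \<open>s \<ge> 1 / 2\<close>. With it, the second bound
    keeps \<open>norm h\<close> below both \<open>\<delta>\<close> and \<open>r\<close>.\<close>
  define d where "d = min (1 / (2 * C)) (min \<delta> r / (2 * K))"
  have d: "d > 0" using C \<delta> r K by (simp add: d_def)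
  have "norm (F y - F p - g' (y - p) / g' p) \<le> e * norm (y - p)" if y: "norm (y - p) < d" for y
  proof -
    define u where "u = y - p"
    define s where "s = F y"
    have lip: "\<bar>s - 1\<bar> \<le> C * norm u"
      using subadd[of p u] subadd[of y "- u"] C(2)[of u] C(2)[of "- u"] Fp norm_minus_commute[of p y]
      by (simp add: s_def u_def)
    have "C * norm u \<le> C * (1 / (2 * C))" using y C(1) by (intro mult_left_mono) (auto simp: d_def u_def)
    then have "C * norm u \<le> 1 / 2" using C(1) by simp
    then have s: "s \<ge> 1 / 2" using lip by linarith
    define h where "h = y /\<^sub>R s - p"
    have sh: "s *\<^sub>R h = (1 - s) *\<^sub>R p + u" using s by (simp add: h_def u_def algebra_simps)
    have "s * norm h = norm (s *\<^sub>R h)" using s by simp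
    also have "\<dots> \<le> \<bar>1 - s\<bar> * norm p + norm u" unfolding sh using norm_triangle_ineq[of "(1 - s) *\<^sub>R p" u] by simp
    also have "\<dots> \<le> C * norm u * norm p + norm u" using lip by (intro add_mono mult_right_mono) auto
    finally have snh: "s * norm h \<le> K * norm u" by (simp add: K_def algebra_simps)
    have "1 / 2 * norm h \<le> s * norm h" using s by (intro mult_right_mono) auto
    also note snh
    also have "K * norm u < K * (min \<delta> r / (2 * K))"
      using y K by (intro mult_strict_left_mono) (auto simp: d_def u_def)
    also have "\<dots> = min \<delta> r / 2" using K by simp
    finally have nh: "norm h < \<delta>" "norm h < r" by auto
    have "p + h \<in> ball p r" using nh by (simp add: dist_norm)
    then have "p + h \<in> U" using r by blast
    moreover have "F (p + h) = 1" 
    proof -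
      have "F (y /\<^sub>R s) = inverse s * s" using s scale[of "inverse s" y] by (simp add: s_def)
      also have "\<dots> = 1" using s by (intro left_inverse) auto
      finally show ?thesis by (simp add: h_def)
    qed
    ultimately have "g (p + h) = 0" using eq frontier_iff by blast
    then have "\<bar>g' h\<bar> \<le> \<eta> * norm h" using \<delta>(2)[of "p + h"] nh gp by simp
    then have "s * \<bar>g' h\<bar> \<le> s * (\<eta> * norm h)" using s by (intro mult_left_mono) auto
    also have "\<dots> \<le> \<eta> * (K * norm u)" using mult_left_mono[OF snh, of \<eta>] eta by (simp add: mult_ac)
    also have "\<dots> = e * \<bar>g' p\<bar> * norm u" using K by (simp add: \<eta>_def)
    finally have *: "\<bar>g' (s *\<^sub>R h)\<bar> \<le> e * \<bar>g' p\<bar> * norm u" using s by (simp add: g'.scaleR abs_mult)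
    have "F y - F p - g' (y - p) / g' p = - g' (s *\<^sub>R h) / g' p"
    proof -
      have "g' (s *\<^sub>R h) = (1 - s) * g' p + g' u" unfolding sh g'.add g'.scaleR by simp
      then show ?thesis using nz by (simp only: Fp flip: s_def u_def) (simp add: field_simps)
    qed
    then have "norm (F y - F p - g' (y - p) / g' p) = \<bar>g' (s *\<^sub>R h)\<bar> / \<bar>g' p\<bar>" by simp
    also have "\<dots> \<le> e * norm u" using * nz by (simp add: field_simps)
    finally show ?thesis by (simp add: u_def)
  qed
  then show "\<exists>d>0. \<forall>y. norm (y - p) < d \<longrightarrow> norm (F y - F p - g' (y - p) / g' p) \<le> e * norm (y - p)"
    using d by blast
qed

end

section \<open>Smooth convex bodies\<close>

locale smooth_body = pointed_body +
  assumes smooth: "smooth_hypersurface (frontier B)"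
begin

lemma local_defining_function:
  assumes "p \<in> frontier B"
  shows "\<exists>U (g :: 'a \<Rightarrow> real). open U \<and> p \<in> U \<and> smooth_on U g \<and>
    (\<forall>x\<in>frontier B \<inter> U. frechet_derivative g (at x) x \<noteq> 0 \<and>
      (F has_derivative (\<lambda>u. frechet_derivative g (at x) u / frechet_derivative g (at x) x)) (at x))"
proof -
  obtain U and g :: "'a \<Rightarrow> real" where U: "open U" "p \<in> U" "smooth_on U g"
    "\<forall>x\<in>U. frechet_derivative g (at x) \<noteq> (\<lambda>_. 0)" "frontier B \<inter> U = {x \<in> U. g x = 0}"
    using smooth assms unfolding smooth_hypersurface_def by blast
  have C1: "C_diff_on (Suc 0) U g" and C0: "C_diff_on 0 U g" using U(3) unfolding smooth_on_def by blast+
  have g: "continuous_on U g" using C0 by simp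
  have "frechet_derivative g (at x) x \<noteq> 0 \<and>
      (F has_derivative (\<lambda>u. frechet_derivative g (at x) u / frechet_derivative g (at x) x)) (at x)"
    if x: "x \<in> frontier B" "x \<in> U" for x
  proof -
    have dg: "(g has_derivative frechet_derivative g (at x)) (at x)" by (rule C_diff_on_SucE(1)[OF C1 x(2)])
    have nz: "frechet_derivative g (at x) x \<noteq> 0"
      using U(4) x(2) by (intro defining_function_transversal[OF x(1) U(1) x(2) g dg _ U(5)]) blast
    show ?thesis using nz has_derivative_defining_function[OF x(1) U(1) x(2) dg nz U(5)] by blast
  qed
  then show ?thesis using U(1,2,3) by blast
qed

sublocale smooth_gauge F
proof
  fix x :: 'a assume x: "x \<noteq> 0"
  define p where "p = x /\<^sub>R F x"
  have Fx: "F x > 0" using pos[OF x] .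
  have p: "p \<in> frontier B" using Fx x by (simp add: frontier_iff p_def scale)
  obtain L where L: "(F has_derivative L) (at p)"
    using local_defining_function[OF p] p by blast
  have "((\<lambda>y. F (y /\<^sub>R F x)) has_derivative (\<lambda>h. L (h /\<^sub>R F x))) (at x)"
    by (rule has_derivative_compose[of "\<lambda>y. y /\<^sub>R F x"])
       (use L in \<open>auto intro!: derivative_eq_intros simp: p_def\<close>)
  then have "((\<lambda>y. F x * F (y /\<^sub>R F x)) has_derivative (\<lambda>h. F x * L (h /\<^sub>R F x))) (at x)"
    by (rule has_derivative_mult_right)
  moreover have "(\<lambda>y. F x * F (y /\<^sub>R F x)) = F" using Fx x by (simp add: scale fun_eq_iff)
  ultimately show "F differentiable (at x)" by (auto simp: differentiable_def)
qed

section \<open>Tangent spaces and inner normals of the boundary\<close>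

lemma frontier_nonzero: "p \<in> frontier B \<Longrightarrow> p \<noteq> 0"
  using frontier_iff by fastforce

text \<open>The line \<open>p + t v\<close> is projected radially to the frontier. Smoothness of the
  projected curve is bootstrapped: \<open>\<gamma>\<close> is as regular as the factor
  \<open>\<phi>\<close>, and the derivative of \<open>\<phi>\<close> is a smooth expression in
  \<open>\<gamma>\<close>, so each order of regularity gives the next.\<close>

lemma radial_projection_curve:
  assumes p: "p \<in> frontier B" and v: "D p v = 0"
  shows "v \<in> tangent_space (frontier B) p"
proof -
  have p0: "p \<noteq> 0" and Fp: "F p = 1" using p frontier_nonzero frontier_iff by auto
  obtain U and g :: "'a \<Rightarrow> real" where U: "open U" "p \<in> U" "smooth_on U g"
    and loc: "\<forall>x\<in>frontier B \<inter> U. frechet_derivative g (at x) x \<noteq> 0 \<and>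
      (F has_derivative (\<lambda>u. frechet_derivative g (at x) u / frechet_derivative g (at x) x)) (at x)"
    using local_defining_function[OF p] by blast
  have nz: "frechet_derivative g (at x) x \<noteq> 0" if "x \<in> frontier B" "x \<in> U" for x
    using loc that by blast
  have der: "(F has_derivative (\<lambda>u. frechet_derivative g (at x) u / frechet_derivative g (at x) x)) (at x)"
    if "x \<in> frontier B" "x \<in> U" for x
    using loc that by blast
  define \<phi> where "\<phi> t = F (p + t *\<^sub>R v)" for t
  define \<gamma> where "\<gamma> t = (p + t *\<^sub>R v) /\<^sub>R \<phi> t" for t
  define T where "T = {t. p + t *\<^sub>R v \<noteq> 0}"
  have T: "open T" unfolding T_def by (intro open_Collect_neq continuous_intros)
  have \<phi>cont: "continuous_on S \<phi>" for S
    unfolding \<phi>_def by (intro continuous_on_compose2[OF continuous_on_gauge[of UNIV]] continuous_intros) auto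
  have "continuous_on T \<gamma>"
    unfolding \<gamma>_def by (intro continuous_intros \<phi>cont) (auto simp: T_def \<phi>_def)
  then have "open (T \<inter> \<gamma> -` U)" by (rule continuous_open_preimage[OF _ T U(1)])
  moreover have "0 \<in> T \<inter> \<gamma> -` U" using p0 U(2) by (simp add: T_def \<gamma>_def \<phi>_def Fp)
  ultimately obtain e where e: "e > 0" "ball 0 e \<subseteq> T \<inter> \<gamma> -` U" using openE by blast
  define I where "I = {-e<..<e}"
  have I: "open I" "0 \<in> I" "I \<subseteq> T \<inter> \<gamma> -` U" using e by (auto simp: I_def dist_norm subset_iff)
  have \<phi>pos: "\<phi> t > 0" if "t \<in> I" for t using I that by (auto simp: \<phi>_def T_def intro!: pos)
  have \<gamma>fr: "\<gamma> t \<in> frontier B" if "t \<in> I" for t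
  proof -
    have "F (\<gamma> t) = inverse (\<phi> t) * \<phi> t" using \<phi>pos[OF that] by (simp add: \<gamma>_def scale \<phi>_def)
    then show ?thesis using \<phi>pos[OF that] by (simp add: frontier_iff)
  qed
  have \<gamma>U: "\<gamma> t \<in> U" if "t \<in> I" for t using I that by auto
  have D\<phi>: "(\<phi> has_derivative (\<lambda>s. s * D (\<gamma> t) v)) (at t)" if t: "t \<in> I" for t
  proof -
    have nz: "p + t *\<^sub>R v \<noteq> 0" using I t by (auto simp: T_def)
    have "D (\<gamma> t) = D (p + t *\<^sub>R v)"
      unfolding \<gamma>_def using \<phi>pos[OF t] by (intro D_scale[OF nz]) auto
    moreover have "(\<phi> has_derivative (\<lambda>s. D (p + t *\<^sub>R v) (s *\<^sub>R v))) (at t)"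
      unfolding \<phi>_def
      by (rule has_derivative_compose[of "\<lambda>t. p + t *\<^sub>R v"])
         (use has_derivative[OF nz] in \<open>auto intro!: derivative_eq_intros\<close>)
    ultimately show ?thesis using linear_scale[OF linear_D[OF nz]] by simp
  qed
  \<comment> \<open>The denominator is the derivative of \<open>g\<close> at
    \<open>\<gamma> t\<close> in the moving direction \<open>\<gamma> t\<close>, expanded in the
    basis because \<open>C_diff_on\<close> controls fixed directions.\<close>
  have D\<gamma>: "D (\<gamma> t) v = frechet_derivative g (at (\<gamma> t)) v * inverse (\<Sum>i\<in>Basis. (\<gamma> t \<bullet> i) * frechet_derivative g (at (\<gamma> t)) i)"
    if t: "t \<in> I" for t
  proof -
    have "C_diff_on (Suc 0) U g" using U(3) unfolding smooth_on_def by blast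
    then have "(g has_derivative frechet_derivative g (at (\<gamma> t))) (at (\<gamma> t))"
      using C_diff_on_SucE(1) \<gamma>U[OF t] by blast
    then interpret L: linear "frechet_derivative g (at (\<gamma> t))" by (rule has_derivative_linear)
    have "frechet_derivative g (at (\<gamma> t)) (\<gamma> t)
        = frechet_derivative g (at (\<gamma> t)) (\<Sum>i\<in>Basis. (\<gamma> t \<bullet> i) *\<^sub>R i)" by (simp only: euclidean_representation)
    also have "\<dots> = (\<Sum>i\<in>Basis. (\<gamma> t \<bullet> i) * frechet_derivative g (at (\<gamma> t)) i)"
      by (simp add: L.sum L.scaleR)
    finally show ?thesis
      using D_unique[OF der[OF \<gamma>fr[OF t] \<gamma>U[OF t]]] by (simp add: divide_inverse)
  qed
  have lin: "C_diff_on k I (\<lambda>t. p + t *\<^sub>R v)" for k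
    by (intro C_diff_on_add C_diff_on_scaleR C_diff_on_const C_diff_on_ident I)
  have \<gamma>C: "C_diff_on k I \<gamma>" if "C_diff_on k I \<phi>" for k
    unfolding \<gamma>_def by (intro C_diff_on_scaleR C_diff_on_inverse lin I that) (use \<phi>pos in force)
  have "C_diff_on k I \<phi>" for k
  proof (induction k)
    case 0
    then show ?case by (simp add: \<phi>cont)
  next
    case (Suc k)
    have Dg: "C_diff_on k I (\<lambda>t. frechet_derivative g (at (\<gamma> t)) w)" for w
    proof (rule C_diff_on_compose[OF I(1) _ _ \<gamma>C[OF Suc], where U = U and g = "\<lambda>x. frechet_derivative g (at x) w"])
      have "C_diff_on (Suc k) U g" using U(3) unfolding smooth_on_def by blast
      then show "C_diff_on k U (\<lambda>x. frechet_derivative g (at x) w)" by (rule C_diff_on_SucE(2))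
    qed (use \<gamma>U in auto)
    have nzs: "(\<Sum>i\<in>Basis. (\<gamma> t \<bullet> i) *\<^sub>R frechet_derivative g (at (\<gamma> t)) i) \<noteq> 0" if "t \<in> I" for t
    proof
      assume z: "(\<Sum>i\<in>Basis. (\<gamma> t \<bullet> i) *\<^sub>R frechet_derivative g (at (\<gamma> t)) i) = 0"
      have "C_diff_on (Suc 0) U g" using U(3) unfolding smooth_on_def by blast
      then have "(g has_derivative frechet_derivative g (at (\<gamma> t))) (at (\<gamma> t))"
        using C_diff_on_SucE(1) \<gamma>U[OF that] by blast
      then interpret L: linear "frechet_derivative g (at (\<gamma> t))" by (rule has_derivative_linear)
      have "frechet_derivative g (at (\<gamma> t)) (\<Sum>i\<in>Basis. (\<gamma> t \<bullet> i) *\<^sub>R i) = 0"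
        using z by (simp add: L.sum L.scaleR)
      then show False using nz[OF \<gamma>fr[OF that] \<gamma>U[OF that]] by (simp add: euclidean_representation)
    qed
    have CD: "C_diff_on k I (\<lambda>t. s *\<^sub>R frechet_derivative g (at (\<gamma> t)) v *\<^sub>R
        inverse (\<Sum>i\<in>Basis. (\<gamma> t \<bullet> i) *\<^sub>R frechet_derivative g (at (\<gamma> t)) i))" for s :: real
      by (intro C_diff_on_scaleR C_diff_on_const C_diff_on_inverse C_diff_on_sum Dg I nzs
          C_diff_on_bounded_linear[OF bounded_linear_inner_left I(1) \<gamma>C[OF Suc]])
    have CD': "C_diff_on k I (\<lambda>t. s * D (\<gamma> t) v)" for s
      by (rule C_diff_on_cong[OF I(1) _ CD[of s]]) (simp add: D\<gamma>)
    show ?case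
      by (rule C_diff_on_SucI[OF I(1), where f' = "\<lambda>t s. s * D (\<gamma> t) v"]) (use D\<phi> CD' in auto)
  qed
  then have sm: "smooth_on I \<gamma>" unfolding smooth_on_def using \<gamma>C by blast
  \<comment> \<open>\<open>D p v = 0\<close> makes the factor \<open>\<phi>\<close> stationary at
    \<open>0\<close>, so the projection keeps the velocity \<open>v\<close>.\<close>
  have "(\<gamma> has_vector_derivative v) (at 0)"
  proof -
    have g0: "\<gamma> 0 = p" by (simp add: \<gamma>_def \<phi>_def Fp)
    then have "(\<phi> has_real_derivative 0) (at 0)" using D\<phi>[OF I(2)] v by (simp add: has_field_derivative_def lambda_zero)
    then have "((\<lambda>t. inverse (\<phi> t)) has_real_derivative 0) (at 0)"
      using DERIV_inverse'[of \<phi> 0 0 UNIV] by (simp add: \<phi>_def Fp)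
    then have "((\<lambda>t. inverse (\<phi> t) *\<^sub>R (p + t *\<^sub>R v)) has_vector_derivative
        (inverse (\<phi> 0) *\<^sub>R v + 0 *\<^sub>R (p + 0 *\<^sub>R v))) (at 0)"
      by (rule has_vector_derivative_scaleR) (auto intro!: derivative_eq_intros)
    then show ?thesis by (simp add: \<gamma>_def[abs_def] \<phi>_def Fp)
  qed
  moreover have "\<gamma> 0 = p" by (simp add: \<gamma>_def \<phi>_def Fp)
  moreover have "\<gamma> ` I \<subseteq> frontier B" using \<gamma>fr by blast
  ultimately show ?thesis
    unfolding tangent_space_def using sm e(1) unfolding I_def by blast
qed

lemma tangent_space_frontier:
  assumes p: "p \<in> frontier B"
  shows "tangent_space (frontier B) p = {v. D p v = 0}"
proof (intro equalityI subsetI)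
  fix v assume "v \<in> tangent_space (frontier B) p"
  then obtain c e where c: "e > 0" "c ` {-e<..<e} \<subseteq> frontier B" "c 0 = p" "(c has_vector_derivative v) (at 0)"
    unfolding tangent_space_def by blast
  have p0: "p \<noteq> 0" using p frontier_nonzero by blast
  have "((\<lambda>t. F (c t)) has_derivative (\<lambda>t. D p (t *\<^sub>R v))) (at 0)"
    using has_derivative_compose[OF c(4)[unfolded has_vector_derivative_def]] has_derivative[OF p0] c(3) by simp
  moreover have "((\<lambda>t. F (c t)) has_derivative (\<lambda>t. 0)) (at 0)"
  proof (rule has_derivative_transform_within_open)
    show "((\<lambda>t. 1 :: real) has_derivative (\<lambda>t. 0)) (at 0)" by simp
    show "open {-e<..<e}" "0 \<in> {-e<..<e}" using c by auto
    show "1 = F (c t)" if "t \<in> {-e<..<e}" for t using that c frontier_iff by force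
  qed
  ultimately have "(\<lambda>t. D p (t *\<^sub>R v)) = (\<lambda>t. 0)" by (rule has_derivative_unique)
  then have "D p (1 *\<^sub>R v) = 0" by metis
  then show "v \<in> {v. D p v = 0}" by simp
qed (use radial_projection_curve[OF p] in auto)

definition grad :: "'a \<Rightarrow> 'a" where "grad p = (\<Sum>i\<in>Basis. D p i *\<^sub>R i)"

lemma grad_inner: assumes "p \<noteq> 0" shows "grad p \<bullet> u = D p u"
proof -
  interpret Dp: linear "D p" by (rule linear_D[OF assms])
  have "D p u = D p (\<Sum>i\<in>Basis. (u \<bullet> i) *\<^sub>R i)" by (simp only: euclidean_representation)
  also have "\<dots> = (\<Sum>i\<in>Basis. (u \<bullet> i) * D p i)" by (simp add: Dp.sum Dp.scaleR)
  also have "\<dots> = grad p \<bullet> u"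
    unfolding grad_def inner_sum_left by (intro sum.cong) (auto simp: inner_commute)
  finally show ?thesis ..
qed

lemma grad_nonzero: assumes "p \<noteq> 0" shows "grad p \<noteq> 0"
  using grad_inner[OF assms, of p] D_self[OF assms] assms by auto

text \<open>The tangent space is the orthogonal complement of \<open>grad p\<close>, so a unit
  normal is a multiple of \<open>grad p\<close>. The sign follows from \<open>D p \<le> F\<close>
  and \<open>D p p = 1\<close>: directions into the interior have negative
  \<open>D p\<close>.\<close>

lemma inner_normal_eq:
  assumes p: "p \<in> frontier B"
  shows "inner_normal B p = - grad p /\<^sub>R norm (grad p)"
proof -
  have p0: "p \<noteq> 0" and Fp: "F p = 1" using p frontier_nonzero frontier_iff by auto
  let ?G = "grad p"
  have G: "?G \<noteq> 0" by (rule grad_nonzero[OF p0])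
  interpret Dp: linear "D p" by (rule linear_D[OF p0])
  let ?P = "\<lambda>\<nu>. norm \<nu> = 1 \<and> (\<forall>v\<in>tangent_space (frontier B) p. v \<bullet> \<nu> = 0) \<and>
             (\<exists>e>0. \<forall>t\<in>{0<..<e}. p + t *\<^sub>R \<nu> \<in> interior B)"
  have "?P (- ?G /\<^sub>R norm ?G)"
  proof (intro conjI ballI)
    show "norm (- ?G /\<^sub>R norm ?G) = 1" using G by simp
    show "v \<bullet> (- ?G /\<^sub>R norm ?G) = 0" if "v \<in> tangent_space (frontier B) p" for v
      using that grad_inner[OF p0, of v] by (simp add: tangent_space_frontier[OF p] inner_commute)
    let ?\<nu> = "- ?G /\<^sub>R norm ?G"
    have "D p ?\<nu> = - norm ?G"
      unfolding grad_inner[OF p0, symmetric] using G by (simp add: power2_norm_eq_inner[symmetric] power2_eq_square)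
    moreover have "((\<lambda>t. F (p + t *\<^sub>R ?\<nu>)) has_derivative (\<lambda>t. D p (t *\<^sub>R ?\<nu>))) (at 0)"
      by (rule has_derivative_compose[of "\<lambda>t. p + t *\<^sub>R ?\<nu>"])
         (use has_derivative[OF p0] in \<open>auto intro!: derivative_eq_intros\<close>)
    moreover have "(\<lambda>t. t *\<^sub>R (- norm ?G)) = (*) (- norm ?G)" by (auto simp: fun_eq_iff)
    ultimately have "((\<lambda>t. F (p + t *\<^sub>R ?\<nu>)) has_real_derivative - norm ?G) (at 0)"
      by (simp only: has_field_derivative_def Dp.scaleR)
    from DERIV_neg_dec_right[OF this] G obtain d where "d > 0"
      "\<And>h. h > 0 \<Longrightarrow> h < d \<Longrightarrow> F (p + 0 *\<^sub>R ?\<nu>) > F (p + (0 + h) *\<^sub>R ?\<nu>)" by auto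
    then show "\<exists>e>0. \<forall>t\<in>{0<..<e}. p + t *\<^sub>R ?\<nu> \<in> interior B"
      using Fp by (intro exI[of _ d]) (auto simp: interior_iff)
  qed
  moreover have "\<nu> = - ?G /\<^sub>R norm ?G" if \<nu>: "?P \<nu>" for \<nu>
  proof -
    define c where "c = (\<nu> \<bullet> ?G) / (?G \<bullet> ?G)"
    define w where "w = \<nu> - c *\<^sub>R ?G"
    have wG: "w \<bullet> ?G = 0" using G by (simp add: w_def c_def inner_diff_left)
    then have "w \<in> tangent_space (frontier B) p"
      using grad_inner[OF p0, of w] by (simp add: tangent_space_frontier[OF p] inner_commute)
    then have "w \<bullet> \<nu> = 0" using \<nu> by blast
    then have "w \<bullet> w = 0" using wG by (simp add: w_def inner_diff_right inner_diff_left inner_commute algebra_simps)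
    then have \<nu>c: "\<nu> = c *\<^sub>R ?G" by (simp add: w_def)
    obtain e where e: "e > 0" "\<And>t. t \<in> {0<..<e} \<Longrightarrow> p + t *\<^sub>R \<nu> \<in> interior B" using \<nu> by blast
    have "p + (e / 2) *\<^sub>R \<nu> \<in> interior B" using e by (intro e(2)) auto
    then have "D p (p + (e / 2) *\<^sub>R \<nu>) < 1"
      using D_le[OF p0, of "p + (e / 2) *\<^sub>R \<nu>"] by (simp add: interior_iff)
    then have "D p \<nu> < 0" using D_self[OF p0] Fp e(1) by (simp add: Dp.add Dp.scaleR mult_less_0_iff)
    then have "c * (?G \<bullet> ?G) < 0" unfolding grad_inner[OF p0, symmetric] \<nu>c by simp
    then have "c < 0" using inner_ge_zero[of ?G] by (simp add: mult_less_0_iff)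
    moreover have "\<bar>c\<bar> * norm ?G = 1" using \<nu> \<nu>c by simp
    ultimately have "c = - inverse (norm ?G)" using G by (simp add: field_simps)
    then show ?thesis using \<nu>c by simp
  qed
  ultimately show ?thesis unfolding inner_normal_def by (intro the_equality) blast+
qed

text \<open>Without this, the value of \<open>frechet_derivative\<close> in the second fundamental
  form would be arbitrary. As \<open>grad\<close> already consumes the one derivative of
  \<open>F\<close>, it is replaced near \<open>p\<close> by the expression \<open>G\<close> in
  derivatives of \<open>g\<close>, which agrees with it on the frontier.\<close>

lemma inner_normal_differentiable:
  assumes p: "p \<in> frontier B"
  shows "inner_normal B differentiable (at p within frontier B)"
proof -
  obtain U and g :: "'a \<Rightarrow> real" where U: "open U" "p \<in> U" "smooth_on U g"
    and loc: "\<forall>x\<in>frontier B \<inter> U. frechet_derivative g (at x) x \<noteq> 0 \<and>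
      (F has_derivative (\<lambda>u. frechet_derivative g (at x) u / frechet_derivative g (at x) x)) (at x)"
    using local_defining_function[OF p] by blast
  have nz: "frechet_derivative g (at x) x \<noteq> 0" if "x \<in> frontier B" "x \<in> U" for x
    using loc that by blast
  have der: "(F has_derivative (\<lambda>u. frechet_derivative g (at x) u / frechet_derivative g (at x) x)) (at x)"
    if "x \<in> frontier B" "x \<in> U" for x
    using loc that by blast
  have C2: "C_diff_on (Suc (Suc 0)) U g" using U(3) unfolding smooth_on_def by blast
  define d where "d i x = frechet_derivative g (at x) i" for i x
  have dd: "d i differentiable (at p)" for i
    using C2 U(2) by (simp add: d_def[abs_def])
  define S where "S x = (\<Sum>i\<in>Basis. (x \<bullet> i) * d i x)" for x
  have S: "frechet_derivative g (at x) x = S x" if "x \<in> U" for x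
  proof -
    have "(g has_derivative frechet_derivative g (at x)) (at x)" by (rule C_diff_on_SucE(1)[OF C2 that])
    then interpret L: linear "frechet_derivative g (at x)" by (rule has_derivative_linear)
    have "frechet_derivative g (at x) x = frechet_derivative g (at x) (\<Sum>i\<in>Basis. (x \<bullet> i) *\<^sub>R i)"
      by (simp only: euclidean_representation)
    also have "\<dots> = S x" by (simp add: L.sum L.scaleR S_def d_def)
    finally show ?thesis .
  qed
  define G where "G x = (\<Sum>i\<in>Basis. (d i x / S x) *\<^sub>R i)" for x
  have G: "grad x = G x" if "x \<in> frontier B" "x \<in> U" for x
    unfolding grad_def G_def D_unique[OF der[OF that]] d_def S[OF that(2)] ..
  have Sd: "S differentiable (at p)" unfolding S_def[abs_def]
    by (intro differentiable_sum ballI finite_Basis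
        differentiable_mult[OF bounded_linear_imp_differentiable[OF bounded_linear_inner_left] dd])
  have "S p \<noteq> 0" using nz[OF p U(2)] S[OF U(2)] by simp
  then have "(\<lambda>x. (d i x / S x) *\<^sub>R i) differentiable (at p)" for i
    by (rule differentiable_scaleR[OF differentiable_divide[OF dd Sd] differentiable_const])
  then have "G differentiable (at p)" unfolding G_def[abs_def]
    by (intro differentiable_sum ballI finite_Basis)
  moreover have "G p \<noteq> 0" using G[OF p U(2)] grad_nonzero frontier_nonzero p by metis
  ultimately have "(\<lambda>x. (- inverse (norm (G x))) *\<^sub>R G x) differentiable (at p)"
    by (intro differentiable_scaleR differentiable_minus differentiable_inverse
        differentiable_compose[of norm G]) (auto intro: differentiable_norm_at)
  then obtain L where "((\<lambda>x. (- inverse (norm (G x))) *\<^sub>R G x) has_derivative L) (at p)"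
    unfolding differentiable_def by blast
  then have L: "((\<lambda>x. (- inverse (norm (G x))) *\<^sub>R G x) has_derivative L) (at p within frontier B)"
    by (rule has_derivative_at_withinI)
  obtain r where r: "r > 0" "ball p r \<subseteq> U" using U openE by blast
  have "(inner_normal B has_derivative L) (at p within frontier B)"
  proof (rule has_derivative_transform_within[OF L r(1) p])
    fix x assume x: "x \<in> frontier B" "dist x p < r"
    then have "x \<in> U" using r by (auto simp: dist_commute)
    then show "(- inverse (norm (G x))) *\<^sub>R G x = inner_normal B x"
      using inner_normal_eq[OF x(1)] G[OF x(1)] by simp
  qed
  then show ?thesis unfolding differentiable_def by blast
qed

text \<open>A segment on which \<open>F\<close> is constant scales to one in the frontier. The
  supporting functional at any of its points also supports at \<open>p\<close>, so the normal is
  constant along the segment and the second fundamental form vanishes in its direction.\<close>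

lemma no_flat_segment:
  assumes pos_def: "\<And>p v. p \<in> frontier B \<Longrightarrow> v \<in> tangent_space (frontier B) p \<Longrightarrow> v \<noteq> 0 \<Longrightarrow>
     second_fundamental_form B p v v > 0"
  shows "\<nexists>x k e. x \<noteq> 0 \<and> k \<noteq> 0 \<and> e > 0 \<and> (\<forall>s. \<bar>s\<bar> < e \<longrightarrow> F (x + s *\<^sub>R k) = F x)"
proof
  assume "\<exists>x k e. x \<noteq> 0 \<and> k \<noteq> 0 \<and> e > 0 \<and> (\<forall>s. \<bar>s\<bar> < e \<longrightarrow> F (x + s *\<^sub>R k) = F x)"
  then obtain x k0 e where x: "x \<noteq> 0" and k0: "k0 \<noteq> 0" and e: "e > 0"
    and seg0: "\<And>s. \<bar>s\<bar> < e \<Longrightarrow> F (x + s *\<^sub>R k0) = F x" by blast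
  define p where "p = x /\<^sub>R F x"
  define k where "k = k0 /\<^sub>R F x"
  have Fx: "F x > 0" by (rule pos[OF x])
  have k: "k \<noteq> 0" using k0 x by (simp add: k_def)
  have seg: "F (p + s *\<^sub>R k) = 1" if "\<bar>s\<bar> < e" for s
  proof -
    have "p + s *\<^sub>R k = (x + s *\<^sub>R k0) /\<^sub>R F x" by (simp add: p_def k_def algebra_simps)
    then have "F (p + s *\<^sub>R k) = inverse (F x) * F x" using seg0[OF that] Fx by (simp add: scale)
    then show ?thesis using x by simp
  qed
  have fr: "p + s *\<^sub>R k \<in> frontier B" if "\<bar>s\<bar> < e" for s using seg[OF that] frontier_iff by blast
  have nz: "p + s *\<^sub>R k \<noteq> 0" if "\<bar>s\<bar> < e" for s using fr[OF that] frontier_nonzero by blast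
  have p: "p \<in> frontier B" and p0: "p \<noteq> 0" using fr[of 0] nz[of 0] e by auto
  define I where "I = {-e<..<e}"
  have I: "open I" "0 \<in> I" using e by (auto simp: I_def)
  have Dk: "D (p + s *\<^sub>R k) k = 0" if s: "\<bar>s\<bar> < e" for s
  proof -
    have "((\<lambda>t. F (p + t *\<^sub>R k)) has_derivative (\<lambda>t. D (p + s *\<^sub>R k) (t *\<^sub>R k))) (at s)"
      by (rule has_derivative_compose[of "\<lambda>t. p + t *\<^sub>R k"])
         (use has_derivative[OF nz[OF s]] in \<open>auto intro!: derivative_eq_intros\<close>)
    moreover have "((\<lambda>t. F (p + t *\<^sub>R k)) has_derivative (\<lambda>t. 0)) (at s)"
    proof (rule has_derivative_transform_within_open[OF _ I(1)])
      show "((\<lambda>t. 1 :: real) has_derivative (\<lambda>t. 0)) (at s)" by simp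
      show "s \<in> I" using s by (auto simp: I_def)
      show "1 = F (p + t *\<^sub>R k)" if "t \<in> I" for t using that seg[of t] by (auto simp: I_def abs_less_iff)
    qed
    ultimately have "(\<lambda>t. D (p + s *\<^sub>R k) (t *\<^sub>R k)) = (\<lambda>t. 0)" by (rule has_derivative_unique)
    then have "D (p + s *\<^sub>R k) (1 *\<^sub>R k) = 0" by metis
    then show ?thesis by simp
  qed
  have const: "inner_normal B (p + s *\<^sub>R k) = inner_normal B p" if s: "\<bar>s\<bar> < e" for s
  proof -
    interpret Ds: linear "D (p + s *\<^sub>R k)" by (rule linear_D[OF nz[OF s]])
    have "D p = D (p + s *\<^sub>R k)"
    proof (rule D_eqI[OF p0])
      show "linear (D (p + s *\<^sub>R k))" by (rule linear_D[OF nz[OF s]])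
      show "D (p + s *\<^sub>R k) y \<le> F y" for y by (rule D_le[OF nz[OF s]])
      have "D (p + s *\<^sub>R k) p = D (p + s *\<^sub>R k) (p + s *\<^sub>R k)" using Dk[OF s] by (simp add: Ds.add Ds.scaleR)
      then show "D (p + s *\<^sub>R k) p = F p" using D_self[OF nz[OF s]] seg[OF s] p frontier_iff by simp
    qed
    then have "grad (p + s *\<^sub>R k) = grad p" by (simp add: grad_def)
    then show ?thesis using inner_normal_eq[OF p] inner_normal_eq[OF fr[OF s]] by simp
  qed
  define N where "N = frechet_derivative (inner_normal B) (at p within frontier B)"
  have N: "(inner_normal B has_derivative N) (at p within frontier B)"
    using inner_normal_differentiable[OF p] unfolding N_def by (simp add: frechet_derivative_works)
  \<comment> \<open>The segment stays in the frontier, so the chain rule applies to the derivative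
    within the frontier and determines the chosen \<open>N\<close> at the tangent vector
    \<open>k\<close>.\<close>
  have "((\<lambda>s. inner_normal B (p + s *\<^sub>R k)) has_derivative (\<lambda>s. N (s *\<^sub>R k))) (at 0 within I)"
  proof (rule has_derivative_in_compose[where f = "\<lambda>s. p + s *\<^sub>R k" and g = "inner_normal B" and g' = N])
    show "((\<lambda>s. p + s *\<^sub>R k) has_derivative (\<lambda>s. s *\<^sub>R k)) (at 0 within I)"
      by (auto intro!: derivative_eq_intros)
    show "(inner_normal B has_derivative N) (at (p + 0 *\<^sub>R k) within (\<lambda>s. p + s *\<^sub>R k) ` I)"
      by (rule has_derivative_subset[where s = "frontier B"]) (use N fr in \<open>auto simp: I_def\<close>)
  qed
  then have 1: "((\<lambda>s. inner_normal B (p + s *\<^sub>R k)) has_derivative (\<lambda>s. N (s *\<^sub>R k))) (at 0)"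
    using at_within_open[OF I(2,1)] by simp
  have 2: "((\<lambda>s. inner_normal B (p + s *\<^sub>R k)) has_derivative (\<lambda>s. 0)) (at 0)"
  proof (rule has_derivative_transform_within_open[OF _ I])
    show "((\<lambda>t. inner_normal B p) has_derivative (\<lambda>t. 0)) (at 0)" by simp
    show "inner_normal B p = inner_normal B (p + s *\<^sub>R k)" if "s \<in> I" for s
      using that const[of s] by (auto simp: I_def abs_less_iff)
  qed
  have "(\<lambda>s. N (s *\<^sub>R k)) = (\<lambda>s. 0)" by (rule has_derivative_unique[OF 1 2])
  then have "N (1 *\<^sub>R k) = 0" by metis
  then have "second_fundamental_form B p k k = 0" by (simp add: second_fundamental_form_def N_def)
  moreover have "k \<in> tangent_space (frontier B) p" using Dk[of 0] e tangent_space_frontier[OF p] by simp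
  ultimately show False using pos_def[OF p _ k] by simp
qed

end

section \<open>Planes near a given plane\<close>

text \<open>Stated by coefficients because \<open>independent {u, v}\<close> does not exclude
  \<open>u = v\<close>.\<close>

definition lin_indep2 :: "'a::real_vector \<Rightarrow> 'a \<Rightarrow> bool" where
  "lin_indep2 u v \<longleftrightarrow> (\<forall>x y. x *\<^sub>R u + y *\<^sub>R v = 0 \<longrightarrow> x = 0 \<and> y = 0)"

lemma lin_indep2_independent:
  assumes "lin_indep2 u v"
  shows "u \<noteq> v" "independent {u, v}"
proof -
  have u: "u \<noteq> k *\<^sub>R v" for k
  proof
    assume "u = k *\<^sub>R v"
    then have "1 *\<^sub>R u + (- k) *\<^sub>R v = 0" by simp
    then show False using assms unfolding lin_indep2_def by fastforce
  qed
  have "v \<noteq> 0"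
  proof
    assume "v = 0"
    then have "0 *\<^sub>R u + 1 *\<^sub>R v = 0" by simp
    then show False using assms unfolding lin_indep2_def by fastforce
  qed
  then show "independent {u, v}" using u by (auto simp: independent_insert span_singleton)
  show "u \<noteq> v" using u[of 1] by simp
qed

text \<open>Injectivity of the coefficient map is quantitative,
  \<open>m * norm w \<le> norm (L w)\<close>. Moving each vector by less than \<open>m / 2\<close>
  changes \<open>L w\<close> by less than \<open>m * norm w\<close> for nonzero
  \<open>w\<close>.\<close>

lemma lin_indep2_open:
  fixes h1 h2 :: "'a::euclidean_space"
  assumes "lin_indep2 h1 h2"
  obtains \<delta> where "\<delta> > 0" "\<And>u v. u \<in> ball h1 \<delta> \<Longrightarrow> v \<in> ball h2 \<delta> \<Longrightarrow> lin_indep2 u v"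
proof -
  define L where "L = (\<lambda>(x :: real, y :: real). x *\<^sub>R h1 + y *\<^sub>R h2)"
  have L: "linear L" unfolding L_def by (rule linearI) (auto simp: algebra_simps)
  have "inj L"
    using linear_injective_0[OF L] assms by (auto simp: L_def lin_indep2_def zero_prod_def)
  then obtain m where m: "m > 0" "\<And>w. m * norm w \<le> norm (L w)"
    using linear_inj_bounded_below_pos[OF L] by blast
  have "lin_indep2 u v" if uv: "u \<in> ball h1 (m / 2)" "v \<in> ball h2 (m / 2)" for u v
    unfolding lin_indep2_def
  proof (intro allI impI)
    fix x y :: real assume xy: "x *\<^sub>R u + y *\<^sub>R v = 0"
    have nx: "\<bar>x\<bar> \<le> norm (x, y)" "\<bar>y\<bar> \<le> norm (x, y)"
      using norm_fst_le[of x y] norm_snd_le[of y x] by auto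
    have "L (x, y) = x *\<^sub>R (h1 - u) + y *\<^sub>R (h2 - v)" using xy by (simp add: L_def algebra_simps)
    then have "norm (L (x, y)) \<le> \<bar>x\<bar> * norm (h1 - u) + \<bar>y\<bar> * norm (h2 - v)"
      using norm_triangle_ineq[of "x *\<^sub>R (h1 - u)" "y *\<^sub>R (h2 - v)"] by simp
    also have "\<dots> \<le> norm (x, y) * norm (h1 - u) + norm (x, y) * norm (h2 - v)"
      using nx by (intro add_mono mult_right_mono) auto
    finally have "m * norm (x, y) \<le> norm (x, y) * (norm (h1 - u) + norm (h2 - v))"
      using m(2)[of "(x, y)"] by (simp add: distrib_left)
    moreover have "norm (h1 - u) + norm (h2 - v) < m" using uv by (simp add: dist_norm)
    ultimately have "norm (x, y) = 0"
      by (smt (verit) mult.commute mult_less_cancel_left_pos norm_ge_zero)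
    then have "(x, y) = 0" by simp
    then show "x = 0 \<and> y = 0" by (simp add: zero_prod_def)
  qed
  then show ?thesis using that[of "m / 2"] m(1) by simp
qed

lemma frame_of_pair:
  assumes "lin_indep2 u v"
  defines "b \<equiv> restrict (\<lambda>i :: nat. if i = 0 then u else v) {..<2}"
  shows "b \<in> frames 2" "b ` {..<2} = {u, v}"
proof -
  have two: "{..<2 :: nat} = {0, 1}" by auto
  show im: "b ` {..<2} = {u, v}" by (auto simp: b_def two)
  have "inj_on b {..<2}"
    using lin_indep2_independent(1)[OF assms(1)] by (auto simp: inj_on_def b_def two)
  then show "b \<in> frames 2"
    using lin_indep2_independent(2)[OF assms(1)] im by (auto simp: frames_def b_def)
qed

text \<open>Open sets of the quotient pull back to open sets of frames, and a neighbourhood of a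
  frame in the product topology contains a product of balls.\<close>

lemma grassmannian_neighbourhood:
  fixes h1 h2 :: "'a::euclidean_space"
  assumes U: "openin (grassmannian_topology 2) \<U>" and HU: "span {h1, h2} \<in> \<U>" and h: "lin_indep2 h1 h2"
  obtains \<delta> where "\<delta> > 0"
    "\<And>u v. u \<in> ball h1 \<delta> \<Longrightarrow> v \<in> ball h2 \<delta> \<Longrightarrow> lin_indep2 u v \<and> span {u, v} \<in> \<U>"
proof -
  obtain T where T: "openin (product_topology (\<lambda>_. euclidean) {..<2}) T"
    and eq: "{b \<in> frames 2. span (b ` {..<2}) \<in> \<U>} = T \<inter> frames 2"
    using U unfolding openin_grassmannian_topology frame_topology_def openin_subtopology by blast
  have two: "{..<2 :: nat} = {0, 1}" by auto
  define b where "b u v = restrict (\<lambda>i :: nat. if i = 0 then u else v) {..<2}" for u v :: 'a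
  have fr: "b u v \<in> frames 2" "b u v ` {..<2} = {u, v}" if "lin_indep2 u v" for u v
    unfolding b_def using frame_of_pair[OF that] by blast+
  have "b h1 h2 \<in> T" using fr[OF h] HU eq by auto
  moreover have "\<forall>x\<in>T. \<exists>X. (\<forall>i\<in>{..<2}. open (X i)) \<and> x \<in> Pi\<^sub>E {..<2} X \<and> Pi\<^sub>E {..<2} X \<subseteq> T"
    using T unfolding openin_product_topology_alt by simp
  ultimately obtain X where X: "\<forall>i\<in>{..<2}. open (X i)" "b h1 h2 \<in> Pi\<^sub>E {..<2} X" "Pi\<^sub>E {..<2} X \<subseteq> T"
    by blast
  have "h1 \<in> X 0" "h2 \<in> X 1" using X(2) by (auto simp: b_def two PiE_iff)
  then obtain d1 d2 where d: "d1 > 0" "ball h1 d1 \<subseteq> X 0" "d2 > 0" "ball h2 d2 \<subseteq> X 1"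
    using X(1) unfolding two by (meson insertCI openE)
  obtain d0 where d0: "d0 > 0" "\<And>u v. u \<in> ball h1 d0 \<Longrightarrow> v \<in> ball h2 d0 \<Longrightarrow> lin_indep2 u v"
    using lin_indep2_open[OF h] by metis
  define \<delta> where "\<delta> = min d0 (min d1 d2)"
  have "lin_indep2 u v \<and> span {u, v} \<in> \<U>" if "u \<in> ball h1 \<delta>" "v \<in> ball h2 \<delta>" for u v
  proof -
    have uv: "lin_indep2 u v" using that by (intro d0(2)) (auto simp: \<delta>_def)
    have "u \<in> X 0" "v \<in> X 1" using that d(2,4) by (auto simp: \<delta>_def)
    then have "b u v \<in> Pi\<^sub>E {..<2} X" by (auto simp: b_def two PiE_iff)
    then have "b u v \<in> T" using X(3) by blast
    then have "b u v \<in> {b \<in> frames 2. span (b ` {..<2}) \<in> \<U>}" using fr(1)[OF uv] eq by blast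
    then show ?thesis using fr(2)[OF uv] uv by simp
  qed
  moreover have "\<delta> > 0" using d d0 by (simp add: \<delta>_def)
  ultimately show ?thesis using that by blast
qed

text \<open>The linear equivalence commutes with scaling, so it respects all sublevel sets and hence
  preserves \<open>F\<close> on \<open>H\<close>. The vectors \<open>a\<close> and \<open>c\<close>
  are preimages of \<open>u\<close> and \<open>v\<close>.\<close>

lemma (in pointed_body) linearly_equivalent_sections_gauge:
  assumes eq: "linearly_equivalent_sections B H H'" and H: "subspace H" and uv: "u \<in> H'" "v \<in> H'"
  shows "\<exists>a\<in>H. \<exists>c\<in>H. \<forall>x y. F (x *\<^sub>R u + y *\<^sub>R v) = F (x *\<^sub>R a + y *\<^sub>R c)"
proof -
  obtain f where f: "linear f" "bij_betw f H H'" "f ` (H \<inter> B) = H' \<inter> B"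
    using eq unfolding linearly_equivalent_sections_def by blast
  interpret f: linear f by fact
  have inj: "inj_on f H" and im: "f ` H = H'" using f(2) by (auto simp: bij_betw_def)
  have Ff: "F (f w) = F w" if w: "w \<in> H" for w
  proof (rule eq_if_same_upper_bounds[OF F_nonneg F_nonneg])
    fix s :: real assume s: "s > 0"
    have wH: "w /\<^sub>R s \<in> H" using w H by (simp add: subspace_scale)
    have "f (w /\<^sub>R s) \<in> B \<longleftrightarrow> w /\<^sub>R s \<in> B"
    proof
      assume "w /\<^sub>R s \<in> B"
      then show "f (w /\<^sub>R s) \<in> B" using f(3) wH by blast
    next
      assume "f (w /\<^sub>R s) \<in> B"
      then have "f (w /\<^sub>R s) \<in> f ` (H \<inter> B)" using f(3) im wH by blast
      then obtain w' where "w' \<in> H \<inter> B" "f (w /\<^sub>R s) = f w'" by blast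
      then show "w /\<^sub>R s \<in> B" using inj wH by (auto dest: inj_onD)
    qed
    then show "(F (f w) \<le> s) = (F w \<le> s)"
      using F_le_iff[OF s, of w] F_le_iff[OF s, of "f w"] by (simp add: f.scaleR)
  qed
  obtain a c where ac: "a \<in> H" "f a = u" "c \<in> H" "f c = v" using uv im by blast
  have "F (x *\<^sub>R u + y *\<^sub>R v) = F (x *\<^sub>R a + y *\<^sub>R c)" for x y
    using Ff[of "x *\<^sub>R a + y *\<^sub>R c"] ac H by (simp add: f.add f.scaleR subspace_add subspace_scale)
  then show ?thesis using ac by blast
qed

section \<open>The ellipse, the ellipsoid and the open set around \<open>H\<close>\<close>

theorem theorem1:
  fixes B H :: "(real ^ 'n) set"
    and \<W> :: "(real ^ 'n) set set"
  assumes "CARD('n) \<ge> 3"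
    and "convex_body B"
    and "smooth_strictly_convex_boundary B"
    and "0 \<in> interior B"
    and "H \<in> grassmannian 2"
    and "\<W> \<subseteq> grassmannian 2"
    and "\<exists>\<U>. openin (grassmannian_topology 2) \<U> \<and> H \<in> \<U> \<and> \<U> \<subseteq> \<W>"
    and "\<forall>H'\<in>\<W>. linearly_equivalent_sections B H H'"
  shows "solid_ellipse_in H 0 (H \<inter> B) \<and>
    (\<exists>E W. solid_ellipsoid E \<and> open W \<and> H \<subseteq> W \<and> B \<inter> W = E \<inter> W)"
proof -
  interpret smooth_body B
    using assms(2,3,4) by unfold_locales (auto simp: convex_body_def smooth_strictly_convex_boundary_def)
  have H: "subspace H" "dim H = 2" using assms(5) by (auto simp: grassmannian_def)
  obtain \<U> where U: "openin (grassmannian_topology 2) \<U>" "H \<in> \<U>" "\<U> \<subseteq> \<W>" using assms(7) by blast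
  obtain S where S: "S \<subseteq> H" "independent S" "H \<subseteq> span S" "card S = 2"
    using basis_exists[of H] H(2) by metis
  then obtain h1 h2 where h: "S = {h1, h2}" "h1 \<noteq> h2" by (auto simp: card_2_iff)
  have spanS: "span {h1, h2} = H" using S H h by (metis span_subspace)
  define J where "J z = Re z *\<^sub>R h1 + Im z *\<^sub>R h2" for z
  have J: "linear J" by (rule linearI) (auto simp: J_def algebra_simps)
  interpret J: linear J by (rule J)
  have J0: "z = 0" if "J z = 0" for z
  proof -
    have i: "h1 \<notin> span {h2}" "h2 \<noteq> 0" using S(2) h by (auto simp: independent_insert)
    have "Re z = 0"
    proof (rule ccontr)
      assume r: "Re z \<noteq> 0"
      have "Re z *\<^sub>R h1 = - (Im z *\<^sub>R h2)" using that by (simp add: J_def eq_neg_iff_add_eq_0)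
      then have "h1 = (- Im z / Re z) *\<^sub>R h2"
        using r by (metis (no_types, opaque_lifting) divide_inverse_commute scaleR_minus_left scaleR_one scaleR_scaleR left_inverse)
      then show False using i(1) by (metis span_base span_scale singletonI)
    qed
    moreover from this have "Im z = 0" using that i(2) by (simp add: J_def)
    ultimately show ?thesis by (simp add: complex_eq_iff)
  qed
  have JH: "range J = H"
  proof
    show "range J \<subseteq> H" using S(1) h H(1) by (auto simp: J_def intro!: subspace_add subspace_scale)
    show "H \<subseteq> range J"
    proof
      fix x assume "x \<in> H"
      then obtain k l where "x = k *\<^sub>R h1 + l *\<^sub>R h2"
        unfolding spanS[symmetric] span_insert span_singleton by (auto simp: algebra_simps)
      then have "x = J (Complex k l)" by (simp add: J_def)
      then show "x \<in> range J" by blast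
    qed
  qed
  \<comment> \<open>Dimension at least three leaves room for a direction \<open>b\<close> transverse
    to \<open>H\<close>.\<close>
  have "H \<noteq> UNIV"
  proof
    assume "H = UNIV"
    then have "dim H = CARD('n)" by (simp add: dim_UNIV)
    then show False using H(2) assms(1) by simp
  qed
  then obtain b where b: "b \<notin> H" by blast
  have inj: "z = 0 \<and> t = 0" if z: "J z + t *\<^sub>R b = 0" for z t
  proof -
    have "t = 0"
    proof (rule ccontr)
      assume t: "t \<noteq> 0"
      have "t *\<^sub>R b = J (- z)" using z by (simp add: J.neg eq_neg_iff_add_eq_0 add.commute)
      then have "t *\<^sub>R b \<in> H" using JH by blast
      then have "inverse t *\<^sub>R (t *\<^sub>R b) \<in> H" by (rule subspace_scale[OF H(1)])
      then show False using b t by simp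
    qed
    then show ?thesis using z J0 by simp
  qed
  have sec: "\<exists>\<delta>>0. \<forall>u\<in>ball (J z1) \<delta>. \<forall>v\<in>ball (J z2) \<delta>.
       \<exists>a c. \<forall>x y. F (x *\<^sub>R u + y *\<^sub>R v) = F (J (x *\<^sub>R a + y *\<^sub>R c))" if z: "Im (cnj z1 * z2) \<noteq> 0" for z1 z2
  proof -
    have li: "lin_indep2 (J z1) (J z2)"
      unfolding lin_indep2_def
    proof (intro allI impI)
      fix x y assume "x *\<^sub>R J z1 + y *\<^sub>R J z2 = 0"
      then have "J (x *\<^sub>R z1 + y *\<^sub>R z2) = 0" by (simp add: J.add J.scaleR)
      then have "x *\<^sub>R z1 + y *\<^sub>R z2 = 0" by (rule J0)
      then have e: "x * Re z1 + y * Re z2 = 0" "x * Im z1 + y * Im z2 = 0" by (auto simp: complex_eq_iff)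
      have d: "Im (cnj z1 * z2) = Re z1 * Im z2 - Im z1 * Re z2" by simp
      have "x * Im (cnj z1 * z2) = 0" "y * Im (cnj z1 * z2) = 0" unfolding d using e by algebra+
      then show "x = 0 \<and> y = 0" using z by simp
    qed
    have "span {J z1, J z2} = H"
    proof (rule antisym)
      show "span {J z1, J z2} \<subseteq> H" using JH H(1) by (intro span_minimal) auto
      show "H \<subseteq> span {J z1, J z2}"
        by (rule card_ge_dim_independent) (use JH lin_indep2_independent[OF li] H(2) in auto)
    qed
    then have "span {J z1, J z2} \<in> \<U>" using U(2) by simp
    then obtain \<delta> where \<delta>: "\<delta> > 0" "\<And>u v. u \<in> ball (J z1) \<delta> \<Longrightarrow> v \<in> ball (J z2) \<delta> \<Longrightarrow> lin_indep2 u v \<and> span {u, v} \<in> \<U>"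
      using grassmannian_neighbourhood[OF U(1) _ li] by metis
    have "\<exists>a c. \<forall>x y. F (x *\<^sub>R u + y *\<^sub>R v) = F (J (x *\<^sub>R a + y *\<^sub>R c))"
      if "u \<in> ball (J z1) \<delta>" "v \<in> ball (J z2) \<delta>" for u v
    proof -
      have "linearly_equivalent_sections B H (span {u, v})" using \<delta>(2)[OF that] U(3) assms(8) by blast
      from linearly_equivalent_sections_gauge[OF this H(1), of u v]
      obtain a c where ac: "a \<in> H" "c \<in> H" "\<And>x y. F (x *\<^sub>R u + y *\<^sub>R v) = F (x *\<^sub>R a + y *\<^sub>R c)"
        by (auto simp: span_base)
      then obtain a' c' where "a = J a'" "c = J c'" using JH by blast
      then show ?thesis using ac(3) by (intro exI[of _ a'] exI[of _ c']) (simp add: J.add J.scaleR)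
    qed
    then show ?thesis using \<delta>(1) by blast
  qed
  have strict: "\<nexists>x k e. x \<noteq> 0 \<and> k \<noteq> 0 \<and> e > 0 \<and> (\<forall>s. \<bar>s\<bar> < e \<longrightarrow> F (x + s *\<^sub>R k) = F x)"
    by (rule no_flat_segment) (use assms(3) in \<open>auto simp: smooth_strictly_convex_boundary_def\<close>)
  obtain Q where Q: "bilinear Q" and sym: "\<And>x y. Q x y = Q y x" and pos: "\<And>x. x \<noteq> 0 \<Longrightarrow> Q x x > 0"
    and FQ: "\<And>z. z \<noteq> 0 \<Longrightarrow> \<exists>e>0. \<forall>v\<in>ball (J z) e. (F v)\<^sup>2 = Q v v"
    using sections_equivalent_imp_quadratic[OF strict J inj sec] by blast
  have le1: "F x \<le> 1 \<longleftrightarrow> (F x)\<^sup>2 \<le> 1" for x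
    using nonneg[of x] by (simp add: power2_le_iff_abs_le abs_square_le_1)
  have Q0: "Q 0 0 = 0" by (rule bilinear_lzero[OF Q])
  have near: "x \<in> interior {x. (F x)\<^sup>2 = Q x x}" if x: "x \<in> H" "x \<noteq> 0" for x
  proof -
    obtain z where z: "x = J z" using x(1) JH by blast
    then have "z \<noteq> 0" using x(2) by auto
    then obtain e where "e > 0" "\<forall>v\<in>ball x e. (F v)\<^sup>2 = Q v v" using FQ z by blast
    then show ?thesis unfolding mem_interior by blast
  qed
  have "H \<inter> B = {x \<in> H. Q x x \<le> 1}"
  proof -
    have "x \<in> B \<longleftrightarrow> Q x x \<le> 1" if "x \<in> H" for x
    proof (cases "x = 0")
      case False
      then have "(F x)\<^sup>2 = Q x x" using near[OF that] interior_subset by blast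
      then show ?thesis using le1[of x] mem_iff by simp
    qed (use zero_in Q0 in simp)
    then show ?thesis by blast
  qed
  then have ellipse: "solid_ellipse_in H 0 (H \<inter> B)"
    unfolding solid_ellipse_in_def using H solid_ellipsoid_in_sublevel[OF Q sym pos H(1)] by simp
  define E where "E = {x \<in> UNIV. Q x x \<le> 1}"
  have E: "solid_ellipsoid E"
    unfolding solid_ellipsoid_def E_def using solid_ellipsoid_in_sublevel[OF Q sym pos subspace_UNIV] by blast
  \<comment> \<open>Agreement of \<open>F\<^sup>2\<close> with \<open>Q\<close> is known only near
    nonzero points of \<open>H\<close>. Around \<open>0\<close> the set \<open>V\<close> takes over,
    all of whose points lie in both \<open>B\<close> and \<open>E\<close>.\<close>
  define V where "V = {x. F x < 1} \<inter> {x. Q x x < 1}"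
  define W where "W = interior {x. (F x)\<^sup>2 = Q x x} \<union> V"
  have "continuous_on UNIV (\<lambda>x. Q x x)"
    using Q by (intro bounded_bilinear.continuous_on[of Q] continuous_on_id)
      (simp add: bilinear_conv_bounded_bilinear)
  then have "open V" unfolding V_def
    by (intro open_Int open_Collect_less continuous_on_gauge continuous_on_const)
  then have "open W" by (auto simp: W_def)
  moreover have "H \<subseteq> W"
  proof
    fix x assume "x \<in> H"
    then show "x \<in> W" using near[of x] Q0 by (cases "x = 0") (auto simp: W_def V_def)
  qed
  moreover have "x \<in> B \<longleftrightarrow> x \<in> E" if "x \<in> W" for x
  proof -
    from that consider "(F x)\<^sup>2 = Q x x" | "F x < 1" "Q x x < 1"
      unfolding W_def V_def using interior_subset by blast
    then show ?thesis using le1[of x] mem_iff[of x] by cases (auto simp: E_def)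
  qed
  ultimately show ?thesis using ellipse E by blast
qed

end
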